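(* Let $\hat{\lambda}\vdash\infty$, $\hat{M}\in\operatorname{SSYT}(\hat{\lambda})$, and $\hat{C}\in\operatorname{CCT}(\hat{\lambda})$. (i) The space $V_{\hat{M}}$ has $\{F_{\hat{M},\hat{T}}\mid\hat{T}\in\operatorname{SYT}(\hat{\lambda})\}$ as a basis. For every finite set $I\subseteq\mathbb{N}$ containing $\operatorname{Dsp}^{c}(\hat{C})$, the set $\{F_{\hat{C},\hat{T}}^{I}\mid\hat{T}\in\operatorname{SYT}(\hat{\lambda})\}$ is a basis of $V_{\hat{C}}^{\vec{h}_{\hat{C}}^{I}}$; and for every finite multi-set $I$ of positive integers containing $\operatorname{Dsp}^{c}(\hat{C})$, the set $\{F_{\hat{C},\hat{T}}^{I,\mathrm{hom}}\mid\hat{T}\in\operatorname{SYT}(\hat{\lambda})\}$ is a basis of $V_{\hat{C}}^{\vec{h}(\hat{C},I)}$. (ii) $V_{\hat{M}}$, and $V_{\hat{C}}^{\vec{h}}$ for every vector $\vec{h}=\{h_r\}_{r\geq1}$ of non-negative integers with finitely many non-zero entries, are representations of both $S_{\mathbb{N}}$ and $S_\infty$. (iii) The isomorphism type of the representations in (ii) depends only on the shape $\hat{\lambda}$. (iv) The representations in (ii), of either group, are irreducible. (v) The irreducible representations associated with different infinite Ferrers diagrams $\hat{\lambda}\vdash\infty$ are not isomorphic.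
   Context: Ring and groups. $\mathbb{Q}[[\mathbf{x}_\infty]]$: formal power series over $\mathbb{Q}$ in $x_1,x_2,\ldots$. $S_{\mathbb{N}}$: all permutations of $\mathbb{N}=\{1,2,\ldots\}$, acting by permuting variables; $S_n\subset S_{\mathbb{N}}$ fixes all $m>n$; $S_\infty=\bigcup_nS_n$. Representations are over $\mathbb{Q}$. $e_r$ is the $r$th elementary symmetric function in all variables, $e_0=1$. Infinite tableaux. $\hat{\lambda}\vdash\infty$ is a Ferrers diagram with infinite first row, the remaining rows forming a finite partition diagram (the finite part). $\operatorname{SYT}(\hat{\lambda})$: standard fillings by $\mathbb{N}$, each number used once. $\hat{M}\in\operatorname{SSYT}(\hat{\lambda})$: a semi-standard filling of the finite part by positive integers, plus a multiplicity $m_h\geq0$ for each $h>0$, finitely many non-zero (thought of as entries at infinity in the first row, after infinitely many zeros). The content of $\hat{M}$ is the multi-set in which each $h>0$ appears $m_h$ plus its number of occurrences in the finite part. $\operatorname{Dsp}^{c}(\hat{M})$ is the multi-set consisting, for each $1\leq h\leq$ (maximal entry of the content), of the number of entries of the content that are $\geq h$. $\operatorname{CCT}(\hat{\lambda})$: those $\hat{C}\in\operatorname{SSYT}(\hat{\lambda})$ such that every $h$ with $m_h>0$ appears in the finite part, and for every $h>0$ in the finite part either its leftmost instance there lies in a row below an instance of $h-1$ in the finite part or $h-1$ has positive multiplicity ($0$ being regarded as having infinite multiplicity); then $\operatorname{Dsp}^{c}(\hat{C})$ is a finite set. A multi-set $I$ contains a set $D$ if every element of $D$ has positive multiplicity in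 $I$; $I\setminus D$ has these multiplicities reduced by one. Series. For $\hat{T}\in\operatorname{SYT}(\hat{\lambda})$, $R(\hat{T})$ and $C(\hat{T})$ are the subgroups of $S_{\mathbb{N}}$ preserving every row, resp. every column, of $\hat{T}$ ($C(\hat{T})$ is finite). Choose for each $h>0$ a set of $m_h$ numbers from the first row of $\hat{T}$, disjoint for different $h$; put $h_i=h$ if $i$ is chosen for $h$, $h_i=0$ for the other $i$ in the first row, and for $i$ in the finite part let $h_i$ be the entry of $\hat{M}$ in the box where $\hat{T}$ has $i$. $p_{\hat{M},\hat{T}}=\prod_ix_i^{h_i}$, and $F_{\hat{M},\hat{T}}=\sum_{\sigma\in C(\hat{T})}\operatorname{sgn}(\sigma)\,\sigma\big(\sum_{p}p\big)$, where $p$ runs over the $R(\hat{T})$-orbit of $p_{\hat{M},\hat{T}}$ (independent of choices). $V_{\hat{M}}$ is the $\mathbb{Q}$-span of all $F_{\hat{M},\hat{T}}$, $\hat{T}\in\operatorname{SYT}(\hat{\lambda})$. $V_{\hat{C}}^{\vec{h}}=V_{\hat{C}}\cdot\prod_{r\geq1}e_r^{h_r}$. For a finite multi-set $I$ of positive integers containing $\operatorname{Dsp}^{c}(\hat{C})$: $F_{\hat{C},\hat{T}}^{I,\mathrm{hom}}=F_{\hat{C},\hat{T}}\prod_{i\in I\setminus\operatorname{Dsp}^{c}(\hat{C})}e_i$, and $\vec{h}(\hat{C},I)$ is the vector whose $r$th entry is the multiplicity of $r$ in $I\setminus\operatorname{Dsp}^{c}(\hat{C})$. If $I$ is a set: $r_i=|\{j\in\mathbb{N}\setminus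 I:j<i\}|$ for $i\in I$, $F_{\hat{C},\hat{T}}^{I}=F_{\hat{C},\hat{T}}\prod_{i\in I\setminus\operatorname{Dsp}^{c}(\hat{C})}e_{r_i}$, and $\vec{h}_{\hat{C}}^{I}=\{h_r\}_{r\geq1}$ with $h_r=|\{i\in I\setminus\operatorname{Dsp}^{c}(\hat{C}):r_i=r\}|$. *)

theory Defs
  imports
    Complex_Main
    "HOL-Library.Poly_Mapping"
    "HOL-Library.Multiset"
    "HOL-Library.FuncSet"
    "HOL-Library.Countable_Set"
    "HOL-Combinatorics.Permutations"
begin

section \<open>Formal power series over the rationals in infinitely many variables\<close>

text \<open>
  A monomial is a finitely supported exponent vector \<open>nat \<Rightarrow>\<^sub>0 nat\<close>, and a series is an
  arbitrary coefficient function on monomials.  The variables are $x_1, x_2, \ldots$: the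
  type also offers a variable $x_0$, but every group, monomial and series defined below is
  built from the indices \<open>{1..}\<close> only.
\<close>

type_synonym mono = "nat \<Rightarrow>\<^sub>0 nat"

typedef series = "UNIV :: (mono \<Rightarrow> rat) set"
  morphisms coeff Series ..

setup_lifting type_definition_series

lemma series_eqI: "(\<And>m. coeff f m = coeff g m) \<Longrightarrow> f = g"
  by (metis coeff_inject ext)

definition decomps :: "mono \<Rightarrow> (mono \<times> mono) set"
  where "decomps m = {(a, b). a + b = m}"

lemma finite_decomps: "finite (decomps m)"
proof -
  let ?K = "Poly_Mapping.keys m"
  let ?B = "PiE ?K (\<lambda>i. {..Poly_Mapping.lookup m i}) :: (nat \<Rightarrow> nat) set"
  let ?g = "\<lambda>(a::mono, b::mono). restrict (Poly_Mapping.lookup a) ?K"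
  have keys0: "Poly_Mapping.lookup a i = 0" if "a + b = m" "i \<notin> ?K" for a b :: mono and i
    using that by (metis add_is_0 in_keys_iff lookup_add)
  have "inj_on ?g (decomps m)"
  proof (rule inj_onI, clarify)
    fix a b c d :: mono
    assume ab: "(a, b) \<in> decomps m" and cd: "(c, d) \<in> decomps m"
      and eq: "restrict (Poly_Mapping.lookup a) ?K = restrict (Poly_Mapping.lookup c) ?K"
    have s: "a + b = m" "c + d = m" using ab cd by (auto simp: decomps_def)
    have "Poly_Mapping.lookup a i = Poly_Mapping.lookup c i" for i
    proof (cases "i \<in> ?K")
      case True
      then show ?thesis using fun_cong[OF eq, of i] by simp
    next
      case False
      then show ?thesis using s keys0 by metis
    qed
    then have "a = c" by (rule poly_mapping_eqI)
    then show "a = c \<and> b = d" using s by auto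
  qed
  moreover have "?g ` decomps m \<subseteq> ?B"
    by (auto simp: decomps_def PiE_iff lookup_add)
  moreover have "finite ?B" by (intro finite_PiE) auto
  ultimately show ?thesis by (meson finite_imageD finite_subset)
qed

instantiation series :: comm_ring_1
begin

lift_definition zero_series :: series is "\<lambda>_. 0" .
lift_definition one_series :: series is "\<lambda>m. if m = 0 then 1 else 0" .
lift_definition plus_series :: "series \<Rightarrow> series \<Rightarrow> series" is "\<lambda>f g m. f m + g m" .
lift_definition minus_series :: "series \<Rightarrow> series \<Rightarrow> series" is "\<lambda>f g m. f m - g m" .
lift_definition uminus_series :: "series \<Rightarrow> series" is "\<lambda>f m. - f m" .
lift_definition times_series :: "series \<Rightarrow> series \<Rightarrow> series"
  is "\<lambda>f g m. \<Sum>(a, b)\<in>decomps m. f a * g b" .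

instance
proof
  fix f g h :: series
  show "f * g * h = f * (g * h)"
  proof (rule series_eqI)
    fix m
    have "coeff (f * g * h) m =
        (\<Sum>(a, b)\<in>decomps m. \<Sum>(c, d)\<in>decomps a. coeff f c * coeff g d * coeff h b)"
      by (simp add: times_series.rep_eq sum_distrib_right case_prod_unfold)
    also have "\<dots> = (\<Sum>(x, y)\<in>(SIGMA x:decomps m. decomps (fst x)).
        coeff f (fst y) * coeff g (snd y) * coeff h (snd x))"
      by (simp add: case_prod_unfold sum.Sigma finite_decomps)
    also have "\<dots> = (\<Sum>(x, y)\<in>(SIGMA x:decomps m. decomps (snd x)).
        coeff f (fst x) * coeff g (fst y) * coeff h (snd y))"
      by (rule sum.reindex_bij_witness[where
            i = "\<lambda>(x, y). ((fst x + fst y, snd y), (fst x, fst y))" and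
            j = "\<lambda>(x, y). ((fst y, snd y + snd x), (snd y, snd x))"])
         (auto simp: decomps_def add.assoc)
    also have "\<dots> =
        (\<Sum>(a, b)\<in>decomps m. \<Sum>(c, d)\<in>decomps b. coeff f a * coeff g c * coeff h d)"
      by (simp add: case_prod_unfold sum.Sigma finite_decomps)
    also have "\<dots> = coeff (f * (g * h)) m"
      by (simp add: times_series.rep_eq sum_distrib_left case_prod_unfold mult.assoc)
    finally show "coeff (f * g * h) m = coeff (f * (g * h)) m" .
  qed
  show "f * g = g * f"
  proof (rule series_eqI)
    fix m
    show "coeff (f * g) m = coeff (g * f) m"
      unfolding times_series.rep_eq
      by (rule sum.reindex_bij_witness[where i = "\<lambda>(a, b). (b, a)" and j = "\<lambda>(a, b). (b, a)"])
         (auto simp: decomps_def add.commute mult.commute)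
  qed
  show "1 * f = f"
  proof (rule series_eqI)
    fix m
    have "coeff (1 * f) m = (\<Sum>x\<in>decomps m. if x = (0, m) then coeff f m else 0)"
      unfolding times_series.rep_eq one_series.rep_eq
      by (rule sum.cong) (auto simp: decomps_def split: if_splits)
    also have "\<dots> = coeff f m"
      using finite_decomps[of m] by (simp add: decomps_def)
    finally show "coeff (1 * f) m = coeff f m" .
  qed
  show "(f + g) * h = f * h + g * h"
    by (rule series_eqI)
       (simp add: times_series.rep_eq plus_series.rep_eq sum.distrib case_prod_unfold
          distrib_right)
  have "coeff 0 0 \<noteq> coeff 1 0"
    by (simp add: zero_series.rep_eq one_series.rep_eq)
  then show "(0::series) \<noteq> 1" by metis
qed (transfer, simp add: fun_eq_iff)+

end

lift_definition qscale :: "rat \<Rightarrow> series \<Rightarrow> series" is "\<lambda>c f m. c * f m" .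

interpretation qs: vector_space qscale
  by unfold_locales (transfer, simp add: fun_eq_iff algebra_simps)+

definition elem_sym :: "nat \<Rightarrow> series"
  where "elem_sym r = Series (\<lambda>m.
    if Poly_Mapping.keys m \<subseteq> {1..} \<and> card (Poly_Mapping.keys m) = r \<and>
      (\<forall>i\<in>Poly_Mapping.keys m. Poly_Mapping.lookup m i = 1) then 1 else 0)"

lemma elem_sym_0: "elem_sym 0 = 1"
  by (rule series_eqI) (auto simp: elem_sym_def Series_inverse one_series.rep_eq)

section \<open>Permutation groups, their action, and representations\<close>

definition S_nat :: "(nat \<Rightarrow> nat) set"
  where "S_nat = {\<sigma>. \<sigma> permutes {1..}}"

definition S_infty :: "(nat \<Rightarrow> nat) set"
  where "S_infty = (\<Union>n. {\<sigma>. \<sigma> permutes {1..n}})"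

text \<open>
  The permutation \<open>\<sigma>\<close> sends $x_i$ to $x_{\sigma(i)}$, so the exponent of $x_i$ in
  \<open>perm_mono \<sigma> m\<close> is the exponent of $x_{\sigma^{-1}(i)}$ in \<open>m\<close>.
\<close>

definition perm_mono :: "(nat \<Rightarrow> nat) \<Rightarrow> mono \<Rightarrow> mono"
  where "perm_mono \<sigma> m = Poly_Mapping.map_key (inv \<sigma>) m"

definition act :: "(nat \<Rightarrow> nat) \<Rightarrow> series \<Rightarrow> series"
  where "act \<sigma> f = Series (\<lambda>m. coeff f (perm_mono (inv \<sigma>) m))"

definition is_representation :: "(nat \<Rightarrow> nat) set \<Rightarrow> series set \<Rightarrow> bool"
  where "is_representation G V \<longleftrightarrow>
    qs.subspace V \<and>
    (\<forall>\<sigma>\<in>G. \<forall>v\<in>V. act \<sigma> v \<in> V) \<and>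
    (\<forall>\<sigma>\<in>G. \<forall>u\<in>V. \<forall>v\<in>V. act \<sigma> (u + v) = act \<sigma> u + act \<sigma> v) \<and>
    (\<forall>\<sigma>\<in>G. \<forall>c. \<forall>v\<in>V. act \<sigma> (qscale c v) = qscale c (act \<sigma> v)) \<and>
    (\<forall>v\<in>V. act id v = v) \<and>
    (\<forall>\<sigma>\<in>G. \<forall>\<tau>\<in>G. \<forall>v\<in>V. act (\<sigma> \<circ> \<tau>) v = act \<sigma> (act \<tau> v))"

definition irreducible_rep :: "(nat \<Rightarrow> nat) set \<Rightarrow> series set \<Rightarrow> bool"
  where "irreducible_rep G V \<longleftrightarrow>
    is_representation G V \<and> V \<noteq> {0} \<and>
    (\<forall>W. W \<subseteq> V \<and> is_representation G W \<longrightarrow> W = {0} \<or> W = V)"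

definition isomorphic_reps :: "(nat \<Rightarrow> nat) set \<Rightarrow> series set \<Rightarrow> series set \<Rightarrow> bool"
  where "isomorphic_reps G V W \<longleftrightarrow>
    (\<exists>\<phi>. bij_betw \<phi> V W \<and>
      (\<forall>u\<in>V. \<forall>v\<in>V. \<phi> (u + v) = \<phi> u + \<phi> v) \<and>
      (\<forall>c. \<forall>v\<in>V. \<phi> (qscale c v) = qscale c (\<phi> v)) \<and>
      (\<forall>\<sigma>\<in>G. \<forall>v\<in>V. \<phi> (act \<sigma> v) = act \<sigma> (\<phi> v)))"

text \<open>
  Bases are indexed families, so distinct indices have to give distinct vectors.
\<close>

definition is_basis :: "('i \<Rightarrow> series) \<Rightarrow> 'i set \<Rightarrow> series set \<Rightarrow> bool"
  where "is_basis F A V \<longleftrightarrow>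
    inj_on F A \<and> qs.independent (F ` A) \<and> qs.span (F ` A) = V"

section \<open>Infinite Ferrers diagrams and tableaux\<close>

text \<open>
  A box is a pair (row, column), both counted from \<open>0\<close>, in English notation: a larger row
  index means further below.  Row \<open>0\<close> is the infinite one.
\<close>

type_synonym box = "nat \<times> nat"

definition finite_part :: "box set \<Rightarrow> box set"
  where "finite_part D = {b \<in> D. 0 < fst b}"

definition ferrers_infty :: "box set \<Rightarrow> bool"
  where "ferrers_infty D \<longleftrightarrow>
    (\<forall>j. (0, j) \<in> D) \<and> finite (finite_part D) \<and>
    (\<forall>i j i' j'. (i, j) \<in> D \<and> i' \<le> i \<and> j' \<le> j \<longrightarrow> (i', j') \<in> D)"

definition diagram_row :: "box set \<Rightarrow> nat \<Rightarrow> box set"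
  where "diagram_row D i = {b \<in> D. fst b = i}"

definition diagram_col :: "box set \<Rightarrow> nat \<Rightarrow> box set"
  where "diagram_col D j = {b \<in> D. snd b = j}"

text \<open>Fillings are \<open>extensional\<close>, so that equal fillings are equal functions.\<close>

definition SYT :: "box set \<Rightarrow> (box \<Rightarrow> nat) set"
  where "SYT D = {T \<in> extensional D.
    bij_betw T D {1..} \<and>
    (\<forall>i j j'. (i, j) \<in> D \<and> (i, j') \<in> D \<and> j < j' \<longrightarrow> T (i, j) < T (i, j')) \<and>
    (\<forall>i i' j. (i, j) \<in> D \<and> (i', j) \<in> D \<and> i < i' \<longrightarrow> T (i, j) < T (i', j))}"

text \<open>
  \<open>entries\<close> is the filling of the finite part; the multiplicities $m_h$ of the entries at
  infinity in the first row are the multiset \<open>at_infinity\<close>.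
\<close>

record infinite_ssyt =
  entries :: "box \<Rightarrow> nat"
  at_infinity :: "nat multiset"

definition SSYT :: "box set \<Rightarrow> infinite_ssyt set"
  where "SSYT D = {M.
    entries M \<in> extensional (finite_part D) \<and>
    (\<forall>b\<in>finite_part D. 0 < entries M b) \<and>
    (\<forall>i j j'. (i, j) \<in> finite_part D \<and> (i, j') \<in> finite_part D \<and> j < j' \<longrightarrow>
       entries M (i, j) \<le> entries M (i, j')) \<and>
    (\<forall>i i' j. (i, j) \<in> finite_part D \<and> (i', j) \<in> finite_part D \<and> i < i' \<longrightarrow>
       entries M (i, j) < entries M (i', j)) \<and>
    0 \<notin># at_infinity M}"

definition tableau_content :: "box set \<Rightarrow> infinite_ssyt \<Rightarrow> nat multiset"
  where "tableau_content D M = at_infinity M + image_mset (entries M) (mset_set (finite_part D))"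

text \<open>The inserted \<open>0\<close> only covers the empty content, which has no maximal entry.\<close>

definition Dspc :: "box set \<Rightarrow> infinite_ssyt \<Rightarrow> nat multiset"
  where "Dspc D M =
    image_mset (\<lambda>h. size (filter_mset (\<lambda>k. h \<le> k) (tableau_content D M)))
      (mset_set {1..Max (insert 0 (set_mset (tableau_content D M)))})"

definition leftmost_instance :: "box set \<Rightarrow> infinite_ssyt \<Rightarrow> nat \<Rightarrow> box \<Rightarrow> bool"
  where "leftmost_instance D M h b \<longleftrightarrow>
    b \<in> finite_part D \<and> entries M b = h \<and>
    (\<forall>b'\<in>finite_part D. entries M b' = h \<longrightarrow> snd b \<le> snd b')"

text \<open>The disjunct \<open>h = 1\<close> says that \<open>0\<close> has infinite multiplicity at infinity.\<close>

definition CCT :: "box set \<Rightarrow> infinite_ssyt set"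
  where "CCT D = {C \<in> SSYT D.
    set_mset (at_infinity C) \<subseteq> entries C ` finite_part D \<and>
    (\<forall>h\<in>entries C ` finite_part D.
       h = 1 \<or> h - 1 \<in># at_infinity C \<or>
       (\<exists>b. leftmost_instance D C h b \<and>
          (\<exists>b'\<in>finite_part D. entries C b' = h - 1 \<and> fst b' < fst b)))}"

text \<open>
  For \<open>C \<in> CCT D\<close> all multiplicities in \<open>Dspc D C\<close> are one, and this is \<open>Dspc D C\<close> as a set.
\<close>

definition Dspc_set :: "box set \<Rightarrow> infinite_ssyt \<Rightarrow> nat set"
  where "Dspc_set D C = set_mset (Dspc D C)"

section \<open>The series and the spaces they span\<close>

definition row_group :: "box set \<Rightarrow> (box \<Rightarrow> nat) \<Rightarrow> (nat \<Rightarrow> nat) set"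
  where "row_group D T = {\<sigma> \<in> S_nat. \<forall>i. \<sigma> ` T ` diagram_row D i = T ` diagram_row D i}"

definition col_group :: "box set \<Rightarrow> (box \<Rightarrow> nat) \<Rightarrow> (nat \<Rightarrow> nat) set"
  where "col_group D T = {\<sigma> \<in> S_nat. \<forall>j. \<sigma> ` T ` diagram_col D j = T ` diagram_col D j}"

text \<open>
  The exponent vectors $(h_i)_i$ arising from a choice of disjoint sets of $m_h$ numbers from
  the first row of \<open>T\<close>; the set chosen for \<open>h\<close> is \<open>{i \<in> T ` diagram_row D 0. lookup p i = h}\<close>.
\<close>

definition admissible_mono :: "box set \<Rightarrow> infinite_ssyt \<Rightarrow> (box \<Rightarrow> nat) \<Rightarrow> mono \<Rightarrow> bool"
  where "admissible_mono D M T p \<longleftrightarrow>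
    Poly_Mapping.lookup p 0 = 0 \<and>
    (\<forall>b\<in>finite_part D. Poly_Mapping.lookup p (T b) = entries M b) \<and>
    (\<forall>h>0. card {i \<in> T ` diagram_row D 0. Poly_Mapping.lookup p i = h} = count (at_infinity M) h)"

lemma inj_SYT: "T \<in> SYT D \<Longrightarrow> inj_on T D"
  by (auto simp: SYT_def bij_betw_def)

lemma SYT_pos: "T \<in> SYT D \<Longrightarrow> b \<in> D \<Longrightarrow> 1 \<le> T b"
  by (auto simp: SYT_def bij_betw_def)

lemma admissible_mono_exists:
  assumes D: "ferrers_infty D" and M: "M \<in> SSYT D" and T: "T \<in> SYT D"
  shows "\<exists>p. admissible_mono D M T p"
proof -
  have bij: "bij_betw T D {1..}" using T by (simp add: SYT_def)
  define xs where "xs = sorted_list_of_multiset (at_infinity M)"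
  have mxs: "mset xs = at_infinity M" by (simp add: xs_def)
  define c where "c b = (if fst b = 0 then if snd b < length xs then xs ! snd b else 0
    else entries M b)" for b :: box
  define g where "g i = (if 1 \<le> i then c (inv_into D T i) else 0)" for i
  have g: "g (T b) = c b" if "b \<in> D" for b
    using that SYT_pos[OF T that] inv_into_f_f[OF inj_SYT[OF T] that] by (simp add: g_def)
  have g0: "g 0 = 0" by (simp add: g_def)
  have fin: "finite {i. g i \<noteq> 0}"
  proof (rule finite_subset)
    show "{i. g i \<noteq> 0} \<subseteq> T ` (finite_part D \<union> {0} \<times> {..<length xs})"
    proof
      fix i assume i: "i \<in> {i. g i \<noteq> 0}"
      then have "i \<in> {1..}" by (auto simp: g_def split: if_splits)
      then have "i \<in> T ` D" using bij by (simp add: bij_betw_def)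
      then obtain b where b: "b \<in> D" "i = T b" by blast
      then have "c b \<noteq> 0" using i g by auto
      then show "i \<in> T ` (finite_part D \<union> {0} \<times> {..<length xs})"
        using b by (cases b) (auto simp: c_def finite_part_def split: if_splits)
    qed
    show "finite (T ` (finite_part D \<union> {0} \<times> {..<length xs}))"
      using D by (auto simp: ferrers_infty_def)
  qed
  define p where "p = Abs_poly_mapping g"
  have p: "Poly_Mapping.lookup p = g" using fin by (simp add: p_def)
  have "card {i \<in> T ` diagram_row D 0. g i = h} = count (at_infinity M) h" if "h > 0" for h
  proof -
    have "{i \<in> T ` diagram_row D 0. g i = h} = T ` Pair 0 ` {j. j < length xs \<and> xs ! j = h}"
      using that D g by (fastforce simp: diagram_row_def c_def ferrers_infty_def split: if_splits)
    also have "card \<dots> = card {j. j < length xs \<and> xs ! j = h}"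
      using D by (subst card_image card_image[OF inj_on_subset[OF inj_SYT[OF T]]],
          auto simp: ferrers_infty_def inj_on_def)+
    also have "\<dots> = length (filter (\<lambda>x. x = h) xs)"
      by (simp add: length_filter_conv_card)
    also have "\<dots> = count (mset xs) h"
      by (induction xs) simp_all
    finally show ?thesis by (simp add: mxs)
  qed
  moreover have "\<forall>b\<in>finite_part D. g (T b) = entries M b"
    by (auto simp: g finite_part_def c_def)
  ultimately show ?thesis using g0 p by (auto simp: admissible_mono_def)
qed

lemma admissible_mono_unique:
  assumes D: "ferrers_infty D" and T: "T \<in> SYT D"
    and p: "admissible_mono D M T p" and q: "admissible_mono D M T q"
  shows "\<exists>\<sigma>\<in>row_group D T. perm_mono \<sigma> p = q"
proof -
  let ?p = "Poly_Mapping.lookup p" and ?q = "Poly_Mapping.lookup q"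
  let ?R = "T ` diagram_row D 0"
  let ?P = "\<lambda>h. {i \<in> ?R. ?p i = h}" and ?Q = "\<lambda>h. {i \<in> ?R. ?q i = h}"
  have bijT: "bij_betw T D {1..}" using T by (simp add: SYT_def)
  have infR: "infinite ?R"
  proof
    assume "finite ?R"
    then have "finite (diagram_row D 0)"
      by (rule finite_imageD) (rule inj_on_subset[OF inj_SYT[OF T]], auto simp: diagram_row_def)
    moreover have "range (Pair 0) \<subseteq> diagram_row D 0"
      using D by (auto simp: ferrers_infty_def diagram_row_def)
    moreover have "infinite (range (Pair (0::nat) :: nat \<Rightarrow> box))"
      by (rule range_inj_infinite) (auto simp: inj_on_def)
    ultimately show False using finite_subset by blast
  qed
  have zero: "infinite {i \<in> ?R. Poly_Mapping.lookup r i = 0}" for r :: mono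
  proof
    assume "finite {i \<in> ?R. Poly_Mapping.lookup r i = 0}"
    then have "finite ({i \<in> ?R. Poly_Mapping.lookup r i = 0} \<union>
        {i. Poly_Mapping.lookup r i \<noteq> 0})" by simp
    then have "finite ?R" by (rule rev_finite_subset) auto
    then show False using infR by simp
  qed
  have "\<exists>f. bij_betw f (?P h) (?Q h)" for h
  proof (cases "h = 0")
    case True
    have "bij_betw (from_nat_into (?P 0)) UNIV (?P 0)" "bij_betw (from_nat_into (?Q 0)) UNIV (?Q 0)"
      using zero[of p] zero[of q] by (auto intro!: bij_betw_from_nat_into)
    then show ?thesis using True bij_betw_trans bij_betw_inv_into by blast
  next
    case False
    have fin: "finite (?P h)" "finite (?Q h)"
      using False by (auto intro: finite_subset[OF _ finite_lookup[of p]]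
          finite_subset[OF _ finite_lookup[of q]])
    have "card (?P h) = card (?Q h)"
      using p q False by (auto simp: admissible_mono_def)
    then show ?thesis using fin by (simp add: finite_same_card_bij)
  qed
  then obtain f where f: "\<And>h. bij_betw (f h) (?P h) (?Q h)" by metis
  define \<sigma> where "\<sigma> i = (if i \<in> ?R then f (?p i) i else i)" for i
  have sR: "\<sigma> i \<in> ?R" "?q (\<sigma> i) = ?p i" if "i \<in> ?R" for i
    using that bij_betwE[OF f[of "?p i"]] by (auto simp: \<sigma>_def)
  have bijR: "bij_betw \<sigma> ?R ?R"
  proof (rule bij_betw_imageI)
    show "inj_on \<sigma> ?R"
    proof (rule inj_onI)
      fix i j assume ij: "i \<in> ?R" "j \<in> ?R" "\<sigma> i = \<sigma> j"
      then have "?p i = ?p j" using sR by metis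
      moreover have "f (?p i) i = f (?p j) j" using ij by (simp add: \<sigma>_def)
      ultimately show "i = j" using f[of "?p i"] ij by (auto simp: bij_betw_def dest: inj_onD)
    qed
    show "\<sigma> ` ?R = ?R"
    proof
      show "\<sigma> ` ?R \<subseteq> ?R" using sR by blast
      show "?R \<subseteq> \<sigma> ` ?R"
      proof
        fix k assume k: "k \<in> ?R"
        then have "k \<in> f (?q k) ` ?P (?q k)" using f[of "?q k"] by (auto simp: bij_betw_def)
        then obtain i where i: "i \<in> ?R" "?p i = ?q k" "k = f (?q k) i" by blast
        then have "k = \<sigma> i" by (simp add: \<sigma>_def)
        then show "k \<in> \<sigma> ` ?R" using i by blast
      qed
    qed
  qed
  have perm: "\<sigma> permutes ?R" by (rule bij_imp_permutes[OF bijR]) (simp only: \<sigma>_def if_False)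
  have subR: "?R \<subseteq> {1..}" using bijT by (auto simp: bij_betw_def diagram_row_def)
  have pS: "\<sigma> \<in> S_nat" using permutes_subset[OF perm subR] by (simp add: S_nat_def)
  have "\<sigma> ` T ` diagram_row D i = T ` diagram_row D i" for i
  proof (cases "i = 0")
    case True
    then show ?thesis using bijR by (simp add: bij_betw_def)
  next
    case False
    have "T ` diagram_row D i \<inter> ?R = {}"
      using inj_SYT[OF T] False by (auto simp: diagram_row_def dest!: inj_onD)
    then have "\<sigma> x = x" if "x \<in> T ` diagram_row D i" for x
      using that by (auto simp: \<sigma>_def)
    then show ?thesis by (simp cong: image_cong_simp)
  qed
  then have RG: "\<sigma> \<in> row_group D T" using pS by (simp add: row_group_def)
  have bij: "bij \<sigma>" using perm by (rule permutes_bij)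
  have qp: "?q (\<sigma> i) = ?p i" for i
  proof (cases "i \<in> ?R")
    case True then show ?thesis by (rule sR)
  next
    case False
    then have s: "\<sigma> i = i" by (simp only: \<sigma>_def if_False)
    show ?thesis
    proof (cases "i = 0")
      case True then show ?thesis using p q s by (simp add: admissible_mono_def)
    next
      case i0: False
      then have "i \<in> T ` D" using bijT by (simp add: bij_betw_def)
      then obtain b where b: "b \<in> D" "i = T b" by blast
      then have "b \<in> finite_part D" using False by (auto simp: finite_part_def diagram_row_def)
      then show ?thesis using p q s b by (simp add: admissible_mono_def)
    qed
  qed
  have "perm_mono \<sigma> p = q"
  proof (rule poly_mapping_eqI)
    fix k
    have "Poly_Mapping.lookup (perm_mono \<sigma> p) k = ?p (inv \<sigma> k)"
      using bij by (simp add: perm_mono_def map_key.rep_eq bij_imp_bij_inv bij_is_inj)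
    also have "\<dots> = ?q k"
      using qp[of "inv \<sigma> k"] bij by (simp add: bij_is_surj surj_f_inv_f)
    finally show "Poly_Mapping.lookup (perm_mono \<sigma> p) k = ?q k" .
  qed
  then show ?thesis using RG by blast
qed

text \<open>
  By the two preceding lemmas the following choice exists, and its orbit under the row group
  does not depend on it.
\<close>

definition p_mono :: "box set \<Rightarrow> infinite_ssyt \<Rightarrow> (box \<Rightarrow> nat) \<Rightarrow> mono"
  where "p_mono D M T = (SOME p. admissible_mono D M T p)"

definition row_orbit :: "box set \<Rightarrow> infinite_ssyt \<Rightarrow> (box \<Rightarrow> nat) \<Rightarrow> mono set"
  where "row_orbit D M T = {perm_mono \<sigma> (p_mono D M T) | \<sigma>. \<sigma> \<in> row_group D T}"

text \<open>The formal, in general infinite, sum of a set of monomials.\<close>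

definition mono_sum :: "mono set \<Rightarrow> series"
  where "mono_sum A = Series (\<lambda>m. if m \<in> A then 1 else 0)"

definition F_series :: "box set \<Rightarrow> infinite_ssyt \<Rightarrow> (box \<Rightarrow> nat) \<Rightarrow> series"
  where "F_series D M T =
    (\<Sum>\<sigma>\<in>col_group D T. of_int (sign \<sigma>) * act \<sigma> (mono_sum (row_orbit D M T)))"

definition V_space :: "box set \<Rightarrow> infinite_ssyt \<Rightarrow> series set"
  where "V_space D M = qs.span (F_series D M ` SYT D)"

text \<open>
  A vector $\{h_r\}_{r \geq 1}$ is a function on \<open>nat\<close> whose value at \<open>0\<close> is irrelevant.
\<close>

definition finite_vec :: "(nat \<Rightarrow> nat) \<Rightarrow> bool"
  where "finite_vec h \<longleftrightarrow> finite {r. 1 \<le> r \<and> h r \<noteq> 0}"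

definition V_vec :: "box set \<Rightarrow> infinite_ssyt \<Rightarrow> (nat \<Rightarrow> nat) \<Rightarrow> series set"
  where "V_vec D C h =
    (\<lambda>v. v * (\<Prod>r\<in>{r. 1 \<le> r \<and> h r \<noteq> 0}. elem_sym r ^ h r)) ` V_space D C"

definition F_hom :: "box set \<Rightarrow> infinite_ssyt \<Rightarrow> nat multiset \<Rightarrow> (box \<Rightarrow> nat) \<Rightarrow> series"
  where "F_hom D C I T =
    F_series D C T * prod_mset (image_mset elem_sym (I - mset_set (Dspc_set D C)))"

definition h_hom :: "box set \<Rightarrow> infinite_ssyt \<Rightarrow> nat multiset \<Rightarrow> nat \<Rightarrow> nat"
  where "h_hom D C I r = count (I - mset_set (Dspc_set D C)) r"

definition r_idx :: "nat set \<Rightarrow> nat \<Rightarrow> nat"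
  where "r_idx I i = card {j \<in> {1..} - I. j < i}"

definition F_set :: "box set \<Rightarrow> infinite_ssyt \<Rightarrow> nat set \<Rightarrow> (box \<Rightarrow> nat) \<Rightarrow> series"
  where "F_set D C I T = F_series D C T * (\<Prod>i\<in>I - Dspc_set D C. elem_sym (r_idx I i))"

definition h_set :: "box set \<Rightarrow> infinite_ssyt \<Rightarrow> nat set \<Rightarrow> nat \<Rightarrow> nat"
  where "h_set D C I r = card {i \<in> I - Dspc_set D C. r_idx I i = r}"

definition shape_reps :: "box set \<Rightarrow> series set set"
  where "shape_reps D =
    {V_space D M | M. M \<in> SSYT D} \<union> {V_vec D C h | C h. C \<in> CCT D \<and> finite_vec h}"

end

theory Submission
  imports Defs
begin

text \<open>
  All the representations attached to a shape \<open>D\<close> are equivariant images of one module, an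
  infinite analogue of the Specht module.  A tabloid of shape \<open>D\<close> is encoded as the monomial
  whose exponent at \<open>n\<close> is the row of \<open>n\<close>; as only the first row is infinite, this is a finite
  monomial.  Column groups are finite, so each bijective filling \<open>T\<close> has a polytabloid, the signed
  sum of its tabloid over the column group, and the span of the polytabloids is the module
  \<open>specht\<close>.  For a semi-standard \<open>M\<close>, sending a tabloid to the sum of all monomials whose
  exponents in each of its rows are those prescribed by \<open>M\<close> defines the equivariant linear map
  \<open>tableau_hom M\<close>, which sends the polytabloid of a standard \<open>T\<close> to \<open>F_series D M T\<close>.  Hence \<open>V_space D M\<close>
  is the image of \<open>specht\<close> under this map, and \<open>V_vec D C h\<close> its image under \<open>tableau_hom C\<close>
  followed by multiplication with a product of elementary symmetric functions.  The theorem thus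
  reduces to statements about \<open>specht\<close>, provided that these maps are not zero on it.

  Basis.  Order tabloids by the sum of all numbers weighted by their rows.  By a rearrangement
  inequality the tabloid of a standard tableau is the strictly largest one in its polytabloid, so
  standard polytabloids are independent.  That they span (\<open>straightening\<close>) follows from a
  dual form of the Garnir relations (\<open>dual_garnir\<close>): a largest tabloid in any combination of
  polytabloids must be standard (\<open>leading_standard\<close>), and can be subtracted off.  In particular the
  span of the standard polytabloids is stable under all permutations, infinite ones included,
  since a polytabloid involves only finitely many variables.

  Irreducibility.  This is James's submodule theorem.  The signed column sum of \<open>T\<close> maps every
  combination of tabloids to a multiple of the polytabloid of \<open>T\<close> (\<open>column_sum_multiple\<close>),
  and positivity of the inner product on tabloids makes some column sum of a given non-zero vector
  non-zero.  Only finitary permutations are used, so both groups are covered at once.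

  Distinct shapes.  A column sum for \<open>D\<close> that is not zero on tabloids of shape \<open>D'\<close>
  yields an inequality between the numbers of boxes from any row on
  (\<open>specht_hom_dominance\<close>); an isomorphism gives the inequalities in both directions.

  Non-vanishing.  For standard \<open>T\<close>, the coefficient of \<open>F_series D M T\<close> is one at a monomial in
  the row orbit of \<open>T\<close> that strictly increases along the columns, again by the rearrangement inequality
  (\<open>F_series_nonzero\<close>), and the ring of series has no zero divisors
  (\<open>series_mult_nonzero\<close>).
\<close>

section \<open>Series without zero divisors\<close>

text \<open>The exponent of a variable in a monomial.\<close>

abbreviation expo :: "mono \<Rightarrow> nat \<Rightarrow> nat"
  where "expo \<equiv> Poly_Mapping.lookup"

lemma coeff_simps [simp]:
  "coeff 0 m = 0" "coeff (f + g) m = coeff f m + coeff g m"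
  "coeff (f - g) m = coeff f m - coeff g m" "coeff (- f) m = - coeff f m"
  "coeff (qscale c f) m = c * coeff f m"
  by (transfer, simp)+

lemma coeff_sum: "coeff (sum f A) m = (\<Sum>a\<in>A. coeff (f a) m)"
  by (induction A rule: infinite_finite_induct) auto

lemma coeff_Series [simp]: "coeff (Series f) m = f m"
  by (simp add: Series_inverse)

lemma coeff_mono_sum [simp]: "coeff (mono_sum A) m = (if m \<in> A then 1 else 0)"
  by (simp add: mono_sum_def)

lemma series_neq_0_iff: "f \<noteq> 0 \<longleftrightarrow> (\<exists>m. coeff f m \<noteq> 0)"
  by (metis coeff_simps(1) series_eqI)

text \<open>The total degree of a monomial.\<close>

definition mdeg :: "mono \<Rightarrow> nat"
  where "mdeg m = (\<Sum>i\<in>Poly_Mapping.keys m. expo m i)"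

lemma mdeg_eq: "finite A \<Longrightarrow> Poly_Mapping.keys m \<subseteq> A \<Longrightarrow> mdeg m = (\<Sum>i\<in>A. expo m i)"
  unfolding mdeg_def by (rule sum.mono_neutral_left) (auto simp: in_keys_iff)

lemma mdeg_add: "mdeg (a + b) = mdeg a + mdeg b"
proof -
  let ?A = "Poly_Mapping.keys a \<union> Poly_Mapping.keys b"
  have "Poly_Mapping.keys (a + b) \<subseteq> ?A" by (rule Poly_Mapping.keys_add)
  then show ?thesis
    by (simp add: mdeg_eq[of ?A] lookup_add sum.distrib)
qed

lemma finite_bounded_monos: "finite {m. Poly_Mapping.keys m \<subseteq> {..N} \<and> mdeg m = d}"
proof -
  define u where "u = (\<Sum>i\<le>N. Poly_Mapping.single i d)"
  have u: "expo u i = (if i \<le> N then d else 0)" for i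
    by (simp add: u_def lookup_sum lookup_single when_def)
  have "{m. Poly_Mapping.keys m \<subseteq> {..N} \<and> mdeg m = d} \<subseteq> fst ` decomps u"
  proof
    fix m assume m: "m \<in> {m. Poly_Mapping.keys m \<subseteq> {..N} \<and> mdeg m = d}"
    have "expo m i \<le> expo u i" for i
    proof (cases "i \<in> Poly_Mapping.keys m")
      case True
      have "expo m i \<le> mdeg m"
        unfolding mdeg_def by (rule member_le_sum) (use True in auto)
      then show ?thesis using m True by (auto simp: u)
    qed (simp add: in_keys_iff)
    then have "m + (u - m) = u"
      by (intro poly_mapping_eqI) (simp add: lookup_add lookup_minus)
    then show "m \<in> fst ` decomps u"
      by (force simp: decomps_def)
  qed
  then show ?thesis using finite_decomps finite_subset by blast
qed

text \<open>
  A product does not vanish at the product of the leading monomials of its factors, where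
  leading means: of lowest degree, and lexicographically largest among the monomials of that
  degree in the variables up to index \<open>N\<close>.  A factorization of that product involves only these
  variables, so the remaining ones do no harm.
\<close>

lemma series_mult_nonzero:
  fixes f g :: series
  assumes "f \<noteq> 0" "g \<noteq> 0"
  shows "f * g \<noteq> 0"
proof -
  have min: "\<exists>m. coeff f m \<noteq> 0 \<and> (\<forall>m'. coeff f m' \<noteq> 0 \<longrightarrow> mdeg m \<le> mdeg m')"
    if "f \<noteq> 0" for f :: series
    using that ex_has_least_nat[of "\<lambda>m. coeff f m \<noteq> 0" _ mdeg]
    unfolding series_neq_0_iff by blast
  obtain a0 where a0: "coeff f a0 \<noteq> 0" "\<And>m. coeff f m \<noteq> 0 \<Longrightarrow> mdeg a0 \<le> mdeg m"
    using min[OF assms(1)] by blast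
  obtain b0 where b0: "coeff g b0 \<noteq> 0" "\<And>m. coeff g m \<noteq> 0 \<Longrightarrow> mdeg b0 \<le> mdeg m"
    using min[OF assms(2)] by blast
  \<comment> \<open>restricting the variables leaves finitely many monomials, so that maxima exist\<close>
  obtain N where N: "Poly_Mapping.keys a0 \<union> Poly_Mapping.keys b0 \<subseteq> {..N}"
    using finite_nat_iff_bounded_le[of "Poly_Mapping.keys a0 \<union> Poly_Mapping.keys b0"] by auto
  define A where "A = {m. coeff f m \<noteq> 0 \<and> Poly_Mapping.keys m \<subseteq> {..N} \<and> mdeg m = mdeg a0}"
  define B where "B = {m. coeff g m \<noteq> 0 \<and> Poly_Mapping.keys m \<subseteq> {..N} \<and> mdeg m = mdeg b0}"
  have fin: "finite A" "finite B"
    unfolding A_def B_def by (auto intro: finite_subset[OF _ finite_bounded_monos])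
  have ne: "A \<noteq> {}" "B \<noteq> {}" using a0 b0 N by (auto simp: A_def B_def)
  let ?a = "Max A" and ?b = "Max B"
  have ab: "?a \<in> A" "?b \<in> B" using fin ne by auto
  have only: "a = ?a \<and> b = ?b"
    if eq: "a + b = ?a + ?b" and nz: "coeff f a \<noteq> 0" "coeff g b \<noteq> 0" for a b
  proof -
    have "expo a i = 0 \<and> expo b i = 0" if "i > N" for i
    proof -
      have "expo (?a + ?b) i = 0"
        using ab that unfolding A_def B_def lookup_add
        by (metis (no_types, lifting) add_is_0 atMost_iff in_keys_iff mem_Collect_eq not_le subsetD)
      then show ?thesis unfolding eq[symmetric] by (simp add: lookup_add)
    qed
    then have k: "Poly_Mapping.keys a \<subseteq> {..N}" "Poly_Mapping.keys b \<subseteq> {..N}"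
      by (metis atMost_iff in_keys_iff leI subsetI)+
    have "mdeg a + mdeg b = mdeg a0 + mdeg b0"
      using arg_cong[OF eq, of mdeg] ab by (simp add: mdeg_add A_def B_def)
    moreover have "mdeg a0 \<le> mdeg a" "mdeg b0 \<le> mdeg b" using a0(2) b0(2) nz by auto
    ultimately have "a \<in> A" "b \<in> B" using nz k by (auto simp: A_def B_def)
    then have le: "a \<le> ?a" "b \<le> ?b" using fin by auto
    show ?thesis
    proof (rule ccontr)
      assume "\<not> ?thesis"
      then have "a < ?a \<and> b \<le> ?b \<or> a \<le> ?a \<and> b < ?b" using le by auto
      then have "a + b < ?a + ?b" by (auto intro: add_less_le_mono add_le_less_mono)
      then show False using eq by simp
    qed
  qed
  have "coeff (f * g) (?a + ?b)
      = (\<Sum>x\<in>decomps (?a + ?b). if x = (?a, ?b) then coeff f ?a * coeff g ?b else 0)"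
    unfolding times_series.rep_eq
    by (rule sum.cong) (use only in \<open>force simp: decomps_def\<close>)+
  also have "\<dots> = coeff f ?a * coeff g ?b"
    using finite_decomps[of "?a + ?b"] by (simp add: decomps_def)
  also have "\<dots> \<noteq> 0" using ab by (simp add: A_def B_def)
  finally show ?thesis by (metis coeff_simps(1))
qed

instance series :: idom
  by standard (rule series_mult_nonzero)

lemma elem_sym_nonzero: "elem_sym r \<noteq> 0"
proof -
  define m where "m = (\<Sum>i\<in>{1..r}. Poly_Mapping.single i (1::nat))"
  have m: "expo m i = (if i \<in> {1..r} then 1 else 0)" for i
    by (simp add: m_def lookup_sum lookup_single when_def)
  then have "Poly_Mapping.keys m = {1..r}" by (auto simp: in_keys_iff split: if_splits)
  then have "coeff (elem_sym r) m = 1" by (auto simp: elem_sym_def m)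
  then show ?thesis by auto
qed

section \<open>The action on monomials and series\<close>

lemma linear_qscale: "Vector_Spaces.linear qscale qscale f \<longleftrightarrow>
    (\<forall>u v. f (u + v) = f u + f v) \<and> (\<forall>c v. f (qscale c v) = qscale c (f v))"
  by (simp add: Vector_Spaces.linear_def module_hom_def module_hom_axioms_def
      qs.vector_space_axioms qs.module_axioms)

interpretation qs2: vector_space_pair qscale qscale ..

lemma qscale_mult: "qscale c f * g = qscale c (f * g)"
  by (rule series_eqI) (simp add: times_series.rep_eq sum_distrib_left case_prod_unfold mult.assoc)

lemma of_int_sign_mult: "of_int (sign p) * f = qscale (of_int (sign p)) (f :: series)"
  by (cases p rule: sign_cases) (simp_all add: qs.scale_minus_left)

lemma expo_perm_mono: "bij \<sigma> \<Longrightarrow> expo (perm_mono \<sigma> m) n = expo m (inv \<sigma> n)"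
  by (simp add: perm_mono_def map_key.rep_eq bij_imp_bij_inv bij_is_inj)

lemma perm_mono_id [simp]: "perm_mono id m = m"
  by (rule poly_mapping_eqI) (simp add: expo_perm_mono)

lemma perm_mono_comp:
  "bij \<sigma> \<Longrightarrow> bij \<tau> \<Longrightarrow> perm_mono (\<sigma> \<circ> \<tau>) m = perm_mono \<sigma> (perm_mono \<tau> m)"
  by (rule poly_mapping_eqI) (simp add: expo_perm_mono bij_comp o_inv_distrib)

lemma perm_mono_inv [simp]:
  "bij \<sigma> \<Longrightarrow> perm_mono \<sigma> (perm_mono (inv \<sigma>) m) = m"
  "bij \<sigma> \<Longrightarrow> perm_mono (inv \<sigma>) (perm_mono \<sigma> m) = m"
  by (rule poly_mapping_eqI, simp add: expo_perm_mono bij_imp_bij_inv inv_inv_eq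
      bij_is_surj bij_is_inj surj_f_inv_f)+

lemma perm_mono_add: "bij \<sigma> \<Longrightarrow> perm_mono \<sigma> (a + b) = perm_mono \<sigma> a + perm_mono \<sigma> b"
  by (rule poly_mapping_eqI) (simp add: expo_perm_mono lookup_add)

lemma coeff_act [simp]: "coeff (act \<sigma> f) m = coeff f (perm_mono (inv \<sigma>) m)"
  by (simp add: act_def)

lemma act_id [simp]: "act id f = f"
  by (rule series_eqI) simp

lemma act_comp: "bij \<sigma> \<Longrightarrow> bij \<tau> \<Longrightarrow> act (\<sigma> \<circ> \<tau>) f = act \<sigma> (act \<tau> f)"
  by (rule series_eqI) (simp add: o_inv_distrib perm_mono_comp bij_imp_bij_inv)

lemma act_add: "act \<sigma> (f + g) = act \<sigma> f + act \<sigma> g"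
  by (rule series_eqI) simp

lemma act_scale: "act \<sigma> (qscale c f) = qscale c (act \<sigma> f)"
  by (rule series_eqI) simp

lemma linear_act: "Vector_Spaces.linear qscale qscale (act \<sigma>)"
  by (simp add: linear_qscale act_add act_scale)

lemma act_mono_sum: "bij \<sigma> \<Longrightarrow> act \<sigma> (mono_sum A) = mono_sum (perm_mono \<sigma> ` A)"
  by (rule series_eqI) (auto simp: image_iff; metis perm_mono_inv)

lemma act_mult: assumes "bij \<sigma>" shows "act \<sigma> (f * g) = act \<sigma> f * act \<sigma> g"
proof (rule series_eqI)
  fix m
  let ?p = "perm_mono (inv \<sigma>)"
  show "coeff (act \<sigma> (f * g)) m = coeff (act \<sigma> f * act \<sigma> g) m"
    unfolding times_series.rep_eq coeff_act
    by (rule sum.reindex_bij_witness[where i = "map_prod ?p ?p"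
          and j = "map_prod (perm_mono \<sigma>) (perm_mono \<sigma>)"])
      (use assms in \<open>auto simp: decomps_def perm_mono_add[symmetric] bij_imp_bij_inv\<close>)
qed

lemma act_prod: "bij \<sigma> \<Longrightarrow> act \<sigma> 1 = 1 \<Longrightarrow> act \<sigma> (prod f A) = (\<Prod>a\<in>A. act \<sigma> (f a))"
  by (induction A rule: infinite_finite_induct) (auto simp: act_mult)

lemma S_natD:
  assumes "\<sigma> \<in> S_nat"
  shows "bij \<sigma>" "\<sigma> 0 = 0" "\<sigma> n \<ge> 1 \<longleftrightarrow> n \<ge> 1" "inv \<sigma> \<in> S_nat"
    "\<sigma> (inv \<sigma> n) = n" "inv \<sigma> (\<sigma> n) = n"
proof -
  have p: "\<sigma> permutes {1..}" using assms by (simp add: S_nat_def)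
  show "bij \<sigma>" "inv \<sigma> \<in> S_nat" using p by (auto simp: S_nat_def permutes_inv permutes_bij)
  show "\<sigma> 0 = 0" using p by (auto intro: permutes_not_in)
  show "\<sigma> n \<ge> 1 \<longleftrightarrow> n \<ge> 1" using permutes_in_image[OF p, of n] by simp
  show "\<sigma> (inv \<sigma> n) = n" "inv \<sigma> (\<sigma> n) = n" using permutes_inverses[OF p] by auto
qed

lemma S_infty_subset: "S_infty \<subseteq> S_nat"
  by (auto simp: S_infty_def S_nat_def intro: permutes_subset)

lemma S_inftyI: "\<sigma> permutes X \<Longrightarrow> finite X \<Longrightarrow> X \<subseteq> {1..} \<Longrightarrow> \<sigma> \<in> S_infty"
proof -
  assume *: "\<sigma> permutes X" "finite X" "X \<subseteq> {1..}"
  obtain N where "X \<subseteq> {..N}" using *(2) finite_nat_iff_bounded_le[of X] by auto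
  then have "X \<subseteq> {1..N}" using *(3) by auto
  then show ?thesis using permutes_subset[OF *(1)] by (auto simp: S_infty_def)
qed

lemma S_infty_permutation: "\<sigma> \<in> S_infty \<Longrightarrow> permutation \<sigma>"
  by (auto simp: S_infty_def permutation_permutes)

lemma S_nat_id [simp]: "id \<in> S_nat" by (simp add: S_nat_def permutes_id)

lemma S_nat_comp: "\<sigma> \<in> S_nat \<Longrightarrow> \<tau> \<in> S_nat \<Longrightarrow> \<sigma> \<circ> \<tau> \<in> S_nat"
  by (auto simp: S_nat_def intro: permutes_compose)

lemma S_infty_inv: "\<sigma> \<in> S_infty \<Longrightarrow> inv \<sigma> \<in> S_infty"
  by (auto simp: S_infty_def intro: permutes_inv)

lemma act_elem_sym: assumes "\<sigma> \<in> S_nat" shows "act \<sigma> (elem_sym r) = elem_sym r"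
proof (rule series_eqI)
  fix m
  let ?m = "perm_mono (inv \<sigma>) m"
  note \<sigma> = S_natD[OF assms]
  have e: "expo ?m n = expo m (\<sigma> n)" for n
    using \<sigma>(1) by (simp add: expo_perm_mono bij_imp_bij_inv inv_inv_eq)
  have k: "Poly_Mapping.keys m = \<sigma> ` Poly_Mapping.keys ?m"
  proof (intro set_eqI iffI)
    fix n assume "n \<in> Poly_Mapping.keys m"
    then have "inv \<sigma> n \<in> Poly_Mapping.keys ?m" by (simp add: in_keys_iff e \<sigma>(5))
    then show "n \<in> \<sigma> ` Poly_Mapping.keys ?m" using \<sigma>(5)[of n] by (metis image_eqI)
  next
    fix n assume "n \<in> \<sigma> ` Poly_Mapping.keys ?m"
    then show "n \<in> Poly_Mapping.keys m" by (auto simp: in_keys_iff e)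
  qed
  have c: "card (Poly_Mapping.keys m) = card (Poly_Mapping.keys ?m)"
    unfolding k by (rule card_image) (rule inj_on_subset[OF bij_is_inj[OF \<sigma>(1)] subset_UNIV])
  have s: "Poly_Mapping.keys m \<subseteq> {1..} \<longleftrightarrow> Poly_Mapping.keys ?m \<subseteq> {1..}"
    using \<sigma>(3) by (subst k) (auto simp: image_subset_iff simp del: One_nat_def)
  have l: "(\<forall>i\<in>Poly_Mapping.keys m. expo m i = 1) \<longleftrightarrow> (\<forall>i\<in>Poly_Mapping.keys ?m. expo ?m i = 1)"
    by (subst k) (simp only: ball_simps e)
  show "coeff (act \<sigma> (elem_sym r)) m = coeff (elem_sym r) m"
    by (simp only: elem_sym_def coeff_act coeff_Series c s l)
qed

lemma act_prod_elem_sym: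
  assumes "\<sigma> \<in> S_nat" shows "act \<sigma> (\<Prod>r\<in>R. elem_sym r ^ h r) = (\<Prod>r\<in>R. elem_sym r ^ h r)"
proof -
  have bij: "bij \<sigma>" by (rule S_natD[OF assms])
  have one: "act \<sigma> 1 = 1" using act_elem_sym[OF assms, of 0] by (simp add: elem_sym_0)
  have "act \<sigma> (elem_sym r ^ n) = elem_sym r ^ n" for r n
    by (induction n) (simp_all add: one act_mult bij act_elem_sym assms)
  then show ?thesis by (simp add: act_prod bij one)
qed

text \<open>
  Two functions that differ from a common value only finitely often and take every other value
  equally often differ by a finitary permutation.
\<close>

lemma finitary_permutation_exists:
  fixes f g :: "nat \<Rightarrow> 'a"
  assumes fin: "finite {n\<in>{1..}. f n \<noteq> z}" "finite {n\<in>{1..}. g n \<noteq> z}"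
    and card: "\<And>c. c \<noteq> z \<Longrightarrow> card {n\<in>{1..}. f n = c} = card {n\<in>{1..}. g n = c}"
  obtains \<sigma> where "\<sigma> \<in> S_infty" "\<And>n. n \<ge> 1 \<Longrightarrow> g (\<sigma> n) = f n"
proof -
  obtain N where N: "{n\<in>{1..}. f n \<noteq> z} \<union> {n\<in>{1..}. g n \<noteq> z} \<subseteq> {..N}"
    using finite_nat_iff_bounded_le fin by (metis (no_types, lifting) finite_Un)
  let ?A = "{1..N}"
  have res: "{n\<in>{1..}. f n = c} = {n\<in>?A. f n = c}" "{n\<in>{1..}. g n = c} = {n\<in>?A. g n = c}"
    if "c \<noteq> z" for c
    using N that by auto
  have cnt: "count (image_mset h (mset_set ?A)) c = card {n\<in>?A. h n = c}" for h :: "nat \<Rightarrow> 'a" and c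
    by (auto simp: count_image_mset intro!: arg_cong[of _ _ card])
  have "count (image_mset f (mset_set ?A)) c = count (image_mset g (mset_set ?A)) c"
    if "c \<noteq> z" for c
    using card[OF that] by (simp only: res[OF that] cnt)
  moreover have "count (image_mset f (mset_set ?A)) z = count (image_mset g (mset_set ?A)) z"
  proof -
    have "filter_mset (\<lambda>c. c \<noteq> z) (image_mset f (mset_set ?A))
        = filter_mset (\<lambda>c. c \<noteq> z) (image_mset g (mset_set ?A))"
      by (rule multiset_eqI) (use calculation in simp)
    moreover have "size M = count M z + size (filter_mset (\<lambda>c. c \<noteq> z) M)" for M
      using arg_cong[OF multiset_partition[of M "\<lambda>c. c = z"], of size]
      by (simp add: filter_eq_replicate_mset)
    ultimately show ?thesis
      by (metis (no_types, lifting) add_right_cancel size_image_mset)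
  qed
  ultimately have "image_mset f (mset_set ?A) = image_mset g (mset_set ?A)"
    by (intro multiset_eqI) metis
  then obtain p where p: "p permutes ?A" "\<forall>x\<in>?A. f x = g (p x)"
    using image_mset_eq_implies_permutes[of ?A f g] by auto
  have "g (p n) = f n" if "n \<ge> 1" for n
  proof (cases "n \<le> N")
    case False
    then have "p n = n" using p(1) by (auto intro: permutes_not_in)
    moreover have "f n = z" "g n = z"
      using False that subsetD[OF N, of n] by auto
    ultimately show ?thesis by simp
  qed (use p that in auto)
  then show ?thesis using that p(1) by (auto simp: S_infty_def)
qed

text \<open>
  On series that involve finitely many variables, infinite permutations act like finitary ones.
\<close>

lemma finitary_agreeing:
  assumes "\<sigma> \<in> S_nat" "finite X" "X \<subseteq> {1..}"
  obtains \<sigma>' where "\<sigma>' \<in> S_infty" "\<And>n. n \<in> X \<Longrightarrow> \<sigma>' n = \<sigma> n"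
proof -
  note \<sigma> = S_natD[OF assms(1)]
  \<comment> \<open>a permutation carrying the labelling of \<open>X\<close> by itself to its transport along \<open>\<sigma>\<close>\<close>
  define f where "f n = (if n \<in> X then n else 0)" for n
  define g where "g n = f (inv \<sigma> n)" for n
  have inj: "inj \<sigma>" using \<sigma>(1) by (rule bij_is_inj)
  have im: "{n\<in>{1..}. g n = c} = \<sigma> ` {n\<in>{1..}. f n = c}" for c
  proof (intro set_eqI iffI)
    fix n assume "n \<in> {n\<in>{1..}. g n = c}"
    then have "inv \<sigma> n \<in> {n\<in>{1..}. f n = c}" using \<sigma>(3)[of "inv \<sigma> n"] \<sigma>(5) by (auto simp: g_def)
    then show "n \<in> \<sigma> ` {n\<in>{1..}. f n = c}" by (metis \<sigma>(5) image_eqI)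
  qed (use \<sigma> in \<open>auto simp: g_def\<close>)
  have "{n\<in>{1..}. f n \<noteq> 0} \<subseteq> X" by (auto simp: f_def split: if_splits)
  then have "finite {n\<in>{1..}. f n \<noteq> 0}" using assms(2) by (rule finite_subset)
  moreover have "{n\<in>{1..}. g n \<noteq> 0} \<subseteq> \<sigma> ` X"
  proof
    fix n assume "n \<in> {n\<in>{1..}. g n \<noteq> 0}"
    then have "inv \<sigma> n \<in> X" by (auto simp: g_def f_def split: if_splits)
    then show "n \<in> \<sigma> ` X" using \<sigma>(5)[of n] by (metis image_eqI)
  qed
  then have "finite {n\<in>{1..}. g n \<noteq> 0}" using assms(2) finite_subset by blast
  moreover have "card {n\<in>{1..}. f n = c} = card {n\<in>{1..}. g n = c}" for c
    unfolding im by (rule card_image[symmetric]) (rule inj_on_subset[OF inj subset_UNIV])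
  ultimately obtain \<sigma>' where \<sigma>': "\<sigma>' \<in> S_infty" "\<And>n. n \<ge> 1 \<Longrightarrow> g (\<sigma>' n) = f n"
    using finitary_permutation_exists[of f 0 g] by blast
  have "\<sigma>' n = \<sigma> n" if "n \<in> X" for n
  proof -
    have n: "n \<ge> 1" using that assms(3) by auto
    then have "f (inv \<sigma> (\<sigma>' n)) = n" using \<sigma>'(2)[of n] that by (simp add: g_def f_def)
    then have "inv \<sigma> (\<sigma>' n) = n" using n by (auto simp: f_def split: if_splits)
    then show ?thesis by (metis \<sigma>(5))
  qed
  then show ?thesis using that \<sigma>'(1) by blast
qed

section \<open>Column groups and polytabloids\<close>

text \<open>A fixed infinite Ferrers diagram.\<close>

locale diagram =
  fixes D :: "box set"
  assumes ferrers: "ferrers_infty D"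
begin

lemma first_row_infinite: "(0, j) \<in> D"
  using ferrers by (simp add: ferrers_infty_def)

lemma diagram_down_closed: "(i, j) \<in> D \<Longrightarrow> i' \<le> i \<Longrightarrow> j' \<le> j \<Longrightarrow> (i', j') \<in> D"
  using ferrers unfolding ferrers_infty_def by blast

lemma finite_finite_part: "finite (finite_part D)"
  using ferrers by (simp add: ferrers_infty_def)

text \<open>The columns from \<open>width\<close> on consist of a single box.\<close>

definition width :: nat
  where "width = Suc (Max (insert 0 (snd ` finite_part D)))"

lemma below_width: "(i, j) \<in> D \<Longrightarrow> 0 < i \<Longrightarrow> j < width"
proof -
  assume "(i, j) \<in> D" "0 < i"
  then have "j \<in> snd ` finite_part D" by (force simp: finite_part_def)
  then have "j \<le> Max (insert 0 (snd ` finite_part D))" using finite_finite_part by (intro Max_ge) auto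
  then show ?thesis by (simp add: width_def)
qed

text \<open>The columns left of \<open>width\<close>; they contain everything that a column group can move.\<close>

definition core :: "box set"
  where "core = {b \<in> D. snd b < width}"

lemma core_subset: "core \<subseteq> D" by (auto simp: core_def)

lemma finite_core: "finite core"
proof (rule finite_subset)
  show "core \<subseteq> finite_part D \<union> {0} \<times> {..<width}" by (auto simp: core_def finite_part_def)
qed (use finite_finite_part in auto)

lemma finite_part_subset_core: "finite_part D \<subseteq> core"
  using below_width by (auto simp: core_def finite_part_def)

text \<open>
  All bijective fillings, standard or not.  Only their values on the diagram matter, so
  extensionality is not required.
\<close>

definition numberings :: "(box \<Rightarrow> nat) set"
  where "numberings = {T. bij_betw T D {1..}}"

text \<open>The box of a number; meaningful for positive numbers only.\<close>

definition box_of :: "(box \<Rightarrow> nat) \<Rightarrow> nat \<Rightarrow> box"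
  where "box_of T = inv_into D T"

lemma numbering:
  assumes "T \<in> numberings"
  shows "b \<in> D \<Longrightarrow> box_of T (T b) = b" "b \<in> D \<Longrightarrow> 1 \<le> T b"
    "1 \<le> n \<Longrightarrow> T (box_of T n) = n" "1 \<le> n \<Longrightarrow> box_of T n \<in> D"
    "b \<in> D \<Longrightarrow> b' \<in> D \<Longrightarrow> T b = T b' \<longleftrightarrow> b = b'"
proof -
  have b: "bij_betw T D {1..}" using assms by (simp add: numberings_def)
  show "b \<in> D \<Longrightarrow> box_of T (T b) = b"
    using b by (simp add: box_of_def bij_betw_def)
  show "b \<in> D \<Longrightarrow> 1 \<le> T b" using b by (auto simp: bij_betw_def)
  show "1 \<le> n \<Longrightarrow> T (box_of T n) = n" "1 \<le> n \<Longrightarrow> box_of T n \<in> D"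
    using b by (auto simp: box_of_def bij_betw_def f_inv_into_f inv_into_into)
  show "b \<in> D \<Longrightarrow> b' \<in> D \<Longrightarrow> T b = T b' \<longleftrightarrow> b = b'"
    using b by (auto simp: bij_betw_def dest: inj_onD)
qed

lemma SYT_numbering: "T \<in> SYT D \<Longrightarrow> T \<in> numberings"
  by (simp add: SYT_def numberings_def)

lemma SYT_col: "T \<in> SYT D \<Longrightarrow> i < i' \<Longrightarrow> (i', j) \<in> D \<Longrightarrow> T (i, j) < T (i', j)"
  using diagram_down_closed[of i' j i j] by (auto simp: SYT_def)

lemma numbering_comp:
  assumes "T \<in> numberings" "\<sigma> \<in> S_nat"
  shows "\<sigma> \<circ> T \<in> numberings"
  using assms unfolding numberings_def S_nat_def
  by (auto intro: bij_betw_trans permutes_imp_bij)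

lemma box_of_comp:
  assumes "T \<in> numberings" "\<sigma> \<in> S_nat" "1 \<le> n"
  shows "box_of (\<sigma> \<circ> T) n = box_of T (inv \<sigma> n)"
proof -
  note \<sigma> = S_natD[OF assms(2)]
  have i: "1 \<le> inv \<sigma> n" using \<sigma>(3)[of "inv \<sigma> n"] \<sigma>(5)[of n] assms(3) by simp
  have "(\<sigma> \<circ> T) (box_of T (inv \<sigma> n)) = n"
    using numbering(3)[OF assms(1) i] \<sigma>(5) by simp
  then show ?thesis
    using numbering(1)[OF numbering_comp[OF assms(1,2)] numbering(4)[OF assms(1) i]] by simp
qed

text \<open>
  A tabloid, the class of a numbering up to permutations within the rows, is encoded as the
  monomial whose exponent at \<open>n\<close> is the row of \<open>n\<close>.
\<close>

definition tabloid_of :: "(box \<Rightarrow> nat) \<Rightarrow> mono"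
  where "tabloid_of T = Abs_poly_mapping (\<lambda>n. if n = 0 then 0 else fst (box_of T n))"

lemma expo_tabloid_of:
  assumes "T \<in> numberings"
  shows "expo (tabloid_of T) n = (if n = 0 then 0 else fst (box_of T n))"
proof -
  have "{n. (if n = 0 then 0 else fst (box_of T n)) \<noteq> 0} \<subseteq> T ` finite_part D"
  proof
    fix n assume "n \<in> {n. (if n = 0 then 0 else fst (box_of T n)) \<noteq> 0}"
    then have n: "1 \<le> n" "0 < fst (box_of T n)" by (auto split: if_splits)
    then have "box_of T n \<in> finite_part D"
      using numbering(4)[OF assms] by (auto simp: finite_part_def)
    then show "n \<in> T ` finite_part D" using numbering(3)[OF assms n(1)] by (metis image_eqI)
  qed
  then have "finite {n. (if n = 0 then 0 else fst (box_of T n)) \<noteq> 0}"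
    using finite_finite_part finite_surj by blast
  then show ?thesis by (simp add: tabloid_of_def)
qed

lemma tabloid_of_box [simp]: "T \<in> numberings \<Longrightarrow> b \<in> D \<Longrightarrow> expo (tabloid_of T) (T b) = fst b"
  using numbering(1,2)[of T b] by (simp add: expo_tabloid_of)

lemma tabloid_of_comp:
  assumes "T \<in> numberings" "\<sigma> \<in> S_nat"
  shows "tabloid_of (\<sigma> \<circ> T) = perm_mono \<sigma> (tabloid_of T)"
proof (rule poly_mapping_eqI)
  fix n
  note \<sigma> = S_natD[OF assms(2)] and \<sigma>' = S_natD[OF S_natD(4)[OF assms(2)]]
  have "inv \<sigma> n = 0 \<longleftrightarrow> n = 0" using \<sigma>(2) \<sigma>(5)[of n] \<sigma>(6)[of 0] by metis
  then show "expo (tabloid_of (\<sigma> \<circ> T)) n = expo (perm_mono \<sigma> (tabloid_of T)) n"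
    using box_of_comp[OF assms, of n] \<sigma>(1)
    by (simp add: expo_perm_mono expo_tabloid_of numbering_comp assms)
qed

lemma col_group_iff:
  assumes T: "T \<in> numberings"
  shows "\<sigma> \<in> col_group D T \<longleftrightarrow> \<sigma> \<in> S_nat \<and> (\<forall>n\<ge>1. snd (box_of T (\<sigma> n)) = snd (box_of T n))"
    (is "_ \<longleftrightarrow> ?R")
proof
  assume \<sigma>: "\<sigma> \<in> col_group D T"
  have "snd (box_of T (\<sigma> n)) = snd (box_of T n)" if n: "n \<ge> 1" for n
  proof -
    let ?j = "snd (box_of T n)"
    have "n \<in> T ` diagram_col D ?j"
      using numbering(3,4)[OF T n] by (force simp: diagram_col_def)
    then have "\<sigma> n \<in> \<sigma> ` T ` diagram_col D ?j" by (rule imageI)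
    then have "\<sigma> n \<in> T ` diagram_col D ?j" using \<sigma> by (simp add: col_group_def)
    then show ?thesis using numbering(1)[OF T] by (auto simp: diagram_col_def)
  qed
  then show ?R using \<sigma> by (simp add: col_group_def)
next
  assume R: ?R
  then have "\<sigma> \<in> S_nat" by simp
  note \<sigma> = S_natD[OF this]
  have mem: "n \<in> T ` diagram_col D j \<longleftrightarrow> n \<ge> 1 \<and> snd (box_of T n) = j" for n j
  proof
    assume "n \<in> T ` diagram_col D j"
    then show "n \<ge> 1 \<and> snd (box_of T n) = j"
      using numbering(1,2)[OF T] by (auto simp: diagram_col_def simp del: One_nat_def)
  next
    assume "n \<ge> 1 \<and> snd (box_of T n) = j"
    then have "box_of T n \<in> diagram_col D j" "n = T (box_of T n)"
      using numbering(3,4)[OF T, of n] by (simp_all add: diagram_col_def)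
    then show "n \<in> T ` diagram_col D j" by blast
  qed
  have "\<sigma> ` (T ` diagram_col D j) = T ` diagram_col D j" for j
  proof (intro set_eqI iffI)
    fix n assume "n \<in> \<sigma> ` (T ` diagram_col D j)"
    then obtain k where "k \<in> T ` diagram_col D j" "n = \<sigma> k" by blast
    then show "n \<in> T ` diagram_col D j" using R \<sigma>(3)[of k] unfolding mem by metis
  next
    fix n assume n: "n \<in> T ` diagram_col D j"
    then have "inv \<sigma> n \<ge> 1" using \<sigma>(3)[of "inv \<sigma> n"] \<sigma>(5)[of n] unfolding mem by simp
    then have "inv \<sigma> n \<in> T ` diagram_col D j" using R n \<sigma>(5)[of n] unfolding mem by metis
    then show "n \<in> \<sigma> ` (T ` diagram_col D j)" using \<sigma>(5)[of n] by (metis image_eqI)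
  qed
  then show "\<sigma> \<in> col_group D T" using R by (simp add: col_group_def)
qed

lemma col_group_S_nat: "\<sigma> \<in> col_group D T \<Longrightarrow> \<sigma> \<in> S_nat"
  by (simp add: col_group_def)

lemma col_group_permutes:
  assumes T: "T \<in> numberings" and \<sigma>: "\<sigma> \<in> col_group D T"
  shows "\<sigma> permutes T ` core"
proof -
  note S = S_natD[OF col_group_S_nat[OF \<sigma>]]
  have "\<sigma> n = n" if n: "n \<notin> T ` core" for n
  proof (cases "n \<ge> 1")
    case False
    then have "n = 0" by simp
    then show ?thesis using S(2) by simp
  next
    case n1: True
    have sn: "1 \<le> \<sigma> n" using S(3) n1 by simp
    obtain i j where b: "box_of T n = (i, j)" by fastforce
    obtain i' j' where b': "box_of T (\<sigma> n) = (i', j')" by fastforce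
    have "(i, j) \<in> D" "T (i, j) = n" using numbering(3,4)[OF T n1] b by auto
    then have w: "\<not> j < width" using n by (force simp: core_def)
    have "(i', j') \<in> D" using numbering(4)[OF T sn] b' by auto
    moreover have "j' = j" using \<sigma> n1 b b' unfolding col_group_iff[OF T] by fastforce
    ultimately have "i' = 0" "i = 0" using below_width w \<open>(i, j) \<in> D\<close> by (metis gr0I)+
    then have "box_of T (\<sigma> n) = box_of T n" using b b' \<open>j' = j\<close> by simp
    then show ?thesis using numbering(3)[OF T] n1 sn by metis
  qed
  then show ?thesis using S(1) by (auto simp: permutes_def bij_iff)
qed

lemma finite_core_image: "T \<in> numberings \<Longrightarrow> finite (T ` core) \<and> T ` core \<subseteq> {1..}"
  using finite_core numbering(2) core_subset by fastforce

lemma col_group_S_infty: "T \<in> numberings \<Longrightarrow> \<sigma> \<in> col_group D T \<Longrightarrow> \<sigma> \<in> S_infty"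
  using S_inftyI[OF col_group_permutes] finite_core_image[of T] by fast

lemma finite_col_group: "T \<in> numberings \<Longrightarrow> finite (col_group D T)"
  by (rule finite_subset[OF _ finite_permutations[of "T ` core"]])
    (use col_group_permutes finite_core_image in auto)

lemma col_group_id [simp]: "id \<in> col_group D T"
  by (simp add: col_group_def)

lemma col_group_comp:
  "\<sigma> \<in> col_group D T \<Longrightarrow> \<tau> \<in> col_group D T \<Longrightarrow> \<sigma> \<circ> \<tau> \<in> col_group D T"
  unfolding col_group_def mem_Collect_eq image_comp[symmetric] by (metis S_nat_comp)

lemma col_group_inv:
  assumes "\<sigma> \<in> col_group D T" shows "inv \<sigma> \<in> col_group D T"
proof -
  have S: "\<sigma> \<in> S_nat" using assms by (rule col_group_S_nat)
  have "inv \<sigma> ` T ` diagram_col D j = T ` diagram_col D j" for j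
  proof -
    have "inv \<sigma> ` \<sigma> ` T ` diagram_col D j = T ` diagram_col D j"
      using S_natD(6)[OF S] by (simp add: image_comp o_def)
    then show ?thesis using assms by (simp add: col_group_def)
  qed
  then show ?thesis using S_natD(4)[OF S] by (simp add: col_group_def)
qed

lemma col_group_transpose:
  assumes "T \<in> numberings" "x \<ge> 1" "y \<ge> 1" "snd (box_of T x) = snd (box_of T y)"
  shows "Transposition.transpose x y \<in> col_group D T"
proof -
  have "Transposition.transpose x y permutes {1..}"
    by (rule permutes_swap_id) (use assms in auto)
  then show ?thesis
    using assms by (auto simp: col_group_iff S_nat_def transpose_def)
qed

lemma rat_sign_square: "rat_of_int (sign p) * rat_of_int (sign p) = 1"
  by (simp flip: of_int_mult)

text \<open>The signed column sum of group representation theory, acting on arbitrary series.\<close>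

definition column_sum :: "(box \<Rightarrow> nat) \<Rightarrow> series \<Rightarrow> series"
  where "column_sum T v = (\<Sum>\<sigma>\<in>col_group D T. qscale (of_int (sign \<sigma>)) (act \<sigma> v))"

text \<open>
  The classical polytabloid, as a signed sum of the monomials that encode tabloids.
\<close>

definition polytabloid :: "(box \<Rightarrow> nat) \<Rightarrow> series"
  where "polytabloid T = column_sum T (mono_sum {tabloid_of T})"

lemma linear_column_sum: "Vector_Spaces.linear qscale qscale (column_sum T)"
  unfolding linear_qscale column_sum_def
  by (simp add: act_add act_scale qs.scale_right_distrib sum.distrib qs.scale_sum_right mult.commute)

lemma coeff_column_sum:
  "coeff (column_sum T v) m = (\<Sum>\<sigma>\<in>col_group D T. of_int (sign \<sigma>) * coeff v (perm_mono (inv \<sigma>) m))"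
  by (simp add: column_sum_def coeff_sum)

lemma column_sum_act:
  assumes T: "T \<in> numberings" and \<tau>: "\<tau> \<in> col_group D T"
  shows "column_sum T (act \<tau> v) = qscale (of_int (sign \<tau>)) (column_sum T v)"
proof -
  let ?C = "col_group D T"
  have p: "permutation \<sigma>" "bij \<sigma>" if "\<sigma> \<in> ?C" for \<sigma>
    using S_infty_permutation[OF col_group_S_infty[OF T that]]
      S_natD(1)[OF col_group_S_nat[OF that]] by auto
  have "column_sum T (act \<tau> v) = (\<Sum>\<sigma>\<in>?C. qscale (of_int (sign \<sigma>)) (act (\<sigma> \<circ> \<tau>) v))"
    unfolding column_sum_def by (rule sum.cong) (simp_all add: act_comp p \<tau>)
  also have "\<dots> = (\<Sum>\<sigma>\<in>?C. qscale (of_int (sign \<tau> * sign \<sigma>)) (act \<sigma> v))"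
    by (rule sum.reindex_bij_witness[where i = "\<lambda>\<sigma>. \<sigma> \<circ> inv \<tau>" and j = "\<lambda>\<sigma>. \<sigma> \<circ> \<tau>"])
      (use p \<tau> in \<open>auto simp: col_group_comp col_group_inv comp_assoc bij_is_inj bij_is_surj
        surj_iff[THEN iffD1] sign_compose rat_sign_square\<close>)
  also have "\<dots> = qscale (of_int (sign \<tau>)) (column_sum T v)"
    by (simp add: column_sum_def qs.scale_sum_right)
  finally show ?thesis .
qed

lemma act_column_sum:
  assumes T: "T \<in> numberings" and \<tau>: "\<tau> \<in> col_group D T"
  shows "act \<tau> (column_sum T v) = qscale (of_int (sign \<tau>)) (column_sum T v)"
proof -
  let ?C = "col_group D T"
  have p: "permutation \<sigma>" "bij \<sigma>" if "\<sigma> \<in> ?C" for \<sigma>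
    using S_infty_permutation[OF col_group_S_infty[OF T that]]
      S_natD(1)[OF col_group_S_nat[OF that]] by auto
  have "act \<tau> (column_sum T v) = (\<Sum>\<sigma>\<in>?C. qscale (of_int (sign \<sigma>)) (act (\<tau> \<circ> \<sigma>) v))"
    unfolding column_sum_def qs2.linear_sum[OF linear_act]
    by (rule sum.cong) (simp_all add: act_comp p \<tau> act_scale)
  also have "\<dots> = (\<Sum>\<sigma>\<in>?C. qscale (of_int (sign \<tau> * sign \<sigma>)) (act \<sigma> v))"
    by (rule sum.reindex_bij_witness[where i = "\<lambda>\<sigma>. inv \<tau> \<circ> \<sigma>" and j = "\<lambda>\<sigma>. \<tau> \<circ> \<sigma>"])
      (use p \<tau> in \<open>auto simp: col_group_comp col_group_inv comp_assoc[symmetric] bij_is_inj bij_is_surj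
        surj_iff[THEN iffD1] sign_compose rat_sign_square simp flip: mult.assoc\<close>)
  also have "\<dots> = qscale (of_int (sign \<tau>)) (column_sum T v)"
    by (simp add: column_sum_def qs.scale_sum_right)
  finally show ?thesis .
qed

lemma column_sum_twice:
  assumes T: "T \<in> numberings"
  shows "column_sum T (column_sum T v) = qscale (of_nat (card (col_group D T))) (column_sum T v)"
proof -
  have "column_sum T (column_sum T v) = (\<Sum>\<sigma>\<in>col_group D T. column_sum T v)"
    unfolding column_sum_def[of T "column_sum T v"]
    by (rule sum.cong) (simp_all add: act_column_sum[OF T] rat_sign_square)
  also have "\<dots> = qscale (of_nat (card (col_group D T))) (column_sum T v)"
    by (simp add: qs.sum_constant_scale del: sum_constant)
  finally show ?thesis .
qed

lemma act_column_sum_conj: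
  assumes T: "T \<in> numberings" and \<sigma>: "\<sigma> \<in> S_infty"
  shows "act \<sigma> (column_sum T v) = column_sum (\<sigma> \<circ> T) (act \<sigma> v)"
proof -
  have S: "\<sigma> \<in> S_nat" using \<sigma> S_infty_subset by blast
  note s = S_natD[OF S] and s' = S_natD[OF S_natD(4)[OF S]]
  let ?C = "col_group D T" and ?C' = "col_group D (\<sigma> \<circ> T)"
  have T': "\<sigma> \<circ> T \<in> numberings" by (rule numbering_comp[OF T S])
  have p: "permutation \<pi>" "bij \<pi>" if "\<pi> \<in> ?C" for \<pi>
    using S_infty_permutation[OF col_group_S_infty[OF T that]]
      S_natD(1)[OF col_group_S_nat[OF that]] by auto
  have ps: "permutation \<sigma>" "permutation (inv \<sigma>)"
    using \<sigma> S_infty_inv S_infty_permutation by blast+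
  have conj: "\<sigma> \<circ> \<pi> \<circ> inv \<sigma> \<in> ?C'" if "\<pi> \<in> ?C" for \<pi>
    unfolding col_group_def
  proof (intro CollectI conjI allI)
    show "\<sigma> \<circ> \<pi> \<circ> inv \<sigma> \<in> S_nat" using that S s(4) col_group_S_nat S_nat_comp by blast
    fix j
    have "(\<sigma> \<circ> \<pi> \<circ> inv \<sigma>) ` (\<sigma> \<circ> T) ` diagram_col D j = \<sigma> ` \<pi> ` T ` diagram_col D j"
      by (simp add: image_comp o_def s(6))
    also have "\<pi> ` T ` diagram_col D j = T ` diagram_col D j" using that by (simp add: col_group_def)
    finally show "(\<sigma> \<circ> \<pi> \<circ> inv \<sigma>) ` (\<sigma> \<circ> T) ` diagram_col D j = (\<sigma> \<circ> T) ` diagram_col D j"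
      by (simp add: image_comp)
  qed
  have conj': "inv \<sigma> \<circ> \<pi> \<circ> \<sigma> \<in> ?C" if "\<pi> \<in> ?C'" for \<pi>
    unfolding col_group_def
  proof (intro CollectI conjI allI)
    show "inv \<sigma> \<circ> \<pi> \<circ> \<sigma> \<in> S_nat" using that S s(4) col_group_S_nat S_nat_comp by blast
    fix j
    have "(inv \<sigma> \<circ> \<pi> \<circ> \<sigma>) ` T ` diagram_col D j = inv \<sigma> ` \<pi> ` (\<sigma> \<circ> T) ` diagram_col D j"
      by (simp add: image_comp o_def)
    also have "\<pi> ` (\<sigma> \<circ> T) ` diagram_col D j = (\<sigma> \<circ> T) ` diagram_col D j"
      using that by (simp add: col_group_def)
    finally show "(inv \<sigma> \<circ> \<pi> \<circ> \<sigma>) ` T ` diagram_col D j = T ` diagram_col D j"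
      by (simp add: image_comp o_def s(6))
  qed
  have cc: "inv \<sigma> \<circ> (\<sigma> \<circ> \<pi> \<circ> inv \<sigma>) \<circ> \<sigma> = \<pi>" "\<sigma> \<circ> (inv \<sigma> \<circ> \<pi> \<circ> \<sigma>) \<circ> inv \<sigma> = \<pi>" for \<pi>
    by (simp_all add: fun_eq_iff s)
  have sg: "sign (\<sigma> \<circ> \<pi> \<circ> inv \<sigma>) = sign \<pi>" if "\<pi> \<in> ?C" for \<pi>
    using p[OF that] ps by (simp add: sign_compose permutation_compose sign_inverse mult.commute)
  have ac: "act (\<sigma> \<circ> \<pi> \<circ> inv \<sigma>) (act \<sigma> v) = act \<sigma> (act \<pi> v)" if "\<pi> \<in> ?C" for \<pi>
  proof -
    have "act (\<sigma> \<circ> \<pi> \<circ> inv \<sigma>) (act \<sigma> v) = act (\<sigma> \<circ> \<pi> \<circ> inv \<sigma> \<circ> \<sigma>) v"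
      using p[OF that] s(1) by (simp add: act_comp bij_comp bij_imp_bij_inv)
    also have "\<sigma> \<circ> \<pi> \<circ> inv \<sigma> \<circ> \<sigma> = \<sigma> \<circ> \<pi>" by (simp add: fun_eq_iff s)
    also have "act (\<sigma> \<circ> \<pi>) v = act \<sigma> (act \<pi> v)" using p[OF that] s(1) by (simp add: act_comp)
    finally show ?thesis .
  qed
  have "act \<sigma> (column_sum T v) = (\<Sum>\<pi>\<in>?C. qscale (of_int (sign \<pi>)) (act \<sigma> (act \<pi> v)))"
    unfolding column_sum_def qs2.linear_sum[OF linear_act] by (simp add: act_scale)
  also have "\<dots> = column_sum (\<sigma> \<circ> T) (act \<sigma> v)"
    unfolding column_sum_def
    by (rule sum.reindex_bij_witness[where i = "\<lambda>\<pi>. inv \<sigma> \<circ> \<pi> \<circ> \<sigma>" and j = "\<lambda>\<pi>. \<sigma> \<circ> \<pi> \<circ> inv \<sigma>"])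
      (simp_all only: conj conj' cc sg ac)
  finally show ?thesis .
qed

lemma act_polytabloid_finitary:
  assumes "T \<in> numberings" "\<sigma> \<in> S_infty"
  shows "act \<sigma> (polytabloid T) = polytabloid (\<sigma> \<circ> T)"
proof -
  have S: "\<sigma> \<in> S_nat" using assms S_infty_subset by blast
  show ?thesis
    by (simp add: polytabloid_def act_column_sum_conj assms act_mono_sum S_natD(1)[OF S]
        tabloid_of_comp S)
qed

text \<open>The far part of the first row of a numbering is irrelevant for its polytabloid.\<close>

lemma polytabloid_cong:
  assumes T: "T \<in> numberings" and T': "T' \<in> numberings" and eq: "\<And>b. b \<in> core \<Longrightarrow> T b = T' b"
  shows "polytabloid T = polytabloid T'"
proof -
  have im: "T ` core = T' ` core" using eq by auto
  have bx: "box_of T n = box_of T' n" if "n \<in> T ` core" for n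
    using that eq core_subset numbering(1)[OF T] numbering(1)[OF T'] by force
  have r0: "fst (box_of U n) = 0" if "U \<in> numberings" "n \<notin> U ` core" "n \<ge> 1" for U n
  proof (rule ccontr)
    assume "fst (box_of U n) \<noteq> 0"
    then have "box_of U n \<in> finite_part D"
      using numbering(4)[OF that(1,3)] by (simp add: finite_part_def)
    then show False using finite_part_subset_core numbering(3)[OF that(1,3)] that(2) by (metis image_eqI subsetD)
  qed
  have tab: "tabloid_of T = tabloid_of T'"
  proof (rule poly_mapping_eqI)
    fix n
    show "expo (tabloid_of T) n = expo (tabloid_of T') n"
      using bx[of n] r0[OF T, of n] r0[OF T', of n] im
      by (cases "n \<in> T ` core") (auto simp: expo_tabloid_of T T')
  qed
  have sub: "col_group D U \<subseteq> col_group D U'"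
    if U: "U \<in> numberings" "U' \<in> numberings" and e: "U ` core = U' ` core"
      and b: "\<And>n. n \<in> U ` core \<Longrightarrow> box_of U n = box_of U' n" for U U'
  proof
    fix \<sigma> assume \<sigma>: "\<sigma> \<in> col_group D U"
    note p = col_group_permutes[OF U(1) \<sigma>]
    have "snd (box_of U' (\<sigma> n)) = snd (box_of U' n)" if "n \<ge> 1" for n
    proof (cases "n \<in> U ` core")
      case True
      then have "\<sigma> n \<in> U ` core" using permutes_in_image[OF p] by simp
      then show ?thesis using b True \<sigma> that unfolding col_group_iff[OF U(1)] by metis
    next
      case False
      then show ?thesis using p by (simp add: permutes_not_in)
    qed
    then show "\<sigma> \<in> col_group D U'" using \<sigma> U by (simp add: col_group_iff)
  qed
  have "col_group D T = col_group D T'"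
    using sub[OF T T' im bx] sub[OF T' T im[symmetric]] bx im by auto
  then show ?thesis by (simp add: polytabloid_def column_sum_def tab)
qed

lemma coeff_polytabloid:
  assumes T: "T \<in> numberings"
  shows "coeff (polytabloid T) t
    = (\<Sum>\<sigma>\<in>col_group D T. of_int (sign \<sigma>) * (if t = perm_mono \<sigma> (tabloid_of T) then 1 else 0))"
  unfolding polytabloid_def coeff_column_sum
proof (rule sum.cong)
  fix \<sigma> assume "\<sigma> \<in> col_group D T"
  then have "bij \<sigma>" using S_natD(1) col_group_S_nat by blast
  then have "perm_mono (inv \<sigma>) t = tabloid_of T \<longleftrightarrow> t = perm_mono \<sigma> (tabloid_of T)"
    by (metis perm_mono_inv)
  then show "of_int (sign \<sigma>) * coeff (mono_sum {tabloid_of T}) (perm_mono (inv \<sigma>) t)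
      = of_int (sign \<sigma>) * (if t = perm_mono \<sigma> (tabloid_of T) then 1 else 0)"
    by simp
qed simp

lemma polytabloid_support:
  assumes T: "T \<in> numberings" and nz: "coeff (polytabloid T) t \<noteq> 0"
  obtains \<sigma> where "\<sigma> \<in> col_group D T" "t = perm_mono \<sigma> (tabloid_of T)"
proof -
  have "\<exists>\<sigma>\<in>col_group D T. t = perm_mono \<sigma> (tabloid_of T)"
    by (rule ccontr) (use nz in \<open>simp add: coeff_polytabloid[OF T]\<close>)
  then show ?thesis using that by blast
qed

lemma perm_mono_agree:
  assumes b: "bij \<sigma>" "bij \<sigma>'" and k: "Poly_Mapping.keys m \<subseteq> X"
    and eq: "\<And>n. n \<in> X \<Longrightarrow> \<sigma> n = \<sigma>' n"
  shows "perm_mono \<sigma> m = perm_mono \<sigma>' m"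
proof (rule poly_mapping_eqI)
  fix n
  have i: "\<sigma> (inv \<sigma> n) = n" "inv \<sigma> (\<sigma> k) = k" "\<sigma>' (inv \<sigma>' n) = n" "inv \<sigma>' (\<sigma>' k) = k" for k n
    using b by (simp_all add: bij_is_inj bij_is_surj surj_f_inv_f)
  show "expo (perm_mono \<sigma> m) n = expo (perm_mono \<sigma>' m) n"
  proof (cases "inv \<sigma> n \<in> X \<or> inv \<sigma>' n \<in> X")
    case True
    then have "inv \<sigma> n = inv \<sigma>' n" using eq i by metis
    then show ?thesis by (simp add: expo_perm_mono b)
  next
    case False
    then have "inv \<sigma> n \<notin> Poly_Mapping.keys m" "inv \<sigma>' n \<notin> Poly_Mapping.keys m" using k by auto
    then show ?thesis by (simp add: expo_perm_mono b in_keys_iff)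
  qed
qed

lemma act_agree:
  assumes b: "bij \<sigma>" "bij \<sigma>'" and k: "\<And>m. coeff v m \<noteq> 0 \<Longrightarrow> Poly_Mapping.keys m \<subseteq> X"
    and eq: "\<And>n. n \<in> X \<Longrightarrow> \<sigma> n = \<sigma>' n"
  shows "act \<sigma> v = act \<sigma>' v"
proof (rule series_eqI)
  have *: "coeff v (perm_mono (inv \<sigma>') m) = coeff v (perm_mono (inv \<sigma>) m)"
    if nz: "coeff v (perm_mono (inv \<sigma>) m) \<noteq> 0" and b: "bij \<sigma>" "bij \<sigma>'"
      and eq: "\<And>n. n \<in> X \<Longrightarrow> \<sigma> n = \<sigma>' n" for \<sigma> \<sigma>' m
  proof -
    have "perm_mono \<sigma> (perm_mono (inv \<sigma>) m) = perm_mono \<sigma>' (perm_mono (inv \<sigma>) m)"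
      by (rule perm_mono_agree[OF b k[OF nz] eq])
    then have "perm_mono (inv \<sigma>') m = perm_mono (inv \<sigma>) m"
      using b by (metis perm_mono_inv)
    then show ?thesis by simp
  qed
  fix m
  show "coeff (act \<sigma> v) m = coeff (act \<sigma>' v) m"
    using *[of \<sigma> m \<sigma>'] *[of \<sigma>' m \<sigma>] b eq
    by (cases "coeff v (perm_mono (inv \<sigma>) m) = 0") auto
qed

lemma keys_tabloid:
  assumes T: "T \<in> numberings" and \<sigma>: "\<sigma> \<in> col_group D T"
  shows "Poly_Mapping.keys (perm_mono \<sigma> (tabloid_of T)) \<subseteq> T ` core"
proof
  fix n assume n: "n \<in> Poly_Mapping.keys (perm_mono \<sigma> (tabloid_of T))"
  let ?k = "inv \<sigma> n"
  have "bij \<sigma>" using S_natD(1)[OF col_group_S_nat[OF \<sigma>]] .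
  then have k: "?k \<noteq> 0" "0 < fst (box_of T ?k)"
    using n by (auto simp: in_keys_iff expo_perm_mono expo_tabloid_of[OF T] split: if_splits)
  then have "box_of T ?k \<in> finite_part D" using numbering(4)[OF T, of ?k] by (simp add: finite_part_def)
  then have "?k \<in> T ` core" using finite_part_subset_core numbering(3)[OF T, of ?k] k(1) by (metis image_eqI less_one not_le subsetD)
  then have "\<sigma> ?k \<in> T ` core" using permutes_in_image[OF col_group_permutes[OF T \<sigma>]] by simp
  then show "n \<in> T ` core" using S_natD(5)[OF col_group_S_nat[OF \<sigma>]] by simp
qed

text \<open>
  The conjugation argument for \<open>act_polytabloid_finitary\<close> needs \<open>sign\<close> to be multiplicative,
  hence finitary permutations.  As a polytabloid involves finitely many variables, the result
  extends to infinite ones.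
\<close>

lemma act_polytabloid:
  assumes T: "T \<in> numberings" and \<sigma>: "\<sigma> \<in> S_nat"
  shows "act \<sigma> (polytabloid T) = polytabloid (\<sigma> \<circ> T)"
proof -
  obtain \<sigma>' where \<sigma>': "\<sigma>' \<in> S_infty" "\<And>n. n \<in> T ` core \<Longrightarrow> \<sigma>' n = \<sigma> n"
    using finitary_agreeing[OF \<sigma>] finite_core_image[OF T] by metis
  then have S': "\<sigma>' \<in> S_nat" using S_infty_subset by blast
  have "act \<sigma> (polytabloid T) = act \<sigma>' (polytabloid T)"
  proof (rule act_agree[where X = "T ` core"])
    fix m assume "coeff (polytabloid T) m \<noteq> 0"
    then show "Poly_Mapping.keys m \<subseteq> T ` core"
      by (metis T polytabloid_support keys_tabloid)
  qed (use \<sigma> S' \<sigma>'(2) S_natD(1) in auto)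
  also have "\<dots> = polytabloid (\<sigma>' \<circ> T)" by (rule act_polytabloid_finitary[OF T \<sigma>'(1)])
  also have "\<dots> = polytabloid (\<sigma> \<circ> T)"
    by (rule polytabloid_cong) (use numbering_comp[OF T] \<sigma> S' \<sigma>'(2) in auto)
  finally show ?thesis .
qed

lemma numberings_transitive:
  assumes "T \<in> numberings" "T' \<in> numberings"
  obtains \<sigma> where "\<sigma> \<in> S_infty" "act \<sigma> (polytabloid T) = polytabloid T'"
proof -
  define \<sigma> where "\<sigma> n = (if n \<ge> 1 then T' (box_of T n) else n)" for n
  have "bij_betw (T' \<circ> box_of T) {1..} {1..}"
    using assms unfolding numberings_def box_of_def
    by (auto intro: bij_betw_trans bij_betw_inv_into)
  then have "bij_betw \<sigma> {1..} {1..}"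
    by (rule bij_betw_cong[THEN iffD1, rotated]) (simp add: \<sigma>_def)
  then have "\<sigma> permutes {1..}" by (rule bij_imp_permutes) (simp add: \<sigma>_def)
  then have S: "\<sigma> \<in> S_nat" by (simp add: S_nat_def)
  obtain \<sigma>' where \<sigma>': "\<sigma>' \<in> S_infty" "\<And>n. n \<in> T ` core \<Longrightarrow> \<sigma>' n = \<sigma> n"
    using finitary_agreeing[OF S] finite_core_image[OF assms(1)] by metis
  have S': "\<sigma>' \<in> S_nat" using \<sigma>'(1) S_infty_subset by blast
  have "act \<sigma>' (polytabloid T) = polytabloid (\<sigma>' \<circ> T)"
    by (rule act_polytabloid[OF assms(1) S'])
  also have "\<dots> = polytabloid T'"
  proof (rule polytabloid_cong[OF numbering_comp[OF assms(1) S'] assms(2)])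
    fix b assume b: "b \<in> core"
    then have "b \<in> D" using core_subset by blast
    then show "(\<sigma>' \<circ> T) b = T' b"
      using \<sigma>'(2)[of "T b"] b numbering(1,2)[OF assms(1), of b] by (simp add: \<sigma>_def)
  qed
  finally show ?thesis using that \<sigma>'(1) by blast
qed

section \<open>Rearrangements within columns\<close>

lemma mult_swap_less: "c < b \<Longrightarrow> x < y \<Longrightarrow> b * x + c * y < b * y + c * (x::nat)"
proof -
  assume "c < b" "x < y"
  then obtain d e where "c + d = b" "d > 0" "x + e = y" "e > 0"
    using less_imp_add_positive[of c b] less_imp_add_positive[of x y] by blast
  then show ?thesis by (auto simp: algebra_simps)
qed

text \<open>
  The rearrangement inequality: a filling with strictly increasing columns is the unique
  maximum of the sum of all entries, each weighted by its row, among its rearrangements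
  within the columns.
\<close>

lemma rearrangement:
  assumes T: "T \<in> numberings" and inc: "\<And>i i' j. i < i' \<Longrightarrow> (i', j) \<in> D \<Longrightarrow> f (T (i, j)) < f (T (i', j))"
    and \<pi>: "\<pi> \<in> col_group D T" "\<pi> \<noteq> id"
  shows "(\<Sum>b\<in>finite_part D. fst b * f (\<pi> (T b))) < (\<Sum>b\<in>finite_part D. fst b * (f (T b) :: nat))"
proof -
  let ?C = "col_group D T"
  define \<Phi> where "\<Phi> \<pi> = (\<Sum>b\<in>core. fst b * f (\<pi> (T b)))" for \<pi>
  have fp: "(\<Sum>b\<in>finite_part D. fst b * f (\<pi> (T b))) = \<Phi> \<pi>" for \<pi>
    unfolding \<Phi>_def using finite_part_subset_core core_subset finite_core
    by (intro sum.mono_neutral_left) (auto simp: finite_part_def intro: gr0I)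
  \<comment> \<open>a lowest displaced entry can be put back by a transposition, which increases \<open>\<Phi>\<close>\<close>
  have better: "\<exists>\<pi>'\<in>?C. \<Phi> \<pi> < \<Phi> \<pi>'" if \<pi>: "\<pi> \<in> ?C" "\<pi> \<noteq> id" for \<pi>
  proof -
    note P = S_natD[OF col_group_S_nat[OF \<pi>(1)]]
    define M where "M = {b \<in> core. \<pi> (T b) \<noteq> T b}"
    have finM: "finite M" using finite_core by (simp add: M_def)
    have inM: "b \<in> M" if "b \<in> D" "\<pi> (T b) \<noteq> T b" for b
    proof -
      have "T b \<in> T ` core" using permutes_not_in[OF col_group_permutes[OF T \<pi>(1)]] that(2) by blast
      then obtain b' where "b' \<in> core" "T b = T b'" by blast
      then show ?thesis using numbering(5)[OF T that(1), of b'] core_subset that(2) by (auto simp: M_def)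
    qed
    have "M \<noteq> {}"
    proof
      assume "M = {}"
      then have "\<pi> (T b) = T b" if "b \<in> D" for b using inM that by blast
      then have "\<pi> n = n" if "n \<ge> 1" for n using numbering(3,4)[OF T that] by metis
      then have "\<pi> = id" using P(2) by (metis eq_id_iff less_one not_le)
      then show False using \<pi>(2) by simp
    qed
    then have "Max (fst ` M) \<in> fst ` M" using finM by (intro Max_in) auto
    then obtain b where b: "b \<in> M" "fst b = Max (fst ` M)" by auto
    have max: "fst b' \<le> fst b" if "b' \<in> M" for b' using that finM b(2) by simp
    have "b \<in> D" using b(1) core_subset by (auto simp: M_def)
    then have bD: "b \<in> D" "1 \<le> T b" using numbering(2)[OF T] by auto
    have inj: "\<pi> x = \<pi> y \<longleftrightarrow> x = y" for x y using P(6) by metis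
    define d where "d = box_of T (\<pi> (T b))"
    have p1: "1 \<le> \<pi> (T b)" using P(3) bD(2) by simp
    have d: "d \<in> D" "T d = \<pi> (T b)" "snd d = snd b"
      using numbering(3,4)[OF T p1] \<pi>(1) bD numbering(1)[OF T bD(1)]
      unfolding col_group_iff[OF T] d_def by auto
    have dM: "d \<in> M" using inM[OF d(1)] d(2) b(1) inj by (simp add: M_def)
    define c where "c = box_of T (inv \<pi> (T b))"
    have p2: "1 \<le> inv \<pi> (T b)" using P(3)[of "inv \<pi> (T b)"] P(5) bD(2) by simp
    have c: "c \<in> D" "\<pi> (T c) = T b" "snd c = snd b"
      using numbering(3,4)[OF T p2] col_group_inv[OF \<pi>(1)] bD numbering(1)[OF T bD(1)] P(5)
      unfolding col_group_iff[OF T] c_def by auto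
    have cb: "c \<noteq> b" "d \<noteq> b" using b(1) c(2) d(2) by (auto simp: M_def)
    have cM: "c \<in> M" using inM[OF c(1)] c(2) numbering(5)[OF T c(1) bD(1)] cb by auto
    have fc: "fst c < fst b" "fst d < fst b"
      using max[OF cM] max[OF dM] cb c(3) d(3) by (auto simp: prod_eq_iff order_less_le)
    have fd: "f (T d) < f (T b)"
      using inc[of "fst d" "fst b" "snd b"] fc(2) d(3) bD(1) by (metis prod.collapse)
    let ?\<tau> = "Transposition.transpose (T b) (T c)"
    let ?\<pi>' = "\<pi> \<circ> ?\<tau>"
    have "?\<tau> \<in> ?C"
      by (rule col_group_transpose[OF T])
        (use bD c numbering(1,2)[OF T] in auto)
    then have mem: "?\<pi>' \<in> ?C" using \<pi>(1) by (rule col_group_comp[rotated])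
    define R where "R = core - {b, c}"
    have core: "core = insert b (insert c R)" "b \<notin> insert c R" "c \<notin> R" "finite R"
      using b(1) cM cb finite_core by (auto simp: R_def M_def)
    have same: "?\<pi>' (T x) = \<pi> (T x)" if "x \<in> R" for x
    proof -
      have "x \<in> D" "x \<noteq> b" "x \<noteq> c" using that core_subset by (auto simp: R_def)
      then have "T x \<noteq> T b" "T x \<noteq> T c"
        using numbering(5)[OF T, of x b] numbering(5)[OF T, of x c] bD(1) c(1) by auto
      then show ?thesis by (simp add: transpose_def)
    qed
    have "\<Phi> \<pi> = fst b * f (T d) + fst c * f (T b) + (\<Sum>b\<in>R. fst b * f (\<pi> (T b)))"
      using core d(2) c(2) by (simp add: \<Phi>_def)
    also have "\<dots> < fst b * f (T b) + fst c * f (T d) + (\<Sum>b\<in>R. fst b * f (\<pi> (T b)))"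
      using mult_swap_less[OF fc(1) fd] by simp
    also have "\<dots> = \<Phi> ?\<pi>'"
      unfolding \<Phi>_def core(1) using core d(2) c(2) same by simp
    finally show ?thesis using mem by blast
  qed
  have finC: "finite (\<Phi> ` ?C)" using finite_col_group[OF T] by simp
  then have "Max (\<Phi> ` ?C) \<in> \<Phi> ` ?C"
    using col_group_id by (intro Max_in) blast+
  then obtain \<rho> where \<rho>: "\<rho> \<in> ?C" "\<Phi> \<rho> = Max (\<Phi> ` ?C)" by auto
  have max: "\<Phi> \<sigma> \<le> \<Phi> \<rho>" if "\<sigma> \<in> ?C" for \<sigma> using that finC \<rho>(2) by simp
  have "\<rho> = id" using better[OF \<rho>(1)] max by (metis not_le)
  then have "\<Phi> \<pi> < \<Phi> id" using better[OF \<pi>] max by (metis order_less_le_trans)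
  then show ?thesis using fp[of \<pi>] fp[of id] by simp
qed

text \<open>
  The sum of all numbers, each multiplied by its row: the statistic by which tabloids are
  ordered.
\<close>

definition weight :: "mono \<Rightarrow> nat"
  where "weight t = (\<Sum>n\<in>Poly_Mapping.keys t. n * expo t n)"

lemma weight_eq: "finite A \<Longrightarrow> Poly_Mapping.keys t \<subseteq> A \<Longrightarrow> weight t = (\<Sum>n\<in>A. n * expo t n)"
  unfolding weight_def by (rule sum.mono_neutral_left) (auto simp: in_keys_iff)

lemma weight_perm:
  assumes T: "T \<in> numberings" and \<sigma>: "\<sigma> \<in> S_nat"
  shows "weight (perm_mono \<sigma> (tabloid_of T)) = (\<Sum>b\<in>finite_part D. fst b * \<sigma> (T b))"
proof -
  note S = S_natD[OF \<sigma>]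
  have T': "\<sigma> \<circ> T \<in> numberings" by (rule numbering_comp[OF T \<sigma>])
  have "Poly_Mapping.keys (tabloid_of (\<sigma> \<circ> T)) \<subseteq> (\<sigma> \<circ> T) ` finite_part D"
  proof
    fix n assume "n \<in> Poly_Mapping.keys (tabloid_of (\<sigma> \<circ> T))"
    then have n: "1 \<le> n" "0 < fst (box_of (\<sigma> \<circ> T) n)"
      by (auto simp: in_keys_iff expo_tabloid_of[OF T'] split: if_splits)
    then have "box_of (\<sigma> \<circ> T) n \<in> finite_part D" using numbering(4)[OF T'] by (simp add: finite_part_def)
    then show "n \<in> (\<sigma> \<circ> T) ` finite_part D" using numbering(3)[OF T' n(1)] by (metis image_eqI)
  qed
  then have "weight (tabloid_of (\<sigma> \<circ> T))
      = (\<Sum>n\<in>(\<sigma> \<circ> T) ` finite_part D. n * expo (tabloid_of (\<sigma> \<circ> T)) n)"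
    using finite_finite_part by (intro weight_eq) auto
  also have "\<dots> = (\<Sum>b\<in>finite_part D. (\<sigma> \<circ> T) b * expo (tabloid_of (\<sigma> \<circ> T)) ((\<sigma> \<circ> T) b))"
    by (subst sum.reindex) (use numbering(5)[OF T'] in \<open>auto simp: inj_on_def finite_part_def\<close>)
  also have "\<dots> = (\<Sum>b\<in>finite_part D. fst b * \<sigma> (T b))"
  proof (rule sum.cong)
    fix b assume "b \<in> finite_part D"
    then have "b \<in> D" by (simp add: finite_part_def)
    then show "(\<sigma> \<circ> T) b * expo (tabloid_of (\<sigma> \<circ> T)) ((\<sigma> \<circ> T) b) = fst b * \<sigma> (T b)"
      by (simp only: tabloid_of_box[OF T']) simp
  qed simp
  finally show ?thesis by (simp add: tabloid_of_comp[OF T \<sigma>])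
qed

lemma polytabloid_leading:
  assumes "T \<in> SYT D" "coeff (polytabloid T) t \<noteq> 0" "t \<noteq> tabloid_of T"
  shows "weight t < weight (tabloid_of T)"
proof -
  have T: "T \<in> numberings" using assms(1) by (rule SYT_numbering)
  obtain \<sigma> where \<sigma>: "\<sigma> \<in> col_group D T" "t = perm_mono \<sigma> (tabloid_of T)"
    using polytabloid_support[OF T assms(2)] .
  then have "\<sigma> \<noteq> id" using assms(3) by auto
  then have "(\<Sum>b\<in>finite_part D. fst b * \<sigma> (T b)) < (\<Sum>b\<in>finite_part D. fst b * T b)"
    using rearrangement[OF T _ \<sigma>(1), of "\<lambda>n. n"] SYT_col[OF assms(1)] by simp
  then show ?thesis
    using weight_perm[OF T col_group_S_nat[OF \<sigma>(1)]] weight_perm[OF T S_nat_id] \<sigma>(2) by simp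
qed

text \<open>A permutation that preserves all columns and all rows is trivial.\<close>

lemma col_group_fixing_rows:
  assumes T: "T \<in> numberings" and \<sigma>: "\<sigma> \<in> col_group D T"
    and rows: "perm_mono \<sigma> (tabloid_of T) = tabloid_of T"
  shows "\<sigma> = id"
proof
  fix n
  note S = S_natD[OF col_group_S_nat[OF \<sigma>]]
  show "\<sigma> n = id n"
  proof (cases "n \<ge> 1")
    case True
    then have sn: "1 \<le> \<sigma> n" using S(3) by simp
    have "expo (tabloid_of T) (\<sigma> n) = expo (tabloid_of T) n"
      using arg_cong[OF rows, of "\<lambda>m. expo m (\<sigma> n)"] S(1,6) by (simp add: expo_perm_mono)
    then have "fst (box_of T (\<sigma> n)) = fst (box_of T n)"
      using True sn by (simp add: expo_tabloid_of[OF T])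
    moreover have "snd (box_of T (\<sigma> n)) = snd (box_of T n)"
      using \<sigma> True by (simp add: col_group_iff[OF T])
    ultimately have "box_of T (\<sigma> n) = box_of T n" by (simp add: prod_eq_iff)
    then show ?thesis using numbering(3)[OF T] True sn by (metis id_apply)
  next
    case False
    then have "n = 0" by simp
    then show ?thesis using S(2) by simp
  qed
qed

lemma coeff_polytabloid_self:
  assumes T: "T \<in> numberings"
  shows "coeff (polytabloid T) (tabloid_of T) = 1"
proof -
  have "coeff (polytabloid T) (tabloid_of T) = (\<Sum>\<sigma>\<in>col_group D T. if \<sigma> = id then 1 else 0)"
    unfolding coeff_polytabloid[OF T]
  proof (rule sum.cong)
    fix \<sigma> assume "\<sigma> \<in> col_group D T"
    then show "of_int (sign \<sigma>) * (if tabloid_of T = perm_mono \<sigma> (tabloid_of T) then 1 else 0)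
        = (if \<sigma> = id then 1 else (0::rat))"
      using col_group_fixing_rows[OF T] by auto
  qed simp
  also have "\<dots> = 1" using finite_col_group[OF T] by simp
  finally show ?thesis .
qed

section \<open>Straightening\<close>

text \<open>Monomials of the form \<open>tabloid_of T\<close>, characterised by the sizes of their level sets.\<close>

definition tabloids :: "mono set"
  where "tabloids = {t. expo t 0 = 0 \<and> (\<forall>i\<ge>1. card {n. expo t n = i} = card (diagram_row D i))}"

text \<open>The permutation module spanned by the tabloids.\<close>

definition tabloid_space :: "series set"
  where "tabloid_space = {v. finite {t. coeff v t \<noteq> 0} \<and> {t. coeff v t \<noteq> 0} \<subseteq> tabloids}"

lemma level_perm: "bij \<sigma> \<Longrightarrow> {n. expo (perm_mono \<sigma> t) n = i} = \<sigma> ` {n. expo t n = i}"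
  by (auto simp: expo_perm_mono bij_is_inj image_iff) (metis bij_inv_eq_iff)

lemma tabloids_perm:
  assumes "\<sigma> \<in> S_nat" "t \<in> tabloids" shows "perm_mono \<sigma> t \<in> tabloids"
proof -
  note S = S_natD[OF assms(1)]
  have "card (\<sigma> ` A) = card A" for A
    by (rule card_image) (rule inj_on_subset[OF bij_is_inj[OF S(1)] subset_UNIV])
  moreover have "inv \<sigma> 0 = 0" using S(2,6) by metis
  ultimately show ?thesis
    using assms(2) S(1) by (simp add: tabloids_def level_perm) (simp add: expo_perm_mono)
qed

lemma tabloid_of_tabloids:
  assumes T: "T \<in> numberings" shows "tabloid_of T \<in> tabloids"
proof -
  have "card {n. expo (tabloid_of T) n = i} = card (diagram_row D i)" if "i \<ge> 1" for i
  proof -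
    have "{n. expo (tabloid_of T) n = i} = T ` diagram_row D i"
    proof (intro set_eqI iffI)
      fix n assume "n \<in> {n. expo (tabloid_of T) n = i}"
      then have n: "n \<ge> 1" "fst (box_of T n) = i"
        using that by (auto simp: expo_tabloid_of[OF T] split: if_splits)
      then have "box_of T n \<in> diagram_row D i" "n = T (box_of T n)"
        using numbering(3,4)[OF T n(1)] by (simp_all add: diagram_row_def)
      then show "n \<in> T ` diagram_row D i" by blast
    qed (use T in \<open>auto simp: diagram_row_def\<close>)
    then show ?thesis
      using numbering(5)[OF T] by (simp add: card_image inj_on_def diagram_row_def)
  qed
  then show ?thesis by (simp add: tabloids_def expo_tabloid_of[OF T])
qed

lemma subspace_tabloid_space: "qs.subspace tabloid_space"
proof (rule qs.subspaceI)
  show "0 \<in> tabloid_space" by (simp add: tabloid_space_def)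
  fix x y assume "x \<in> tabloid_space" "y \<in> tabloid_space"
  moreover have "{t. coeff (x + y) t \<noteq> 0} \<subseteq> {t. coeff x t \<noteq> 0} \<union> {t. coeff y t \<noteq> 0}" by auto
  ultimately show "x + y \<in> tabloid_space"
    unfolding tabloid_space_def mem_Collect_eq by (meson finite_UnI finite_subset le_sup_iff order_trans)
next
  fix c x assume "x \<in> tabloid_space"
  moreover have "{t. coeff (qscale c x) t \<noteq> 0} \<subseteq> {t. coeff x t \<noteq> 0}" by auto
  ultimately show "qscale c x \<in> tabloid_space"
    unfolding tabloid_space_def mem_Collect_eq by (meson finite_subset order_trans)
qed

lemma polytabloid_in_space:
  assumes T: "T \<in> numberings" shows "polytabloid T \<in> tabloid_space"
proof -
  let ?S = "(\<lambda>\<sigma>. perm_mono \<sigma> (tabloid_of T)) ` col_group D T"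
  have "{t. coeff (polytabloid T) t \<noteq> 0} \<subseteq> ?S"
    using polytabloid_support[OF T] by blast
  moreover have "finite ?S" using finite_col_group[OF T] by simp
  moreover have "?S \<subseteq> tabloids"
    using tabloids_perm tabloid_of_tabloids[OF T] col_group_S_nat by blast
  ultimately show ?thesis
    unfolding tabloid_space_def mem_Collect_eq by (meson finite_subset order_trans)
qed

lemma span_tabloid_space: "F \<subseteq> numberings \<Longrightarrow> qs.span (polytabloid ` F) \<subseteq> tabloid_space"
  by (rule qs.span_minimal) (use polytabloid_in_space subspace_tabloid_space in auto)

text \<open>
  A dual form of the Garnir relations.  If more numbers than row \<open>i\<close> of \<open>t\<close> has lie in the rows
  \<open>i\<close> and \<open>i + 1\<close> of \<open>t\<close>, then symmetrizing any polytabloid over them kills the coefficient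
  at \<open>t\<close>: either two of the numbers share a column of \<open>T\<close> and the symmetrized polytabloid
  vanishes, or the columns are distinct, but then there are too many of them.  The bound \<open>N\<close>
  serves to make row \<open>0\<close> finite.
\<close>

lemma dual_garnir:
  assumes T: "T \<in> numberings" and N: "T ` core \<subseteq> {..N}" and X: "X \<subseteq> {1..N}"
    and big: "card {n\<in>{1..N}. expo t n = i} < card X"
    and rows: "\<And>x. x \<in> X \<Longrightarrow> expo t x = i \<or> expo t x = Suc i"
  shows "(\<Sum>\<sigma> | \<sigma> permutes X. coeff (act \<sigma> (polytabloid T)) t) = 0"
proof (cases "\<exists>x\<in>X. \<exists>y\<in>X. x \<noteq> y \<and> snd (box_of T x) = snd (box_of T y)")
  case True
  then obtain x y where xy: "x \<in> X" "y \<in> X" "x \<noteq> y" "snd (box_of T x) = snd (box_of T y)" by blast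
  let ?\<tau> = "Transposition.transpose x y"
  have \<tau>: "?\<tau> \<in> col_group D T" by (rule col_group_transpose[OF T]) (use xy X in auto)
  have \<tau>X: "?\<tau> permutes X" using xy by (intro permutes_swap_id)
  have "act ?\<tau> (polytabloid T) = - polytabloid T"
    unfolding polytabloid_def act_column_sum[OF T \<tau>] by (simp add: sign_swap_id xy qs.scale_minus_left)
  then have *: "coeff (act (\<sigma> \<circ> ?\<tau>) (polytabloid T)) t = - coeff (act \<sigma> (polytabloid T)) t"
    if "\<sigma> permutes X" for \<sigma>
    using that by (simp only: act_comp permutes_bij permutes_bij[OF \<tau>X]) simp
  have "(\<Sum>\<sigma> | \<sigma> permutes X. coeff (act \<sigma> (polytabloid T)) t)
      = (\<Sum>\<sigma> | \<sigma> permutes X. coeff (act (\<sigma> \<circ> ?\<tau>) (polytabloid T)) t)"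
    by (rule sum.reindex_bij_witness[where i = "\<lambda>\<sigma>. \<sigma> \<circ> ?\<tau>" and j = "\<lambda>\<sigma>. \<sigma> \<circ> ?\<tau>"])
      (auto simp: comp_assoc intro: permutes_compose[OF \<tau>X])
  also have "\<dots> = - (\<Sum>\<sigma> | \<sigma> permutes X. coeff (act \<sigma> (polytabloid T)) t)"
    unfolding sum_negf[symmetric] by (rule sum.cong) (use * in blast)+
  finally show ?thesis by simp
next
  case False
  have "coeff (act \<sigma> (polytabloid T)) t = 0" if \<sigma>: "\<sigma> permutes X" for \<sigma>
  proof (rule ccontr)
    assume "coeff (act \<sigma> (polytabloid T)) t \<noteq> 0"
    then obtain \<pi> where \<pi>: "\<pi> \<in> col_group D T"
      and eq: "perm_mono (inv \<sigma>) t = perm_mono \<pi> (tabloid_of T)"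
      using polytabloid_support[OF T] by (metis coeff_act)
    note P = S_natD[OF col_group_S_nat[OF \<pi>]]
      and P' = S_natD[OF S_natD(4)[OF col_group_S_nat[OF \<pi>]]]
    have b\<sigma>: "bij \<sigma>" using \<sigma> by (rule permutes_bij)
    let ?u = "perm_mono \<pi> (tabloid_of T)"
    have u: "expo ?u n = expo t (\<sigma> n)" for n
      unfolding eq[symmetric] using b\<sigma> by (simp add: expo_perm_mono bij_imp_bij_inv inv_inv_eq)
    have u1: "expo ?u n = fst (box_of T (inv \<pi> n))" if "n \<ge> 1" for n
    proof -
      have "inv \<pi> n \<noteq> 0" using P'(3)[of n] that by simp
      then show ?thesis using P(1) by (simp add: expo_perm_mono expo_tabloid_of[OF T])
    qed
    define g where "g x = \<pi> (T (i, snd (box_of T x)))" for x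
    have g: "g x \<in> {n\<in>{1..N}. expo ?u n = i} \<and> snd (box_of T (g x)) = snd (box_of T x)"
      if x: "x \<in> X" for x
    proof -
      have x1: "x \<ge> 1" "x \<le> N" using x X by auto
      have y1: "inv \<pi> x \<ge> 1" using P'(3)[of x] x1 by simp
      obtain r c where rc: "box_of T (inv \<pi> x) = (r, c)" by fastforce
      have c: "c = snd (box_of T x)"
        using col_group_inv[OF \<pi>] x1 rc unfolding col_group_iff[OF T] by (metis snd_conv)
      have "\<sigma> x \<in> X" using \<sigma> x by (simp add: permutes_in_image)
      then have "i \<le> r" using rows[of "\<sigma> x"] u[of x] u1[OF x1(1)] rc by auto
      moreover have "(r, c) \<in> D" using numbering(4)[OF T y1] rc by simp
      ultimately have D: "(i, c) \<in> D" by (rule diagram_down_closed[OF _ _ order_refl, rotated])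
      note T1 = numbering(2)[OF T D]
      have g1: "g x \<ge> 1" using P(3) T1 by (simp add: g_def c[symmetric])
      have "inv \<pi> (g x) = T (i, c)" by (simp add: g_def c P(6))
      then have ug: "expo ?u (g x) = i" using u1[OF g1] numbering(1)[OF T D] by simp
      have sg: "snd (box_of T (g x)) = c"
        using \<pi> T1 numbering(1)[OF T D] unfolding col_group_iff[OF T] by (simp add: g_def c)
      have "g x \<le> N"
      proof (cases "c < width")
        case True
        then have "g x \<in> T ` core"
          using numbering(3,4)[OF T g1] sg by (force simp: core_def)
        then show ?thesis using N by auto
      next
        case False
        have "fst (box_of T (g x)) = 0" "fst (box_of T x) = 0"
          using False below_width numbering(4)[OF T g1] numbering(4)[OF T x1(1)] sg c
          by (metis gr0I prod.collapse)+
        then have "box_of T (g x) = box_of T x" using sg c by (simp add: prod_eq_iff)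
        then have "g x = x" using numbering(3)[OF T] g1 x1(1) by metis
        then show ?thesis using x1 by simp
      qed
      then show ?thesis using g1 ug sg c by simp
    qed
    have "inj_on g X" using g False by (intro inj_onI) metis
    moreover have "g ` X \<subseteq> {n\<in>{1..N}. expo ?u n = i}" using g by blast
    ultimately have "card X \<le> card {n\<in>{1..N}. expo ?u n = i}"
      by (intro card_inj_on_le[of g]) auto
    also have "card {n\<in>{1..N}. expo ?u n = i} = card (\<sigma> ` {n\<in>{1..N}. expo ?u n = i})"
      by (rule card_image[symmetric]) (rule inj_on_subset[OF bij_is_inj[OF b\<sigma>] subset_UNIV])
    also have "\<dots> \<le> card {n\<in>{1..N}. expo t n = i}"
    proof (rule card_mono)
      have "\<sigma> permutes {1..N}" using \<sigma> X by (rule permutes_subset)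
      then have "\<sigma> n \<in> {1..N}" if "n \<in> {1..N}" for n using that permutes_in_image by metis
      then show "\<sigma> ` {n\<in>{1..N}. expo ?u n = i} \<subseteq> {n\<in>{1..N}. expo t n = i}"
        unfolding u by blast
    qed simp
    finally show False using big by simp
  qed
  then show ?thesis by (intro sum.neutral) auto
qed

text \<open>
  Exchanging numbers above \<open>m\<close> in row \<open>i\<close> with numbers up to \<open>m\<close> in row \<open>i + 1\<close> increases
  the weight.
\<close>

lemma weight_exchange:
  assumes \<sigma>: "\<sigma> permutes X" and X: "X \<subseteq> {1..N}" and k: "Poly_Mapping.keys t \<subseteq> {..N}"
    and rows: "\<And>x. x \<in> X \<Longrightarrow> expo t x = i \<and> m < x \<or> expo t x = Suc i \<and> x \<le> m"
  shows "perm_mono (inv \<sigma>) t = t \<or> weight t < weight (perm_mono (inv \<sigma>) t)"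
proof -
  let ?u = "perm_mono (inv \<sigma>) t"
  have b\<sigma>: "bij \<sigma>" using \<sigma> by (rule permutes_bij)
  have u: "expo ?u n = expo t (\<sigma> n)" for n
    using b\<sigma> by (simp add: expo_perm_mono bij_imp_bij_inv inv_inv_eq)
  have finX: "finite X" using X finite_subset by blast
  have out: "\<sigma> n = n" if "n \<notin> X" for n using \<sigma> that by (rule permutes_not_in)
  have ku: "Poly_Mapping.keys ?u \<subseteq> {..N}"
  proof
    fix n assume n: "n \<in> Poly_Mapping.keys ?u"
    show "n \<in> {..N}"
    proof (cases "n \<in> X")
      case False
      then have "n \<in> Poly_Mapping.keys t" using n out by (simp add: in_keys_iff u)
      then show ?thesis using k by auto
    qed (use X in auto)
  qed
  define d where "d n = int (expo t (\<sigma> n)) - int (expo t n)" for n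
  have "int (weight ?u) - int (weight t) = (\<Sum>n\<le>N. int n * d n)"
    using weight_eq[OF _ k] weight_eq[OF _ ku]
    by (simp add: u d_def right_diff_distrib sum_subtractf)
  also have "\<dots> = (\<Sum>n\<in>X. int n * d n)"
    by (rule sum.mono_neutral_right) (use X out in \<open>auto simp: d_def\<close>)
  finally have w: "int (weight ?u) - int (weight t) = (\<Sum>n\<in>X. int n * d n)" .
  have "(\<Sum>n\<in>X. d n) = 0"
    unfolding d_def sum_subtractf using sum.permute[OF \<sigma>, of "\<lambda>n. int (expo t n)"] by (simp add: o_def)
  \<comment> \<open>as the \<open>d n\<close> sum to zero, the weights may be shifted; the shift by \<open>m + 1/2\<close> gives them
    the signs of the \<open>d n\<close>\<close>
  then have w2: "2 * (int (weight ?u) - int (weight t)) = (\<Sum>n\<in>X. (2 * int n - 2 * int m - 1) * d n)"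
    by (simp add: w left_diff_distrib sum_subtractf sum_distrib_left[symmetric] mult.assoc)
  have nonneg: "0 \<le> (2 * int n - 2 * int m - 1) * d n" if n: "n \<in> X" for n
  proof -
    have "\<sigma> n \<in> X" using \<sigma> n by (simp add: permutes_in_image)
    then show ?thesis
      using rows[OF n] rows[of "\<sigma> n"] by (auto simp: d_def zero_le_mult_iff)
  qed
  show ?thesis
  proof (cases "weight t < weight ?u")
    case False
    then have "(\<Sum>n\<in>X. (2 * int n - 2 * int m - 1) * d n) = 0"
      using w2 sum_nonneg[of X "\<lambda>n. (2 * int n - 2 * int m - 1) * d n"] nonneg by simp
    then have "(2 * int n - 2 * int m - 1) * d n = 0" if "n \<in> X" for n
      using sum_nonneg_eq_0_iff[OF finX, of "\<lambda>n. (2 * int n - 2 * int m - 1) * d n"] nonneg that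
      by blast
    moreover have "2 * int n - 2 * int m - 1 \<noteq> 0" for n by presburger
    ultimately have "d n = 0" if "n \<in> X" for n using that by (metis mult_eq_0_iff)
    then have "expo ?u n = expo t n" for n using out[of n] by (cases "n \<in> X") (auto simp: u d_def)
    then show ?thesis by (simp add: poly_mapping_eqI)
  qed simp
qed

text \<open>
  The tabloids of largest weight in a combination of polytabloids satisfy the ballot condition:
  if it failed at \<open>m\<close>, the dual Garnir relation for the numbers above \<open>m\<close> in row \<open>i\<close> and those
  up to \<open>m\<close> in row \<open>i + 1\<close> would express the coefficient at \<open>t\<close> by coefficients at tabloids of
  larger weight, which are zero.
\<close>

lemma leading_lattice:
  assumes v: "v \<in> qs.span (polytabloid ` numberings)" and nz: "coeff v t \<noteq> 0"
    and max: "\<And>t'. coeff v t' \<noteq> 0 \<Longrightarrow> weight t' \<le> weight t"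
  shows "card {n\<in>{1..m}. expo t n = Suc i} \<le> card {n\<in>{1..m}. expo t n = i}"
proof (rule ccontr)
  assume less: "\<not> ?thesis"
  obtain A r where A: "finite A" "A \<subseteq> polytabloid ` numberings" "v = (\<Sum>a\<in>A. qscale (r a) a)"
    using v unfolding qs.span_explicit by blast
  then obtain F where F: "F \<subseteq> numberings" "finite F" "A = polytabloid ` F"
    by (meson finite_subset_image)
  have "finite ({m} \<union> Poly_Mapping.keys t \<union> (\<Union>T\<in>F. T ` core))"
    using F finite_core_image by auto
  then obtain N where N: "{m} \<union> Poly_Mapping.keys t \<union> (\<Union>T\<in>F. T ` core) \<subseteq> {..N}"
    using finite_nat_iff_bounded_le by metis
  let ?A = "\<lambda>i m. {n\<in>{1..m}. expo t n = i}"
  define X where "X = (?A i N - ?A i m) \<union> ?A (Suc i) m"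
  have X: "X \<subseteq> {1..N}" using N by (auto simp: X_def)
  have sub: "?A i m \<subseteq> ?A i N" using N by auto
  have "card X = card (?A i N - ?A i m) + card (?A (Suc i) m)"
    unfolding X_def by (rule card_Un_disjoint) auto
  also have "card (?A i N - ?A i m) = card (?A i N) - card (?A i m)"
    using sub by (intro card_Diff_subset) auto
  finally have big: "card (?A i N) < card X"
    using less card_mono[OF _ sub] by simp
  have rows: "expo t x = i \<and> m < x \<or> expo t x = Suc i \<and> x \<le> m" if "x \<in> X" for x
    using that by (auto simp: X_def)
  have zero: "(\<Sum>\<sigma> | \<sigma> permutes X. coeff (act \<sigma> v) t) = 0"
  proof -
    have "(\<Sum>\<sigma> | \<sigma> permutes X. coeff (act \<sigma> a) t) = 0" if "a \<in> A" for a
    proof -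
      from that obtain T where T: "T \<in> F" "a = polytabloid T" unfolding F(3) by blast
      show ?thesis unfolding T(2)
        by (rule dual_garnir[OF _ _ X big]) (use T(1) F(1) N rows in blast)+
    qed
    moreover have "(\<Sum>\<sigma> | \<sigma> permutes X. coeff (act \<sigma> v) t)
        = (\<Sum>a\<in>A. r a * (\<Sum>\<sigma> | \<sigma> permutes X. coeff (act \<sigma> a) t))"
      by (simp add: A(3) coeff_sum sum_distrib_left) (rule sum.swap)
    ultimately show ?thesis by simp
  qed
  let ?S = "{\<sigma>. \<sigma> permutes X \<and> perm_mono (inv \<sigma>) t = t}"
  have fin: "finite {\<sigma>. \<sigma> permutes X}" using X finite_subset by (intro finite_permutations) blast
  have "coeff (act \<sigma> v) t = (if perm_mono (inv \<sigma>) t = t then coeff v t else 0)" if "\<sigma> permutes X" for \<sigma>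
  proof -
    have "perm_mono (inv \<sigma>) t = t \<or> weight t < weight (perm_mono (inv \<sigma>) t)"
      by (rule weight_exchange[OF that X _ rows]) (use N in auto)
    then show ?thesis
      using max[of "perm_mono (inv \<sigma>) t"] by (cases "coeff v (perm_mono (inv \<sigma>) t) = 0") auto
  qed
  then have "(\<Sum>\<sigma> | \<sigma> permutes X. coeff (act \<sigma> v) t)
      = (\<Sum>\<sigma> | \<sigma> permutes X. if perm_mono (inv \<sigma>) t = t then coeff v t else 0)"
    by (intro sum.cong) auto
  also have "\<dots> = of_nat (card ?S) * coeff v t"
    by (simp add: sum.If_cases[OF fin] Collect_conj_eq)
  finally have "card ?S = 0" using zero nz by simp
  moreover have "finite ?S" using fin by (rule rev_finite_subset) auto
  ultimately have "?S = {}" by (simp only: card_0_eq)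
  moreover have "id \<in> ?S" by (simp add: permutes_id)
  ultimately show False by (metis empty_iff)
qed

lemma row_initial:
  assumes "i \<ge> 1"
  shows "{j. (i, j) \<in> D} = {..<card (diagram_row D i)}"
proof -
  let ?R = "{j. (i, j) \<in> D}"
  have "diagram_row D i = Pair i ` ?R" by (auto simp: diagram_row_def)
  then have c: "card (diagram_row D i) = card ?R" by (simp add: card_image inj_on_def)
  have "?R \<subseteq> {..<width}" using below_width assms by auto
  then have fin: "finite ?R" using finite_subset by blast
  have "j \<in> ?R \<longleftrightarrow> j < card ?R" for j
  proof
    assume j: "j \<in> ?R"
    then have "{..j} \<subseteq> ?R" using diagram_down_closed by blast
    then show "j < card ?R" using card_mono[OF fin, of "{..j}"] by simp
  next
    assume j: "j < card ?R"
    show "j \<in> ?R"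
    proof (rule ccontr)
      assume "j \<notin> ?R"
      then have "?R \<subseteq> {..<j}" using diagram_down_closed by (auto simp: not_less[symmetric])
      then show False using j card_mono[of "{..<j}" ?R] by simp
    qed
  qed
  then show ?thesis unfolding c by blast
qed

text \<open>
  Writing the rows of a tabloid in increasing order gives a standard tableau if the ballot
  condition holds.
\<close>

lemma lattice_standard:
  assumes t: "t \<in> tabloids"
    and lattice: "\<And>m i. card {n\<in>{1..m}. expo t n = Suc i} \<le> card {n\<in>{1..m}. expo t n = i}"
  obtains T where "T \<in> SYT D" "tabloid_of T = t"
proof -
  define A where "A i = {n\<in>{1..}. expo t n = i}" for i
  let ?e = "\<lambda>i. enumerate (A i)"
  let ?R = "\<lambda>i. {j. (i, j) \<in> D}"
  have finA: "finite (A i) \<longleftrightarrow> i \<noteq> 0" for i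
  proof (cases "i = 0")
    case True
    have "finite (Poly_Mapping.keys t)" by simp
    moreover have "{1..} - Poly_Mapping.keys t = A 0" by (auto simp: A_def in_keys_iff)
    ultimately have "infinite (A 0)"
      using infinite_Ici[of "1::nat"] by (metis Diff_infinite_finite)
    then show ?thesis using True by simp
  next
    case False
    then have "A i \<subseteq> Poly_Mapping.keys t" by (auto simp: A_def in_keys_iff)
    then show ?thesis using False finite_subset finite_keys by blast
  qed
  have cardA: "?R i = {..<card (A i)}" if "i \<noteq> 0" for i
  proof -
    have "{n. expo t n = i} = A i" using t that by (auto simp: A_def tabloids_def) (metis gr0I less_eq_Suc_le)
    moreover have "card {n. expo t n = i} = card (diagram_row D i)"
      using t that by (simp add: tabloids_def)
    ultimately have "card (A i) = card (diagram_row D i)" by simp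
    then show ?thesis using row_initial[of i] that by simp
  qed
  have bij: "bij_betw (?e i) (?R i) (A i)" for i
    using finA[of i] cardA[of i] first_row_infinite bij_enumerate[of "A 0"] finite_bij_enumerate[of "A i"]
    by (cases "i = 0") auto
  have mono: "?e i j < ?e i j'" if "(i, j') \<in> D" "j < j'" for i j j'
  proof (cases "i = 0")
    case True
    then show ?thesis using enumerate_mono[OF that(2)] finA[of i] by blast
  next
    case False
    then have "j' < card (A i)" using cardA[OF False] that(1) by blast
    then show ?thesis using finite_enumerate_mono[OF that(2)] finA[of i] False by blast
  qed
  have mono': "j < j'" if "(i, j) \<in> D" "?e i j < ?e i j'" for i j j'
  proof (rule ccontr)
    assume "\<not> j < j'"
    then have "j = j' \<or> j' < j" by auto
    then show False using mono[OF that(1), of j'] that(2) by auto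
  qed
  have inA: "?e i j \<in> A i" if "(i, j) \<in> D" for i j
    using bij_betwE[OF bij[of i]] that by blast
  \<comment> \<open>the ballot condition at the entry below\<close>
  have step: "?e i j < ?e (Suc i) j" if D: "(Suc i, j) \<in> D" for i j
  proof (rule ccontr)
    let ?m = "?e (Suc i) j"
    assume "\<not> ?e i j < ?m"
    moreover have Di: "(i, j) \<in> D" using D diagram_down_closed by (meson le_SucI order_refl)
    moreover have "?e i j \<noteq> ?m" using inA[OF D] inA[OF Di] by (auto simp: A_def)
    ultimately have gt: "?m < ?e i j" by simp
    have "{n\<in>{1..?m}. expo t n = i} \<subseteq> ?e i ` {..<j}"
    proof
      fix n assume n: "n \<in> {n\<in>{1..?m}. expo t n = i}"
      then have "n \<in> A i" by (auto simp: A_def)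
      then obtain k where k: "(i, k) \<in> D" "n = ?e i k" using bij[of i] by (auto simp: bij_betw_def)
      then have "k < j" using n gt by (intro mono'[OF k(1)]) auto
      then show "n \<in> ?e i ` {..<j}" using k by blast
    qed
    then have "card {n\<in>{1..?m}. expo t n = i} \<le> j"
      using surj_card_le[of "{..<j}" "{n\<in>{1..?m}. expo t n = i}" "?e i"] by simp
    moreover have "?e (Suc i) ` {..j} \<subseteq> {n\<in>{1..?m}. expo t n = Suc i}"
    proof
      fix n assume "n \<in> ?e (Suc i) ` {..j}"
      then obtain k where k: "k \<le> j" "n = ?e (Suc i) k" by blast
      then have "(Suc i, k) \<in> D" using D diagram_down_closed by blast
      then show "n \<in> {n\<in>{1..?m}. expo t n = Suc i}"
        using inA[of "Suc i" k] k mono[OF D, of k] by (cases "k = j") (auto simp: A_def)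
    qed
    then have "card (?e (Suc i) ` {..j}) \<le> card {n\<in>{1..?m}. expo t n = Suc i}"
      by (intro card_mono) auto
    moreover have "inj_on (?e (Suc i)) {..j}"
      using bij[of "Suc i"] D diagram_down_closed by (auto simp: bij_betw_def intro: inj_on_subset)
    then have "card (?e (Suc i) ` {..j}) = Suc j" by (simp add: card_image)
    ultimately show False using lattice[of ?m i] by simp
  qed
  have col: "i < i' \<Longrightarrow> (i', j) \<in> D \<Longrightarrow> ?e i j < ?e i' j" for i i' j
  proof (induction i')
    case (Suc i')
    have "(i', j) \<in> D" using Suc.prems diagram_down_closed by (meson le_SucI order_refl)
    then show ?case using Suc step[OF Suc.prems(2)] by (cases "i = i'") auto
  qed simp
  define T where "T = restrict (\<lambda>(i, j). ?e i j) D"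
  have T: "T (i, j) = ?e i j" if "(i, j) \<in> D" for i j using that by (simp add: T_def)
  have bijT: "bij_betw T D {1..}"
  proof (rule bij_betw_imageI)
    show "inj_on T D"
    proof (rule inj_onI, clarify)
      fix i j i' j' assume *: "(i, j) \<in> D" "(i', j') \<in> D" "T (i, j) = T (i', j')"
      then have "?e i j = ?e i' j'" by (simp add: T)
      moreover from this have "i = i'" using inA[OF *(1)] inA[OF *(2)] by (auto simp: A_def)
      ultimately show "i = i' \<and> j = j'"
        using bij[of i] * by (auto simp: bij_betw_def dest: inj_onD)
    qed
    show "T ` D = {1..}"
    proof (intro set_eqI iffI)
      fix n assume "n \<in> T ` D"
      then show "n \<in> {1..}" using inA by (auto simp: T A_def)
    next
      fix n :: nat assume "n \<in> {1..}"
      then have "n \<in> A (expo t n)" by (simp add: A_def)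
      then obtain j where "(expo t n, j) \<in> D" "n = ?e (expo t n) j"
        using bij[of "expo t n"] by (auto simp: bij_betw_def)
      then show "n \<in> T ` D" by (metis T image_eqI)
    qed
  qed
  have SYT: "T \<in> SYT D"
    unfolding SYT_def using bijT mono col by (auto simp: T) (simp add: T_def)
  have "tabloid_of T = t"
  proof (rule poly_mapping_eqI)
    fix n
    have num: "T \<in> numberings" using bijT by (simp add: numberings_def)
    show "expo (tabloid_of T) n = expo t n"
    proof (cases "n = 0")
      case True
      then show ?thesis using t by (simp add: expo_tabloid_of[OF num] tabloids_def)
    next
      case False
      obtain i j where b: "box_of T n = (i, j)" by fastforce
      have "(i, j) \<in> D" "T (i, j) = n" using numbering(3,4)[OF num, of n] b False by auto
      then have "n \<in> A i" using inA T by metis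
      then show ?thesis using False b by (simp add: expo_tabloid_of[OF num] A_def)
    qed
  qed
  then show ?thesis using that SYT by blast
qed

lemma leading_standard:
  assumes v: "v \<in> qs.span (polytabloid ` numberings)" and nz: "coeff v t \<noteq> 0"
    and max: "\<And>t'. coeff v t' \<noteq> 0 \<Longrightarrow> weight t' \<le> weight t"
  obtains T where "T \<in> SYT D" "tabloid_of T = t"
proof -
  have "v \<in> tabloid_space" using v span_tabloid_space by blast
  then have "t \<in> tabloids" using nz by (auto simp: tabloid_space_def)
  then show ?thesis using lattice_standard leading_lattice[OF v nz max] that by blast
qed

text \<open>
  Standard polytabloids already span: the tabloids of largest weight are standard, and
  subtracting the corresponding multiples of polytabloids lowers the largest weight.
\<close>

theorem straightening: "qs.span (polytabloid ` numberings) = qs.span (polytabloid ` SYT D)"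
proof
  let ?S = "qs.span (polytabloid ` numberings)" and ?V = "qs.span (polytabloid ` SYT D)"
  show sub: "?V \<subseteq> ?S" using SYT_numbering by (intro qs.span_mono) auto
  have "v \<in> ?V" if "v \<in> ?S" "\<And>t. coeff v t \<noteq> 0 \<Longrightarrow> weight t < W" for v W
    using that
  proof (induction W arbitrary: v)
    case 0
    then have "v = 0" using series_neq_0_iff by blast
    then show ?case by (simp add: qs.span_zero)
  next
    case (Suc W)
    define A where "A = {t. coeff v t \<noteq> 0 \<and> weight t = W}"
    have "v \<in> tabloid_space" using Suc.prems(1) span_tabloid_space by blast
    then have finA: "finite A" by (auto simp: A_def tabloid_space_def)
    have "\<exists>T\<in>SYT D. tabloid_of T = t" if "t \<in> A" for t
      using leading_standard[OF Suc.prems(1), of t] Suc.prems(2) that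
      by (metis (mono_tags, lifting) A_def less_Suc_eq_le mem_Collect_eq)
    then obtain \<tau> where \<tau>: "\<And>t. t \<in> A \<Longrightarrow> \<tau> t \<in> SYT D" "\<And>t. t \<in> A \<Longrightarrow> tabloid_of (\<tau> t) = t"
      by metis
    define w where "w = (\<Sum>t\<in>A. qscale (coeff v t) (polytabloid (\<tau> t)))"
    have w: "w \<in> ?V" unfolding w_def using \<tau>(1)
      by (intro qs.span_sum qs.span_scale qs.span_base) auto
    have "weight t' < W" if nz: "coeff (v - w) t' \<noteq> 0" for t'
    proof (rule ccontr)
      assume W: "\<not> weight t' < W"
      have "coeff (polytabloid (\<tau> t)) t' = (if t' = t then 1 else 0)" if t: "t \<in> A" for t
        using polytabloid_leading[OF \<tau>(1)[OF t], of t'] W t \<tau>(2)[OF t]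
          coeff_polytabloid_self[OF SYT_numbering[OF \<tau>(1)[OF t]]]
        by (auto simp: A_def)
      then have "coeff w t' = (\<Sum>t\<in>A. if t' = t then coeff v t else 0)"
        unfolding w_def coeff_sum by (intro sum.cong) auto
      also have "\<dots> = (if t' \<in> A then coeff v t' else 0)" using finA by simp
      also have "\<dots> = coeff v t'"
        using Suc.prems(2)[of t'] W by (cases "coeff v t' = 0") (auto simp: A_def)
      finally show False using nz by simp
    qed
    moreover have "v - w \<in> ?S" using Suc.prems(1) w sub by (intro qs.span_diff) auto
    ultimately have "v - w \<in> ?V" by (rule Suc.IH[rotated])
    then show ?case using w qs.span_add[of "v - w" _ w] by simp
  qed
  moreover have "\<exists>W. \<forall>t. coeff v t \<noteq> 0 \<longrightarrow> weight t < W" if "v \<in> ?S" for v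
  proof -
    have "finite {t. coeff v t \<noteq> 0}" using that span_tabloid_space by (auto simp: tabloid_space_def)
    then have "finite (weight ` {t. coeff v t \<noteq> 0})" by simp
    then show ?thesis using finite_nat_iff_bounded by (metis (mono_tags, lifting) image_subset_iff lessThan_iff mem_Collect_eq)
  qed
  ultimately show "?S \<subseteq> ?V" by blast
qed

text \<open>A standard tableau is determined by its tabloid.\<close>

lemma SYT_eqI:
  assumes T: "T \<in> SYT D" "T' \<in> SYT D" and eq: "tabloid_of T = tabloid_of T'"
  shows "T = T'"
proof -
  have nn: "T \<in> numberings" "T' \<in> numberings" using T SYT_numbering by auto
  have notless: "\<not> U (i, j) < U' (i, j)"
    if U: "U \<in> SYT D" "U' \<in> SYT D" "tabloid_of U = tabloid_of U'" and D: "(i, j) \<in> D"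
      and IH: "\<And>k. k < j \<Longrightarrow> U (i, k) = U' (i, k)" for U U' i j
  proof
    assume less: "U (i, j) < U' (i, j)"
    have n: "U \<in> numberings" "U' \<in> numberings" using U SYT_numbering by auto
    let ?n = "U (i, j)"
    have n1: "?n \<ge> 1" using numbering(2)[OF n(1) D] .
    have "fst (box_of U' ?n) = expo (tabloid_of U') ?n" using n1 by (simp add: expo_tabloid_of[OF n(2)])
    also have "\<dots> = i" using D n(1) by (simp add: U(3)[symmetric])
    finally obtain k where k: "box_of U' ?n = (i, k)" by (metis prod.collapse)
    then have k': "(i, k) \<in> D" "U' (i, k) = ?n" using numbering(3,4)[OF n(2) n1] by auto
    have "k < j"
    proof (rule ccontr)
      assume "\<not> k < j"
      then have "U' (i, j) \<le> U' (i, k)"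
        using U(2) D k'(1) by (cases "j = k") (auto simp: SYT_def intro: less_imp_le)
      then show False using less k' by simp
    qed
    then have "U (i, k) = U (i, j)" using IH k'(2) by simp
    then show False using numbering(5)[OF n(1) k'(1) D] \<open>k < j\<close> by simp
  qed
  have "(i, j) \<in> D \<Longrightarrow> T (i, j) = T' (i, j)" for i j
  proof (induction j rule: less_induct)
    case (less j)
    have "T (i, k) = T' (i, k)" if "k < j" for k
      using less.IH[OF that] diagram_down_closed[OF less.prems order_refl] that by simp
    then show ?case
      using notless[OF T eq less.prems] notless[OF T(2,1) eq[symmetric] less.prems]
      by (metis linorder_neqE_nat)
  qed
  moreover have "T \<in> extensional D" "T' \<in> extensional D" using T by (auto simp: SYT_def)
  ultimately show ?thesis by (metis extensionalityI surj_pair)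
qed

lemma SYT_support:
  assumes "T \<in> SYT D" "T' \<in> SYT D" "coeff (polytabloid T') (tabloid_of T) \<noteq> 0"
  shows "T = T' \<or> weight (tabloid_of T) < weight (tabloid_of T')"
  using polytabloid_leading[OF assms(2,3)] SYT_eqI[OF assms(1,2)] by blast

theorem polytabloid_basis:
  "is_basis polytabloid (SYT D) (qs.span (polytabloid ` SYT D))"
proof -
  have self: "coeff (polytabloid T) (tabloid_of T) = 1" if "T \<in> SYT D" for T
    using coeff_polytabloid_self SYT_numbering that by blast
  have inj: "inj_on polytabloid (SYT D)"
  proof (rule inj_onI)
    fix T T' assume *: "T \<in> SYT D" "T' \<in> SYT D" "polytabloid T = polytabloid T'"
    then show "T = T'"
      using SYT_support[of T T'] SYT_support[of T' T] self by (metis order_less_asym zero_neq_one)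
  qed
  have "qs.independent (polytabloid ` SYT D)"
    unfolding qs.dependent_explicit
  proof clarify
    fix B u v
    assume B: "finite B" "B \<subseteq> polytabloid ` SYT D" "(\<Sum>v\<in>B. qscale (u v) v) = 0"
      and v: "v \<in> B" "u v \<noteq> 0"
    have "\<exists>T\<in>SYT D. polytabloid T = b" if "b \<in> B" for b using B(2) that by blast
    then obtain \<tau> where \<tau>: "\<And>b. b \<in> B \<Longrightarrow> \<tau> b \<in> SYT D" "\<And>b. b \<in> B \<Longrightarrow> polytabloid (\<tau> b) = b"
      by metis
    let ?W = "\<lambda>b. weight (tabloid_of (\<tau> b))"
    define P where "P = {b\<in>B. u b \<noteq> 0}"
    have P: "finite P" "P \<noteq> {}" using B(1) v by (auto simp: P_def)
    then have "Max (?W ` P) \<in> ?W ` P" by (intro Max_in) auto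
    then obtain b where b: "b \<in> P" "?W b = Max (?W ` P)" by auto
    have bB: "b \<in> B" "u b \<noteq> 0" using b by (auto simp: P_def)
    have "u a * coeff a (tabloid_of (\<tau> b)) = (if a = b then u b else 0)" if a: "a \<in> B" for a
    proof (cases "a = b")
      case True
      then show ?thesis using self[OF \<tau>(1)[OF bB(1)]] \<tau>(2)[OF bB(1)] by simp
    next
      case False
      have "coeff a (tabloid_of (\<tau> b)) = 0" if "u a \<noteq> 0"
      proof (rule ccontr)
        assume "coeff a (tabloid_of (\<tau> b)) \<noteq> 0"
        then have "\<tau> b = \<tau> a \<or> ?W b < ?W a"
          using SYT_support[OF \<tau>(1)[OF bB(1)] \<tau>(1)[OF a]] \<tau>(2)[OF a] by simp
        moreover have "?W a \<le> ?W b" using a that P(1) b(2) by (simp add: P_def)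
        ultimately have "\<tau> b = \<tau> a" by simp
        then show False using \<tau>(2)[OF a] \<tau>(2)[OF bB(1)] False by simp
      qed
      then show ?thesis using False by auto
    qed
    then have "coeff (\<Sum>v\<in>B. qscale (u v) v) (tabloid_of (\<tau> b)) = (\<Sum>a\<in>B. if a = b then u b else 0)"
      unfolding coeff_sum by (intro sum.cong) auto
    also have "\<dots> = u b" using B(1) bB(1) by simp
    finally show False using B(3) bB(2) by simp
  qed
  then show ?thesis using inj by (simp add: is_basis_def)
qed

section \<open>Tabloids against columns\<close>

lemma numberings_nonempty: "numberings \<noteq> {}"
proof -
  have "infinite (range (Pair (0::nat)) :: box set)" by (rule range_inj_infinite) (simp add: inj_on_def)
  then have "infinite D" using first_row_infinite infinite_super[of "range (Pair 0)" D] by blast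
  moreover have "countable D" by simp
  ultimately have "bij_betw (to_nat_on D) D UNIV" by (rule to_nat_on_infinite[rotated])
  moreover have "bij_betw Suc UNIV {1..}"
    by (rule bij_betw_byWitness[where f' = "\<lambda>n. n - 1"]) auto
  ultimately have "bij_betw (Suc \<circ> to_nat_on D) D {1..}" by (rule bij_betw_trans)
  then show ?thesis by (auto simp: numberings_def)
qed

text \<open>Level sets of the right sizes do characterise the monomials \<open>tabloid_of T\<close>.\<close>

lemma tabloid_numbering:
  assumes t: "t \<in> tabloids"
  obtains T where "T \<in> numberings" "tabloid_of T = t"
proof -
  obtain U where U: "U \<in> numberings" using numberings_nonempty by blast
  let ?u = "tabloid_of U"
  have "?u \<in> tabloids" by (rule tabloid_of_tabloids[OF U])
  then have u0: "expo ?u 0 = 0" and uc: "\<And>i. i \<noteq> 0 \<Longrightarrow> card {n. expo ?u n = i} = card (diagram_row D i)"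
    by (auto simp: tabloids_def)
  have t0: "expo t 0 = 0" and tc: "\<And>i. i \<noteq> 0 \<Longrightarrow> card {n. expo t n = i} = card (diagram_row D i)"
    using t by (auto simp: tabloids_def)
  have lev: "{n\<in>{1..}. expo m n = i} = {n. expo m n = i}" if "expo m 0 = 0" "i \<noteq> 0" for m i
    using that by (metis (no_types, lifting) Collect_cong atLeast_iff gr0I less_one not_le)
  have fin: "finite {n\<in>{1..}. expo m n \<noteq> 0}" for m :: mono by simp
  have "card {n\<in>{1..}. expo t n = c} = card {n\<in>{1..}. expo ?u n = c}" if "c \<noteq> 0" for c
    using lev[OF t0 that] lev[OF u0 that] tc[OF that] uc[OF that] by simp
  then obtain \<sigma> where \<sigma>: "\<sigma> \<in> S_infty" "\<And>n. n \<ge> 1 \<Longrightarrow> expo ?u (\<sigma> n) = expo t n"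
    using finitary_permutation_exists[of "expo t" 0 "expo ?u"] fin by blast
  then have S: "\<sigma> \<in> S_nat" using S_infty_subset by blast
  note s = S_natD[OF S]
  have "expo ?u (\<sigma> n) = expo t n" for n
    using \<sigma>(2)[of n] s(2) u0 t0 by (cases "n = 0") auto
  then have "perm_mono (inv \<sigma>) ?u = t"
    using s(1) by (intro poly_mapping_eqI) (simp add: expo_perm_mono bij_imp_bij_inv inv_inv_eq)
  then have "tabloid_of (inv \<sigma> \<circ> U) = t" by (simp add: tabloid_of_comp[OF U s(4)])
  then show ?thesis using that numbering_comp[OF U s(4)] by blast
qed

lemma card_rows_below:
  assumes "t \<in> tabloids" "k \<ge> 1"
  shows "card {n. k \<le> expo t n} = card {b \<in> D. k \<le> fst b}"
proof -
  obtain T where T: "T \<in> numberings" "tabloid_of T = t" using tabloid_numbering[OF assms(1)] .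
  have "{n. k \<le> expo t n} = T ` {b \<in> D. k \<le> fst b}"
  proof (intro set_eqI iffI)
    fix n assume n: "n \<in> {n. k \<le> expo t n}"
    then have n1: "n \<ge> 1" "k \<le> fst (box_of T n)"
      using assms(2) by (auto simp: T(2)[symmetric] expo_tabloid_of[OF T(1)] split: if_splits)
    then have "box_of T n \<in> {b \<in> D. k \<le> fst b}" "n = T (box_of T n)"
      using numbering(3,4)[OF T(1) n1(1)] by simp_all
    then show "n \<in> T ` {b \<in> D. k \<le> fst b}" by blast
  next
    fix n assume "n \<in> T ` {b \<in> D. k \<le> fst b}"
    then show "n \<in> {n. k \<le> expo t n}" using tabloid_of_box[OF T(1)] by (auto simp: T(2)[symmetric])
  qed
  then show ?thesis using numbering(5)[OF T(1)] by (simp add: card_image inj_on_def)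
qed

text \<open>No two numbers of a column of \<open>T\<close> lie in the same row of \<open>t\<close>.\<close>

definition transversal :: "(box \<Rightarrow> nat) \<Rightarrow> mono \<Rightarrow> bool"
  where "transversal T t \<longleftrightarrow> (\<forall>x\<ge>1. \<forall>y\<ge>1.
    snd (box_of T x) = snd (box_of T y) \<and> expo t x = expo t y \<longrightarrow> x = y)"

text \<open>The set of numbers in a column.\<close>

definition col_nums :: "(box \<Rightarrow> nat) \<Rightarrow> nat \<Rightarrow> nat set"
  where "col_nums T c = {n. n \<ge> 1 \<and> snd (box_of T n) = c}"

lemma col_nums_image: "T \<in> numberings \<Longrightarrow> col_nums T c = T ` {b \<in> D. snd b = c}"
proof (intro set_eqI iffI)
  fix n assume T: "T \<in> numberings" and "n \<in> col_nums T c"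
  then have "box_of T n \<in> {b \<in> D. snd b = c}" "n = T (box_of T n)"
    using numbering(3,4)[OF T] by (simp_all add: col_nums_def)
  then show "n \<in> T ` {b \<in> D. snd b = c}" by blast
next
  fix n assume T: "T \<in> numberings" and "n \<in> T ` {b \<in> D. snd b = c}"
  then obtain b where "b \<in> D" "snd b = c" "n = T b" by blast
  then show "n \<in> col_nums T c" using numbering(1,2)[OF T] by (simp add: col_nums_def)
qed

lemma finite_col: "finite {b \<in> D. snd b = c}"
proof (rule finite_subset)
  show "{b \<in> D. snd b = c} \<subseteq> insert (0, c) (finite_part D)"
    by (auto simp: finite_part_def)
qed (use finite_finite_part in simp)

lemma finite_col_nums: "T \<in> numberings \<Longrightarrow> finite (col_nums T c)"
  by (simp add: col_nums_image finite_col)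

text \<open>Of distinct rows, at most \<open>k\<close> lie above row \<open>k\<close>.\<close>

lemma transversal_column_count:
  assumes T: "T \<in> numberings" and tr: "transversal T t"
  shows "card {b \<in> D. snd b = c \<and> k \<le> fst b} \<le> card {n \<in> col_nums T c. k \<le> expo t n}"
proof (cases "\<exists>r. (r, c) \<in> D \<and> k \<le> r")
  case False
  then have "{b \<in> D. snd b = c \<and> k \<le> fst b} = {}" by auto
  then show ?thesis by (simp only: card.empty le0)
next
  case True
  let ?B = "{b \<in> D. snd b = c}" and ?K = "col_nums T c"
  have fK: "finite ?K" by (rule finite_col_nums[OF T])
  have eq: "card ?K = card ?B"
    unfolding col_nums_image[OF T] using numbering(5)[OF T] by (simp add: card_image inj_on_def)
  have "inj_on (expo t) {n \<in> ?K. expo t n < k}"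
    using tr by (auto simp: inj_on_def transversal_def col_nums_def)
  then have "card {n \<in> ?K. expo t n < k} \<le> card {..<k}"
    by (rule card_inj_on_le) auto
  then have le: "card {n \<in> ?K. expo t n < k} \<le> k" by simp
  have "{b \<in> ?B. fst b < k} = (\<lambda>r. (r, c)) ` {..<k}"
    using True diagram_down_closed by (fastforce simp: image_iff)
  then have k: "card {b \<in> ?B. fst b < k} = k" by (simp add: card_image inj_on_def)
  have "card ?K = card ({n \<in> ?K. expo t n < k} \<union> {n \<in> ?K. k \<le> expo t n})"
    by (rule arg_cong[where f = card]) auto
  also have "\<dots> = card {n \<in> ?K. expo t n < k} + card {n \<in> ?K. k \<le> expo t n}"
    by (rule card_Un_disjoint) (use fK in auto)
  finally have 1: "card ?K = card {n \<in> ?K. expo t n < k} + card {n \<in> ?K. k \<le> expo t n}" .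
  have "card ?B = card ({b \<in> ?B. fst b < k} \<union> {b \<in> D. snd b = c \<and> k \<le> fst b})"
    by (rule arg_cong[where f = card]) auto
  also have "\<dots> = card {b \<in> ?B. fst b < k} + card {b \<in> D. snd b = c \<and> k \<le> fst b}"
  proof (rule card_Un_disjoint)
    show "finite {b \<in> ?B. fst b < k}" using finite_col[of c] by (rule rev_finite_subset) auto
    show "finite {b \<in> D. snd b = c \<and> k \<le> fst b}" using finite_col[of c] by (rule rev_finite_subset) auto
  qed auto
  finally show ?thesis using 1 eq le k by simp
qed

text \<open>
  Finitely many columns account for everything below the first row, in \<open>D\<close> as well as in \<open>t\<close>.
  The parameter \<open>c\<close> forces a given column to be among them.
\<close>

lemma transversal_sums:
  assumes T: "T \<in> numberings" and t0: "expo t 0 = 0" and k: "k \<ge> 1"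
  obtains c0 where
    "card {b \<in> D. k \<le> fst b} = (\<Sum>c<c0. card {b \<in> D. snd b = c \<and> k \<le> fst b})"
    "card {n. k \<le> expo t n} = (\<Sum>c<c0. card {n \<in> col_nums T c. k \<le> expo t n})"
    "c < c0"
proof -
  have "finite ({width, c} \<union> (\<lambda>n. snd (box_of T n)) ` Poly_Mapping.keys t)" by simp
  then obtain c0 where c0: "{width, c} \<union> (\<lambda>n. snd (box_of T n)) ` Poly_Mapping.keys t \<subseteq> {..<c0}"
    using finite_nat_iff_bounded by metis
  have 1: "card {b \<in> D. k \<le> fst b} = (\<Sum>c<c0. card {b \<in> D. snd b = c \<and> k \<le> fst b})"
  proof -
    have "{b \<in> D. k \<le> fst b} = (\<Union>c<c0. {b \<in> D. snd b = c \<and> k \<le> fst b})"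
      using c0 below_width k by fastforce
    moreover have "card (\<Union>c<c0. {b \<in> D. snd b = c \<and> k \<le> fst b})
        = (\<Sum>c<c0. card {b \<in> D. snd b = c \<and> k \<le> fst b})"
    proof (rule card_UN_disjoint)
      have "finite {b \<in> D. snd b = c \<and> k \<le> fst b}" for c
        using finite_col[of c] by (rule rev_finite_subset) auto
      then show "\<forall>c\<in>{..<c0}. finite {b \<in> D. snd b = c \<and> k \<le> fst b}" by blast
    qed auto
    ultimately show ?thesis by simp
  qed
  have 2: "card {n. k \<le> expo t n} = (\<Sum>c<c0. card {n \<in> col_nums T c. k \<le> expo t n})"
  proof -
    have "{n. k \<le> expo t n} = (\<Union>c<c0. {n \<in> col_nums T c. k \<le> expo t n})"
    proof (intro set_eqI iffI)
      fix n assume "n \<in> {n. k \<le> expo t n}"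
      then have n: "k \<le> expo t n" "n \<in> Poly_Mapping.keys t" "n \<ge> 1"
        using k t0 by (auto simp: in_keys_iff Suc_le_eq intro!: gr0I)
      then have "snd (box_of T n) < c0" using c0 by auto
      then show "n \<in> (\<Union>c<c0. {n \<in> col_nums T c. k \<le> expo t n})" using n by (auto simp: col_nums_def)
    qed auto
    moreover have "card (\<Union>c<c0. {n \<in> col_nums T c. k \<le> expo t n})
        = (\<Sum>c<c0. card {n \<in> col_nums T c. k \<le> expo t n})"
    proof (rule card_UN_disjoint)
      show "\<forall>c\<in>{..<c0}. finite {n \<in> col_nums T c. k \<le> expo t n}"
        using finite_col_nums[OF T] by simp
    qed (auto simp: col_nums_def)
    ultimately show ?thesis by simp
  qed
  show ?thesis using that[OF 1 2] c0 by simp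
qed

lemma transversal_dominance:
  assumes T: "T \<in> numberings" and t0: "expo t 0 = 0" and tr: "transversal T t" and k: "k \<ge> 1"
  shows "card {b \<in> D. k \<le> fst b} \<le> card {n. k \<le> expo t n}"
proof -
  obtain c0 where c0: "card {b \<in> D. k \<le> fst b} = (\<Sum>c<c0. card {b \<in> D. snd b = c \<and> k \<le> fst b})"
    "card {n. k \<le> expo t n} = (\<Sum>c<c0. card {n \<in> col_nums T c. k \<le> expo t n})" "0 < c0"
    using transversal_sums[OF T t0 k] .
  show ?thesis unfolding c0(1,2) by (rule sum_mono) (rule transversal_column_count[OF T tr])
qed

text \<open>
  When the shapes agree, equality holds in all column counts, so the rows of the numbers of each
  column are those of its boxes.
\<close>

lemma transversal_same_shape:
  assumes T: "T \<in> numberings" and t: "t \<in> tabloids" and tr: "transversal T t"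
  obtains \<sigma> where "\<sigma> \<in> col_group D T" "t = perm_mono \<sigma> (tabloid_of T)"
proof -
  have t0: "expo t 0 = 0" using t by (simp add: tabloids_def)
  have D: "(expo t n, snd (box_of T n)) \<in> D" if n: "n \<ge> 1" for n
  proof (rule ccontr)
    let ?k = "expo t n" and ?c = "snd (box_of T n)"
    assume nD: "(?k, ?c) \<notin> D"
    then have k: "?k \<ge> 1" using first_row_infinite by (metis less_one not_le)
    obtain c0 where c0: "card {b \<in> D. ?k \<le> fst b} = (\<Sum>c<c0. card {b \<in> D. snd b = c \<and> ?k \<le> fst b})"
      "card {n. ?k \<le> expo t n} = (\<Sum>c<c0. card {n \<in> col_nums T c. ?k \<le> expo t n})" "?c < c0"
      using transversal_sums[OF T t0 k] .
    have "(\<Sum>c<c0. card {b \<in> D. snd b = c \<and> ?k \<le> fst b})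
        = (\<Sum>c<c0. card {n \<in> col_nums T c. ?k \<le> expo t n})"
      using card_rows_below[OF t k] c0 by simp
    then have "card {b \<in> D. snd b = ?c \<and> ?k \<le> fst b} = card {n \<in> col_nums T ?c. ?k \<le> expo t n}"
      by (rule sum_mono_inv) (use transversal_column_count[OF T tr] c0(3) in auto)
    moreover have "(r, ?c) \<notin> D" if "?k \<le> r" for r
      using nD diagram_down_closed[of r ?c ?k ?c] that by auto
    then have "{b \<in> D. snd b = ?c \<and> ?k \<le> fst b} = {}" by auto
    ultimately have "card {n \<in> col_nums T ?c. ?k \<le> expo t n} = 0" by (simp only: card.empty)
    then have "{n \<in> col_nums T ?c. ?k \<le> expo t n} = {}" using finite_col_nums[OF T] by simp
    moreover have "n \<in> {n \<in> col_nums T ?c. ?k \<le> expo t n}" using n by (simp add: col_nums_def)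
    ultimately show False by blast
  qed
  define \<rho> where "\<rho> n = (if n \<ge> 1 then T (expo t n, snd (box_of T n)) else n)" for n
  have \<rho>1: "\<rho> n \<ge> 1" "box_of T (\<rho> n) = (expo t n, snd (box_of T n))" if "n \<ge> 1" for n
    using numbering(1,2)[OF T D[OF that]] that by (auto simp: \<rho>_def)
  have inj: "inj_on \<rho> {1..}"
  proof (rule inj_onI)
    fix x y assume xy: "x \<in> {1..}" "y \<in> {1..}" "\<rho> x = \<rho> y"
    then have "(expo t x, snd (box_of T x)) = (expo t y, snd (box_of T y))"
      using \<rho>1(2)[of x] \<rho>1(2)[of y] by simp
    then show "x = y" using tr xy by (auto simp: transversal_def)
  qed
  have "\<rho> ` {1..} = {1..}"
  proof
    show "\<rho> ` {1..} \<subseteq> {1..}" using \<rho>1(1) by auto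
    show "{1..} \<subseteq> \<rho> ` {1..}"
    proof
      fix n :: nat assume n: "n \<in> {1..}"
      let ?K = "col_nums T (snd (box_of T n))"
      have "\<rho> ` ?K = ?K"
      proof (rule endo_inj_surj[OF finite_col_nums[OF T]])
        show "\<rho> ` ?K \<subseteq> ?K" using \<rho>1 by (auto simp: col_nums_def simp del: One_nat_def)
        show "inj_on \<rho> ?K" by (rule inj_on_subset[OF inj]) (auto simp: col_nums_def)
      qed
      moreover have "n \<in> ?K" using n by (simp add: col_nums_def)
      ultimately have "n \<in> \<rho> ` ?K" by simp
      then show "n \<in> \<rho> ` {1..}" by (auto simp: col_nums_def)
    qed
  qed
  then have "\<rho> permutes {1..}" using inj by (intro bij_imp_permutes) (auto simp: bij_betw_def \<rho>_def)
  then have S: "\<rho> \<in> S_nat" by (simp add: S_nat_def)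
  note s = S_natD[OF S]
  have C: "\<rho> \<in> col_group D T" using S \<rho>1(2) by (simp add: col_group_iff[OF T])
  have "t = perm_mono (inv \<rho>) (tabloid_of T)"
  proof (rule poly_mapping_eqI)
    fix n
    have "expo (perm_mono (inv \<rho>) (tabloid_of T)) n = expo (tabloid_of T) (\<rho> n)"
      using s(1) by (simp add: expo_perm_mono bij_imp_bij_inv inv_inv_eq)
    also have "\<dots> = expo t n"
      using \<rho>1[of n] s(2) t0 by (cases "n = 0") (simp_all add: expo_tabloid_of[OF T])
    finally show "expo t n = expo (perm_mono (inv \<rho>) (tabloid_of T)) n" by simp
  qed
  then show ?thesis using that col_group_inv[OF C] by blast
qed

lemma column_sum_nontransversal:
  assumes T: "T \<in> numberings" and nt: "\<not> transversal T t"
  shows "column_sum T (mono_sum {t}) = 0"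
proof -
  obtain x y where xy: "x \<ge> 1" "y \<ge> 1" "snd (box_of T x) = snd (box_of T y)" "expo t x = expo t y" "x \<noteq> y"
    using nt by (auto simp: transversal_def)
  let ?\<tau> = "Transposition.transpose x y"
  have \<tau>: "?\<tau> \<in> col_group D T" by (rule col_group_transpose[OF T xy(1-3)])
  have b: "bij ?\<tau>" using S_natD(1)[OF col_group_S_nat[OF \<tau>]] .
  have "perm_mono ?\<tau> t = t"
  proof (rule poly_mapping_eqI)
    fix n
    show "expo (perm_mono ?\<tau> t) n = expo t n"
      using xy(4) by (simp add: expo_perm_mono[OF b]) (simp add: transpose_def)
  qed
  then have "act ?\<tau> (mono_sum {t}) = mono_sum {t}" by (simp add: act_mono_sum[OF b])
  then have "column_sum T (mono_sum {t}) = - column_sum T (mono_sum {t})"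
    using column_sum_act[OF T \<tau>, of "mono_sum {t}"] xy(5) by (simp add: sign_swap_id qs.scale_minus_left)
  then have "coeff (column_sum T (mono_sum {t})) m = - coeff (column_sum T (mono_sum {t})) m" for m
    by (metis coeff_simps(4))
  then have "coeff (column_sum T (mono_sum {t})) m = 0" for m by (metis neg_equal_zero)
  then show ?thesis using series_neq_0_iff by blast
qed

lemma column_sum_tabloid:
  assumes T: "T \<in> numberings" and t: "t \<in> tabloids"
  shows "\<exists>c. column_sum T (mono_sum {t}) = qscale c (polytabloid T)"
proof (cases "transversal T t")
  case False
  then have "column_sum T (mono_sum {t}) = qscale 0 (polytabloid T)"
    using column_sum_nontransversal[OF T] by simp
  then show ?thesis ..
next
  case True
  obtain \<sigma> where \<sigma>: "\<sigma> \<in> col_group D T" "t = perm_mono \<sigma> (tabloid_of T)"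
    using transversal_same_shape[OF T t True] .
  have "mono_sum {t} = act \<sigma> (mono_sum {tabloid_of T})"
    using \<sigma> S_natD(1)[OF col_group_S_nat[OF \<sigma>(1)]] by (simp add: act_mono_sum)
  then show ?thesis using column_sum_act[OF T \<sigma>(1)] by (auto simp: polytabloid_def)
qed

lemma tabloid_expansion:
  assumes "finite {t. coeff v t \<noteq> 0}"
  shows "v = (\<Sum>t | coeff v t \<noteq> 0. qscale (coeff v t) (mono_sum {t}))"
proof (rule series_eqI)
  fix m
  have "(\<Sum>t | coeff v t \<noteq> 0. coeff v t * (if m \<in> {t} then 1 else 0))
      = (\<Sum>t | coeff v t \<noteq> 0. if m = t then coeff v t else 0)"
    by (rule sum.cong) auto
  also have "\<dots> = coeff v m" using assms by simp
  finally show "coeff v m = coeff (\<Sum>t | coeff v t \<noteq> 0. qscale (coeff v t) (mono_sum {t})) m"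
    by (simp add: coeff_sum)
qed

text \<open>The basic fact of James's submodule theorem.\<close>

lemma column_sum_multiple:
  assumes T: "T \<in> numberings" and v: "v \<in> tabloid_space"
  shows "\<exists>c. column_sum T v = qscale c (polytabloid T)"
proof -
  have fin: "finite {t. coeff v t \<noteq> 0}" and sub: "{t. coeff v t \<noteq> 0} \<subseteq> tabloids"
    using v by (auto simp: tabloid_space_def)
  obtain c where c: "\<And>t. t \<in> tabloids \<Longrightarrow> column_sum T (mono_sum {t}) = qscale (c t) (polytabloid T)"
    using column_sum_tabloid[OF T] by metis
  have "column_sum T v = column_sum T (\<Sum>t | coeff v t \<noteq> 0. qscale (coeff v t) (mono_sum {t}))"
    using tabloid_expansion[OF fin] by simp
  also have "\<dots> = (\<Sum>t | coeff v t \<noteq> 0. qscale (coeff v t) (column_sum T (mono_sum {t})))"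
    by (simp add: qs2.linear_sum[OF linear_column_sum] qs2.linear_scale[OF linear_column_sum])
  also have "\<dots> = (\<Sum>t | coeff v t \<noteq> 0. qscale (coeff v t * c t) (polytabloid T))"
    by (rule sum.cong) (use c sub in auto)
  also have "\<dots> = qscale (\<Sum>t | coeff v t \<noteq> 0. coeff v t * c t) (polytabloid T)"
    by (simp add: qs.scale_sum_left)
  finally show ?thesis ..
qed

section \<open>Irreducibility\<close>

text \<open>The Specht module of the shape.\<close>

definition specht :: "series set"
  where "specht = qs.span (polytabloid ` SYT D)"

lemma polytabloid_specht: "T \<in> numberings \<Longrightarrow> polytabloid T \<in> specht"
  unfolding specht_def straightening[symmetric] by (rule qs.span_base) blast

lemma specht_tabloid_space: "specht \<subseteq> tabloid_space"
  unfolding specht_def straightening[symmetric] by (rule span_tabloid_space) simp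

lemma subspace_specht: "qs.subspace specht"
  by (simp add: specht_def)

lemma act_specht:
  assumes \<sigma>: "\<sigma> \<in> S_nat" and v: "v \<in> specht"
  shows "act \<sigma> v \<in> specht"
proof -
  have "act \<sigma> v \<in> act \<sigma> ` qs.span (polytabloid ` numberings)"
    using v unfolding specht_def straightening[symmetric] by (rule imageI)
  also have "\<dots> = qs.span (act \<sigma> ` polytabloid ` numberings)"
    by (rule qs2.linear_span_image[OF linear_act, symmetric])
  also have "\<dots> \<subseteq> qs.span specht"
  proof (rule qs.span_mono)
    show "act \<sigma> ` polytabloid ` numberings \<subseteq> specht"
      using polytabloid_specht act_polytabloid numbering_comp \<sigma> by auto
  qed
  finally show ?thesis using subspace_specht by (simp add: qs.span_eq_iff[THEN iffD2])
qed

text \<open>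
  The inner product for which the tabloids are orthonormal, of a vector with a polytabloid.
\<close>

lemma pairing:
  assumes T: "T \<in> numberings" and fin: "finite {t. coeff u t \<noteq> 0}"
  shows "(\<Sum>t | coeff u t \<noteq> 0. coeff u t * coeff (polytabloid T) t)
    = coeff (column_sum T u) (tabloid_of T)"
proof -
  let ?S = "{t. coeff u t \<noteq> 0}" and ?C = "col_group D T"
  have "(\<Sum>t\<in>?S. coeff u t * coeff (polytabloid T) t)
      = (\<Sum>\<sigma>\<in>?C. \<Sum>t\<in>?S. if t = perm_mono \<sigma> (tabloid_of T) then of_int (sign \<sigma>) * coeff u t else 0)"
    unfolding coeff_polytabloid[OF T] sum_distrib_left
    by (subst sum.swap) (intro sum.cong, auto)
  also have "\<dots> = (\<Sum>\<sigma>\<in>?C. of_int (sign \<sigma>) * coeff u (perm_mono \<sigma> (tabloid_of T)))"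
    by (rule sum.cong) (use fin in auto)
  also have "\<dots> = (\<Sum>\<sigma>\<in>?C. of_int (sign \<sigma>) * coeff u (perm_mono (inv \<sigma>) (tabloid_of T)))"
  proof (rule sum.reindex_bij_witness[where i = inv and j = inv])
    fix \<sigma> assume \<sigma>: "\<sigma> \<in> ?C"
    have b: "bij \<sigma>" and p: "permutation \<sigma>"
      using S_natD(1)[OF col_group_S_nat[OF \<sigma>]] S_infty_permutation[OF col_group_S_infty[OF T \<sigma>]] by auto
    show "inv (inv \<sigma>) = \<sigma>" "inv \<sigma> \<in> ?C" using b \<sigma> by (simp_all add: inv_inv_eq col_group_inv)
    then show "inv (inv \<sigma>) = \<sigma>" "inv \<sigma> \<in> ?C" by simp_all
    show "of_int (sign (inv \<sigma>)) * coeff u (perm_mono (inv (inv \<sigma>)) (tabloid_of T))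
        = of_int (sign \<sigma>) * coeff u (perm_mono \<sigma> (tabloid_of T))"
      using b p by (simp add: inv_inv_eq sign_inverse)
  qed
  also have "\<dots> = coeff (column_sum T u) (tabloid_of T)" by (simp add: coeff_column_sum)
  finally show ?thesis .
qed

text \<open>
  A vector that all column sums annihilate is orthogonal to every polytabloid, hence to itself.
\<close>

lemma column_sum_nonzero:
  assumes u: "u \<in> specht" "u \<noteq> 0"
  obtains T where "T \<in> SYT D" "column_sum T u \<noteq> 0"
proof -
  let ?S = "{t. coeff u t \<noteq> 0}"
  have fin: "finite ?S" using u(1) specht_tabloid_space by (auto simp: tabloid_space_def)
  define l where "l w = (\<Sum>t\<in>?S. coeff u t * coeff w t)" for w
  have "\<exists>T\<in>SYT D. column_sum T u \<noteq> 0"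
  proof (rule ccontr)
    assume "\<not> ?thesis"
    then have z: "column_sum T u = 0" if "T \<in> SYT D" for T using that by blast
    have "qs.subspace {w. l w = 0}"
      by (rule qs.subspaceI)
        (auto simp: l_def distrib_left sum.distrib mult.left_commute simp flip: sum_distrib_left)
    moreover have "polytabloid ` SYT D \<subseteq> {w. l w = 0}"
      using pairing[OF SYT_numbering fin] z by (auto simp: l_def)
    ultimately have "l u = 0" using u(1) qs.span_minimal[of "polytabloid ` SYT D"] unfolding specht_def by blast
    moreover have "l u > 0" unfolding l_def
    proof (rule sum_pos[OF fin])
      show "?S \<noteq> {}" using u(2) series_neq_0_iff by blast
      fix t assume "t \<in> ?S"
      then show "0 < coeff u t * coeff u t" by (simp add: zero_less_mult_iff linorder_neq_iff) linarith
    qed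
    ultimately show False by simp
  qed
  then show ?thesis using that by blast
qed

text \<open>Finitary permutations suffice for irreducibility.\<close>

lemma specht_minimal:
  assumes W: "qs.subspace W" "\<And>\<sigma> v. \<sigma> \<in> S_infty \<Longrightarrow> v \<in> W \<Longrightarrow> act \<sigma> v \<in> W"
    and sub: "W \<subseteq> specht" and nz: "u \<in> W" "u \<noteq> 0"
  shows "W = specht"
proof -
  obtain T where T: "T \<in> SYT D" "column_sum T u \<noteq> 0"
    using column_sum_nonzero[of u] sub nz by blast
  have num: "T \<in> numberings" using T(1) by (rule SYT_numbering)
  obtain c where c: "column_sum T u = qscale c (polytabloid T)"
    using column_sum_multiple[OF num] sub nz(1) specht_tabloid_space by blast
  then have c0: "c \<noteq> 0" using T(2) by auto
  have "column_sum T u \<in> W" unfolding column_sum_def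
    by (intro qs.subspace_sum qs.subspace_scale W nz) (rule col_group_S_infty[OF num])
  then have "qscale (1 / c) (qscale c (polytabloid T)) \<in> W" unfolding c by (rule qs.subspace_scale[OF W(1)])
  then have TW: "polytabloid T \<in> W" using c0 by simp
  have "polytabloid T' \<in> W" if T': "T' \<in> SYT D" for T'
  proof -
    obtain \<sigma> where "\<sigma> \<in> S_infty" "act \<sigma> (polytabloid T) = polytabloid T'"
      using numberings_transitive[OF num SYT_numbering[OF T']] .
    then show ?thesis using W(2) TW by metis
  qed
  then have "specht \<subseteq> W" unfolding specht_def by (intro qs.span_minimal W) auto
  then show ?thesis using sub by blast
qed

lemma specht_nonzero: "\<exists>T\<in>SYT D. polytabloid T \<noteq> 0"
proof (rule ccontr)
  assume "\<not> ?thesis"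
  then have "specht \<subseteq> {0}" unfolding specht_def by (intro qs.span_minimal) auto
  moreover obtain T where T: "T \<in> numberings" using numberings_nonempty by blast
  ultimately have "polytabloid T = 0" using polytabloid_specht by blast
  then show False using coeff_polytabloid_self[OF T] by simp
qed

end

section \<open>Distinct shapes\<close>

text \<open>An infinite Ferrers diagram is determined by the numbers of boxes in the rows from \<open>k\<close> on.\<close>

lemma diagram_eqI:
  assumes "diagram D" "diagram D'"
    and eq: "\<And>k. k \<ge> 1 \<Longrightarrow> card {b \<in> D. k \<le> fst b} = card {b \<in> D'. k \<le> fst b}"
  shows "D = D'"
proof -
  have row: "card (diagram_row E k) = card {b \<in> E. k \<le> fst b} - card {b \<in> E. Suc k \<le> fst b}"
    if E: "diagram E" and k: "k \<ge> 1" for E k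
  proof -
    have fin: "finite {b \<in> E. k \<le> fst b}"
      by (rule finite_subset[OF _ diagram.finite_finite_part[OF E]]) (use k in \<open>auto simp: finite_part_def\<close>)
    have eq: "diagram_row E k = {b \<in> E. k \<le> fst b} - {b \<in> E. Suc k \<le> fst b}"
      by (auto simp: diagram_row_def)
    have sub: "{b \<in> E. Suc k \<le> fst b} \<subseteq> {b \<in> E. k \<le> fst b}" by auto
    show ?thesis unfolding eq by (rule card_Diff_subset[OF finite_subset[OF sub fin] sub])
  qed
  have "(i, j) \<in> D \<longleftrightarrow> (i, j) \<in> D'" for i j
  proof (cases "i = 0")
    case True
    then show ?thesis using assms(1,2) by (simp add: diagram.first_row_infinite)
  next
    case False
    then have i: "i \<ge> 1" by simp
    have "card (diagram_row D i) = card (diagram_row D' i)"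
      using row[OF assms(1) i] row[OF assms(2) i] eq[OF i] eq[of "Suc i"] by simp
    then have "{j. (i, j) \<in> D} = {j. (i, j) \<in> D'}"
      using diagram.row_initial[OF assms(1) i] diagram.row_initial[OF assms(2) i] by simp
    then show ?thesis by blast
  qed
  then show ?thesis by auto
qed

text \<open>
  An injective homomorphism between Specht modules forces a dominance relation between the
  shapes: a column sum for \<open>D\<close> does not annihilate the image, so some tabloid of shape \<open>D'\<close> has
  the numbers of every column of a tableau of shape \<open>D\<close> in distinct rows.
\<close>

lemma specht_hom_dominance:
  assumes D: "diagram D" and D': "diagram D'"
    and add: "\<And>u v. u \<in> diagram.specht D \<Longrightarrow> v \<in> diagram.specht D \<Longrightarrow> \<phi> (u + v) = \<phi> u + \<phi> v"
    and scale: "\<And>c v. v \<in> diagram.specht D \<Longrightarrow> \<phi> (qscale c v) = qscale c (\<phi> v)"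
    and equi: "\<And>\<sigma> v. \<sigma> \<in> S_infty \<Longrightarrow> v \<in> diagram.specht D \<Longrightarrow> \<phi> (act \<sigma> v) = act \<sigma> (\<phi> v)"
    and inj: "inj_on \<phi> (diagram.specht D)"
    and into: "\<phi> ` diagram.specht D \<subseteq> diagram.specht D'"
    and k: "k \<ge> 1"
  shows "card {b \<in> D. k \<le> fst b} \<le> card {b \<in> D'. k \<le> fst b}"
proof -
  interpret d: diagram D by (rule D)
  interpret d': diagram D' by (rule D')
  have zero: "\<phi> 0 = 0" using scale[of 0 0] qs.subspace_0[OF d.subspace_specht] by simp
  obtain T where T: "T \<in> SYT D" "d.polytabloid T \<noteq> 0" using d.specht_nonzero by blast
  have num: "T \<in> d.numberings" using T(1) by (rule d.SYT_numbering)
  have pT: "d.polytabloid T \<in> d.specht" by (rule d.polytabloid_specht[OF num])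
  have sum: "\<phi> (\<Sum>i\<in>A. f i) = (\<Sum>i\<in>A. \<phi> (f i))" if "\<And>i. i \<in> A \<Longrightarrow> f i \<in> d.specht" for A :: "(nat \<Rightarrow> nat) set" and f
    using that
  proof (induction A rule: infinite_finite_induct)
    case (insert x A)
    then show ?case using add[of "f x" "\<Sum>i\<in>A. f i"] qs.subspace_sum[OF d.subspace_specht, of A f] by simp
  qed (simp_all add: zero)
  have comm: "\<phi> (d.column_sum T v) = d.column_sum T (\<phi> v)" if v: "v \<in> d.specht" for v
  proof -
    have S: "\<sigma> \<in> S_infty" "\<sigma> \<in> S_nat" if "\<sigma> \<in> col_group D T" for \<sigma>
      using d.col_group_S_infty[OF num that] d.col_group_S_nat[OF that] by auto
    have mem: "act \<sigma> v \<in> d.specht" if "\<sigma> \<in> col_group D T" for \<sigma>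
      using d.act_specht[OF S(2)[OF that] v] .
    have "\<phi> (d.column_sum T v) = (\<Sum>\<sigma>\<in>col_group D T. \<phi> (qscale (of_int (sign \<sigma>)) (act \<sigma> v)))"
      unfolding d.column_sum_def
      by (rule sum) (rule qs.subspace_scale[OF d.subspace_specht mem])
    also have "\<dots> = d.column_sum T (\<phi> v)"
      unfolding d.column_sum_def
      by (rule sum.cong) (use scale mem equi S v in auto)
    finally show ?thesis .
  qed
  let ?w = "\<phi> (d.polytabloid T)"
  have "d.column_sum T (d.polytabloid T) = qscale (of_nat (card (col_group D T))) (d.polytabloid T)"
    unfolding d.polytabloid_def by (rule d.column_sum_twice[OF num])
  moreover have "card (col_group D T) \<noteq> 0"
    using d.finite_col_group[OF num] d.col_group_id by (metis card_0_eq empty_iff)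
  ultimately have "d.column_sum T (d.polytabloid T) \<noteq> 0" using T(2) by simp
  moreover have "d.column_sum T (d.polytabloid T) \<in> d.specht"
    using calculation d.column_sum_twice[OF num] qs.subspace_scale[OF d.subspace_specht pT]
    by (metis d.polytabloid_def)
  ultimately have "\<phi> (d.column_sum T (d.polytabloid T)) \<noteq> 0"
    using inj zero qs.subspace_0[OF d.subspace_specht] by (metis inj_onD)
  then have nz: "d.column_sum T ?w \<noteq> 0" by (simp add: comm[OF pT])
  have w: "?w \<in> d'.tabloid_space" using into pT d'.specht_tabloid_space by blast
  then have fin: "finite {t. coeff ?w t \<noteq> 0}" and tab: "{t. coeff ?w t \<noteq> 0} \<subseteq> d'.tabloids"
    by (auto simp: d'.tabloid_space_def)
  have "\<exists>t. coeff ?w t \<noteq> 0 \<and> d.transversal T t"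
  proof (rule ccontr)
    assume "\<not> ?thesis"
    then have "d.column_sum T (mono_sum {t}) = 0" if "coeff ?w t \<noteq> 0" for t
      using d.column_sum_nontransversal[OF num] that by blast
    then have "d.column_sum T (\<Sum>t | coeff ?w t \<noteq> 0. qscale (coeff ?w t) (mono_sum {t})) = 0"
      by (simp add: qs2.linear_sum[OF d.linear_column_sum] qs2.linear_scale[OF d.linear_column_sum])
    then show False using nz d.tabloid_expansion[OF fin] by simp
  qed
  then obtain t where t: "t \<in> d'.tabloids" "d.transversal T t" using tab by blast
  have "expo t 0 = 0" using t(1) by (simp add: d'.tabloids_def)
  then have "card {b \<in> D. k \<le> fst b} \<le> card {n. k \<le> expo t n}"
    by (rule d.transversal_dominance[OF num _ t(2) k])
  also have "\<dots> = card {b \<in> D'. k \<le> fst b}" by (rule d'.card_rows_below[OF t(1) k])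
  finally show ?thesis .
qed

section \<open>The homomorphism of a semi-standard tableau\<close>

context diagram
begin

lemma rows_image:
  assumes T: "T \<in> numberings"
  shows "T ` diagram_row D i = {n. n \<ge> 1 \<and> expo (tabloid_of T) n = i}"
proof (intro set_eqI iffI)
  fix n assume "n \<in> T ` diagram_row D i"
  then obtain b where "b \<in> D" "fst b = i" "n = T b" by (auto simp: diagram_row_def)
  then show "n \<in> {n. n \<ge> 1 \<and> expo (tabloid_of T) n = i}"
    using numbering(2)[OF T] tabloid_of_box[OF T] by simp
next
  fix n assume n: "n \<in> {n. n \<ge> 1 \<and> expo (tabloid_of T) n = i}"
  then have "n \<ge> 1" "fst (box_of T n) = i" by (auto simp: expo_tabloid_of[OF T] split: if_splits)
  then have "box_of T n \<in> diagram_row D i" "n = T (box_of T n)"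
    using numbering(3,4)[OF T] by (simp_all add: diagram_row_def)
  then show "n \<in> T ` diagram_row D i" by blast
qed

lemma row_group_iff:
  assumes T: "T \<in> numberings"
  shows "\<sigma> \<in> row_group D T \<longleftrightarrow> \<sigma> \<in> S_nat \<and> perm_mono \<sigma> (tabloid_of T) = tabloid_of T"
proof (cases "\<sigma> \<in> S_nat")
  case False
  then show ?thesis by (simp add: row_group_def)
next
  case S: True
  let ?t = "tabloid_of T"
  note s = S_natD[OF S] and s' = S_natD[OF S_natD(4)[OF S]]
  have "(\<forall>i. \<sigma> ` T ` diagram_row D i = T ` diagram_row D i) \<longleftrightarrow> perm_mono \<sigma> ?t = ?t"
  proof
    assume *: "\<forall>i. \<sigma> ` T ` diagram_row D i = T ` diagram_row D i"
    show "perm_mono \<sigma> ?t = ?t"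
    proof (rule poly_mapping_eqI)
      fix n
      show "expo (perm_mono \<sigma> ?t) n = expo ?t n"
      proof (cases "n = 0")
        case True
        then show ?thesis using s'(2) s(1) by (simp add: expo_perm_mono)
      next
        case False
        then have "inv \<sigma> n \<ge> 1" using s'(3)[of n] by simp
        then have "inv \<sigma> n \<in> T ` diagram_row D (expo ?t (inv \<sigma> n))" by (simp add: rows_image[OF T])
        then have "\<sigma> (inv \<sigma> n) \<in> T ` diagram_row D (expo ?t (inv \<sigma> n))" using * by blast
        then show ?thesis using s(1,5) by (simp add: rows_image[OF T] expo_perm_mono)
      qed
    qed
  next
    assume eq: "perm_mono \<sigma> ?t = ?t"
    have e: "expo ?t (\<sigma> n) = expo ?t n" for n
      using arg_cong[OF eq, of "\<lambda>m. expo m (\<sigma> n)"] s(1,6) by (simp add: expo_perm_mono)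
    show "\<forall>i. \<sigma> ` T ` diagram_row D i = T ` diagram_row D i"
    proof (intro allI set_eqI iffI)
      fix i n assume "n \<in> \<sigma> ` T ` diagram_row D i"
      then show "n \<in> T ` diagram_row D i" using s(3) e by (auto simp: rows_image[OF T] simp del: One_nat_def)
    next
      fix i n assume "n \<in> T ` diagram_row D i"
      then have "inv \<sigma> n \<in> T ` diagram_row D i"
        using s'(3)[of n] e[of "inv \<sigma> n"] s(5)[of n] by (simp add: rows_image[OF T])
      then show "n \<in> \<sigma> ` T ` diagram_row D i" using s(5)[of n] by (metis image_eqI)
    qed
  qed
  then show ?thesis using S by (simp add: row_group_def)
qed

text \<open>The number of entries \<open>h\<close> in row \<open>i\<close>, not counting the zeros of row \<open>0\<close>.\<close>

definition row_count :: "infinite_ssyt \<Rightarrow> nat \<Rightarrow> nat \<Rightarrow> nat"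
  where "row_count M i h = (if i = 0 then count (at_infinity M) h
    else card {b \<in> finite_part D. fst b = i \<and> entries M b = h})"

text \<open>
  The exponents of \<open>q\<close> at the numbers of row \<open>i\<close> of the tabloid \<open>t\<close> are the entries of row \<open>i\<close>
  of \<open>M\<close>, up to order.
\<close>

definition compatible :: "infinite_ssyt \<Rightarrow> mono \<Rightarrow> mono \<Rightarrow> bool"
  where "compatible M t q \<longleftrightarrow> expo q 0 = 0 \<and>
    (\<forall>i h. (i, h) \<noteq> (0, 0) \<longrightarrow>
      card {n\<in>{1..}. (expo t n, expo q n) = (i, h)} = row_count M i h)"

lemma compatible_perm:
  assumes S: "\<sigma> \<in> S_nat" and c: "compatible M t q"
  shows "compatible M (perm_mono \<sigma> t) (perm_mono \<sigma> q)"
proof -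
  note s = S_natD[OF S] and s' = S_natD[OF S_natD(4)[OF S]]
  have "{n\<in>{1..}. (expo (perm_mono \<sigma> t) n, expo (perm_mono \<sigma> q) n) = c}
      = \<sigma> ` {n\<in>{1..}. (expo t n, expo q n) = c}" for c
  proof (intro set_eqI iffI)
    fix n assume "n \<in> {n\<in>{1..}. (expo (perm_mono \<sigma> t) n, expo (perm_mono \<sigma> q) n) = c}"
    then have "inv \<sigma> n \<in> {n\<in>{1..}. (expo t n, expo q n) = c}"
      using s(1) s'(3)[of n] by (simp add: expo_perm_mono)
    then show "n \<in> \<sigma> ` {n\<in>{1..}. (expo t n, expo q n) = c}" using s(5)[of n] by (metis image_eqI)
  next
    fix n assume "n \<in> \<sigma> ` {n\<in>{1..}. (expo t n, expo q n) = c}"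
    then obtain k where "k \<ge> 1" "(expo t k, expo q k) = c" "n = \<sigma> k" by auto
    then show "n \<in> {n\<in>{1..}. (expo (perm_mono \<sigma> t) n, expo (perm_mono \<sigma> q) n) = c}"
      using s(1,6) s(3)[of k] by (simp add: expo_perm_mono)
  qed
  moreover have "card (\<sigma> ` A) = card A" for A
    by (rule card_image) (rule inj_on_subset[OF bij_is_inj[OF s(1)] subset_UNIV])
  moreover have "expo (perm_mono \<sigma> q) 0 = 0"
    using c s(1) s'(2) by (simp add: compatible_def expo_perm_mono)
  ultimately show ?thesis using c by (simp only: compatible_def) simp
qed

lemma compatible_perm_iff:
  assumes S: "\<sigma> \<in> S_nat"
  shows "compatible M (perm_mono \<sigma> t) q \<longleftrightarrow> compatible M t (perm_mono (inv \<sigma>) q)"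
  using compatible_perm[OF S, of M t "perm_mono (inv \<sigma>) q"]
    compatible_perm[OF S_natD(4)[OF S], of M "perm_mono \<sigma> t" q] S_natD(1)[OF S] by auto

text \<open>
  The monomials compatible with a tabloid form an orbit of its stabilizer, even of the finitary
  part of the latter.
\<close>

lemma compatible_transitive:
  assumes t0: "expo t 0 = 0" and p: "compatible M t p" and q: "compatible M t q"
  obtains \<sigma> where "\<sigma> \<in> S_infty" "perm_mono \<sigma> t = t" "perm_mono \<sigma> p = q"
proof -
  have fin: "finite {n\<in>{1..}. (expo t n, expo m n) \<noteq> (0, 0)}" for m :: mono
    by (rule finite_subset[of _ "Poly_Mapping.keys t \<union> Poly_Mapping.keys m"]) (auto simp: in_keys_iff)
  have cd: "card {n\<in>{1..}. (expo t n, expo p n) = c} = card {n\<in>{1..}. (expo t n, expo q n) = c}"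
    if "c \<noteq> (0, 0)" for c
  proof (cases c)
    case (Pair i h)
    then have "card {n\<in>{1..}. (expo t n, expo m n) = c} = row_count M i h" if "compatible M t m" for m
      using that \<open>c \<noteq> (0, 0)\<close> unfolding compatible_def by blast
    then show ?thesis using p q by simp
  qed
  obtain \<sigma> where \<sigma>: "\<sigma> \<in> S_infty"
    "\<And>n. n \<ge> 1 \<Longrightarrow> (expo t (\<sigma> n), expo q (\<sigma> n)) = (expo t n, expo p n)"
    by (rule finitary_permutation_exists[of "\<lambda>n. (expo t n, expo p n)" "(0, 0)"
        "\<lambda>n. (expo t n, expo q n)", OF fin fin]) (erule cd, erule that)
  have S: "\<sigma> \<in> S_nat" using \<sigma>(1) S_infty_subset by blast
  note s = S_natD[OF S] and s' = S_natD[OF S_natD(4)[OF S]]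
  have p0: "expo p 0 = 0" and q0: "expo q 0 = 0" using p q by (simp_all add: compatible_def)
  have e: "expo t (inv \<sigma> n) = expo t n \<and> expo p (inv \<sigma> n) = expo q n" for n
  proof (cases "n = 0")
    case True
    then show ?thesis using t0 p0 q0 s'(2) by simp
  next
    case False
    then have "inv \<sigma> n \<ge> 1" using s'(3)[of n] by simp
    then show ?thesis using \<sigma>(2)[of "inv \<sigma> n"] s(5)[of n] by simp
  qed
  have "perm_mono \<sigma> t = t" "perm_mono \<sigma> p = q"
    using e s(1) by (auto intro!: poly_mapping_eqI simp: expo_perm_mono)
  then show ?thesis using that \<sigma>(1) by blast
qed

lemma admissible_compatible:
  assumes T: "T \<in> numberings" and a: "admissible_mono D M T p"
  shows "compatible M (tabloid_of T) p"
proof -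
  let ?t = "tabloid_of T"
  have "card {n\<in>{1..}. (expo ?t n, expo p n) = (i, h)} = row_count M i h" if ih: "(i, h) \<noteq> (0, 0)" for i h
  proof (cases "i = 0")
    case True
    then have "{n\<in>{1..}. (expo ?t n, expo p n) = (i, h)} = {n \<in> T ` diagram_row D 0. expo p n = h}"
      by (auto simp: rows_image[OF T])
    then show ?thesis using a ih True by (simp add: admissible_mono_def row_count_def)
  next
    case False
    have ent: "expo p (T b) = entries M b" if "b \<in> finite_part D" for b
      using a that by (simp add: admissible_mono_def)
    have "{n\<in>{1..}. (expo ?t n, expo p n) = (i, h)} = T ` {b \<in> finite_part D. fst b = i \<and> entries M b = h}"
    proof (intro set_eqI iffI)
      fix n assume n: "n \<in> {n\<in>{1..}. (expo ?t n, expo p n) = (i, h)}"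
      let ?b = "box_of T n"
      have "?b \<in> D" "T ?b = n" "fst ?b = i"
        using n numbering(3,4)[OF T, of n] by (auto simp: expo_tabloid_of[OF T] split: if_splits)
      moreover from this have "?b \<in> finite_part D" using False by (simp add: finite_part_def)
      ultimately have "?b \<in> {b \<in> finite_part D. fst b = i \<and> entries M b = h}" "n = T ?b"
        using n ent[of ?b] by auto
      then show "n \<in> T ` {b \<in> finite_part D. fst b = i \<and> entries M b = h}" by blast
    next
      fix n assume "n \<in> T ` {b \<in> finite_part D. fst b = i \<and> entries M b = h}"
      then obtain b where b: "b \<in> finite_part D" "fst b = i" "entries M b = h" "n = T b" by blast
      then have "b \<in> D" by (simp add: finite_part_def)
      then show "n \<in> {n\<in>{1..}. (expo ?t n, expo p n) = (i, h)}"
        using b ent numbering(2)[OF T] tabloid_of_box[OF T] by simp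
    qed
    moreover have "inj_on T {b \<in> finite_part D. fst b = i \<and> entries M b = h}"
      using numbering(5)[OF T] by (auto simp: inj_on_def finite_part_def)
    ultimately show ?thesis using False by (simp add: row_count_def card_image)
  qed
  then show ?thesis using a by (simp add: compatible_def admissible_mono_def)
qed

lemma row_orbit_compatible:
  assumes T: "T \<in> SYT D" and M: "M \<in> SSYT D"
  shows "row_orbit D M T = {q. compatible M (tabloid_of T) q}"
proof -
  have num: "T \<in> numberings" using T by (rule SYT_numbering)
  let ?t = "tabloid_of T" and ?p = "p_mono D M T"
  have t0: "expo ?t 0 = 0" by (simp add: expo_tabloid_of[OF num])
  have "admissible_mono D M T ?p"
    unfolding p_mono_def using admissible_mono_exists[OF ferrers M T] by (rule someI_ex)
  then have p: "compatible M ?t ?p" by (rule admissible_compatible[OF num])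
  show ?thesis
  proof (intro set_eqI iffI)
    fix q assume "q \<in> row_orbit D M T"
    then obtain \<sigma> where "\<sigma> \<in> row_group D T" "q = perm_mono \<sigma> ?p" by (auto simp: row_orbit_def)
    then show "q \<in> {q. compatible M ?t q}"
      using compatible_perm[OF _ p, of \<sigma>] by (simp add: row_group_iff[OF num])
  next
    fix q assume "q \<in> {q. compatible M ?t q}"
    then obtain \<sigma> where "\<sigma> \<in> S_infty" "perm_mono \<sigma> ?t = ?t" "perm_mono \<sigma> ?p = q"
      using compatible_transitive[OF t0 p] by blast
    then show "q \<in> row_orbit D M T"
      using S_infty_subset by (auto simp: row_orbit_def row_group_iff[OF num])
  qed
qed

text \<open>
  The linear map that sends a tabloid to the sum of the monomials compatible with it.  Since,
  for semi-standard \<open>M\<close>, only finitely many tabloids are compatible with a given monomial, it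
  makes sense on all series.
\<close>

definition tableau_hom :: "infinite_ssyt \<Rightarrow> series \<Rightarrow> series"
  where "tableau_hom M v = Series (\<lambda>q. \<Sum>t | t \<in> tabloids \<and> compatible M t q. coeff v t)"

lemma linear_tableau_hom: "Vector_Spaces.linear qscale qscale (tableau_hom M)"
  unfolding linear_qscale tableau_hom_def
  by (auto intro!: series_eqI simp: sum.distrib sum_distrib_left)

lemma tableau_hom_act:
  assumes S: "\<sigma> \<in> S_nat"
  shows "tableau_hom M (act \<sigma> v) = act \<sigma> (tableau_hom M v)"
proof (rule series_eqI)
  fix q
  note s = S_natD[OF S]
  have "(\<Sum>t | t \<in> tabloids \<and> compatible M t q. coeff v (perm_mono (inv \<sigma>) t))
      = (\<Sum>t | t \<in> tabloids \<and> compatible M t (perm_mono (inv \<sigma>) q). coeff v t)"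
    by (rule sum.reindex_bij_witness[where i = "perm_mono \<sigma>" and j = "perm_mono (inv \<sigma>)"])
      (use s S compatible_perm[OF s(4)] in
        \<open>auto simp: tabloids_perm compatible_perm_iff\<close>)
  then show "coeff (tableau_hom M (act \<sigma> v)) q = coeff (act \<sigma> (tableau_hom M v)) q"
    by (simp add: tableau_hom_def)
qed

lemma finite_compatible:
  assumes M: "M \<in> SSYT D"
  shows "finite {t. t \<in> tabloids \<and> compatible M t q}"
proof -
  obtain N where N: "Poly_Mapping.keys q \<subseteq> {..N}"
    using finite_nat_iff_bounded_le[of "Poly_Mapping.keys q"] by auto
  define B where "B = Max (insert 0 (fst ` finite_part D))"
  have "{t. t \<in> tabloids \<and> compatible M t q}
      \<subseteq> (\<Union>d\<le>Suc N * B. {t. Poly_Mapping.keys t \<subseteq> {..N} \<and> mdeg t = d})"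
  proof clarify
    fix t assume t: "t \<in> tabloids" and c: "compatible M t q"
    have k: "n \<le> N \<and> expo t n \<le> B" if n: "expo t n \<noteq> 0" for n
    proof
      let ?i = "expo t n"
      have n1: "n \<ge> 1" using t n by (cases n) (auto simp: tabloids_def)
      have fin: "finite {n. expo t n = ?i}"
        by (rule finite_subset[of _ "Poly_Mapping.keys t"]) (use n in \<open>auto simp: in_keys_iff\<close>)
      have "{b \<in> finite_part D. fst b = ?i \<and> entries M b = 0} = {}"
        using M by (auto simp: SSYT_def)
      then have "row_count M ?i 0 = 0" using n by (simp only: row_count_def if_False card.empty)
      then have "card {n'\<in>{1..}. (expo t n', expo q n') = (?i, 0)} = 0"
        using c n by (simp add: compatible_def)
      moreover have "finite {n'\<in>{1..}. (expo t n', expo q n') = (?i, 0)}"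
        using fin by (rule rev_finite_subset) auto
      ultimately have "{n'\<in>{1..}. (expo t n', expo q n') = (?i, 0)} = {}" by (simp only: card_0_eq)
      then have "expo q n \<noteq> 0" using n1 by auto
      then have "n \<in> Poly_Mapping.keys q" by (simp only: in_keys_iff not_False_eq_True)
      then show "n \<le> N" using N by blast
      have "card {n. expo t n = ?i} = card (diagram_row D ?i)" using t n by (simp add: tabloids_def)
      moreover have "card {n. expo t n = ?i} > 0" using fin by (auto simp: card_gt_0_iff)
      ultimately have "diagram_row D ?i \<noteq> {}" by (metis card.empty less_irrefl)
      then have "?i \<in> fst ` finite_part D" using n by (force simp: diagram_row_def finite_part_def)
      then show "?i \<le> B" unfolding B_def using finite_finite_part by (intro Max_ge) auto
    qed
    then have keys: "Poly_Mapping.keys t \<subseteq> {..N}" by (auto simp: in_keys_iff)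
    have "expo t n \<le> B" for n using k[of n] by (cases "expo t n = 0") auto
    then have "mdeg t \<le> Suc N * B"
      using mdeg_eq[OF _ keys] sum_bounded_above[of "{..N}" "expo t" B] by simp
    then show "t \<in> (\<Union>d\<le>Suc N * B. {t. Poly_Mapping.keys t \<subseteq> {..N} \<and> mdeg t = d})"
      using keys by auto
  qed
  then show ?thesis by (rule finite_subset) (intro finite_UN_I finite_atMost finite_bounded_monos)
qed

lemma tableau_hom_tabloid:
  assumes M: "M \<in> SSYT D" and t: "t \<in> tabloids"
  shows "tableau_hom M (mono_sum {t}) = mono_sum {q. compatible M t q}"
proof (rule series_eqI)
  fix q
  have "(\<Sum>t' | t' \<in> tabloids \<and> compatible M t' q. coeff (mono_sum {t}) t')
      = (\<Sum>t' | t' \<in> tabloids \<and> compatible M t' q. if t' = t then 1 else 0)"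
    by (rule sum.cong) auto
  also have "\<dots> = (if compatible M t q then 1 else 0)"
    using finite_compatible[OF M, of q] t by simp
  finally show "coeff (tableau_hom M (mono_sum {t})) q = coeff (mono_sum {q. compatible M t q}) q"
    by (simp add: tableau_hom_def)
qed

lemma F_series_column_sum: "F_series D M T = column_sum T (mono_sum (row_orbit D M T))"
  by (simp add: F_series_def column_sum_def of_int_sign_mult)

lemma tableau_hom_column_sum: "tableau_hom M (column_sum T v) = column_sum T (tableau_hom M v)"
  unfolding column_sum_def qs2.linear_sum[OF linear_tableau_hom] qs2.linear_scale[OF linear_tableau_hom]
  by (rule sum.cong) (simp_all add: tableau_hom_act col_group_S_nat)

lemma tableau_hom_polytabloid:
  assumes M: "M \<in> SSYT D" and T: "T \<in> SYT D"
  shows "tableau_hom M (polytabloid T) = F_series D M T"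
proof -
  have num: "T \<in> numberings" using T by (rule SYT_numbering)
  show ?thesis
    unfolding polytabloid_def tableau_hom_column_sum F_series_column_sum row_orbit_compatible[OF T M]
    by (simp only: tableau_hom_tabloid[OF M tabloid_of_tabloids[OF num]])
qed

text \<open>
  Moving the entries at infinity beyond the finite columns makes the exponents strictly
  increasing along every column.
\<close>

lemma column_strict_mono_exists:
  assumes M: "M \<in> SSYT D" and T: "T \<in> SYT D"
  obtains q where "compatible M (tabloid_of T) q"
    "\<And>i i' j. i < i' \<Longrightarrow> (i', j) \<in> D \<Longrightarrow> expo q (T (i, j)) < expo q (T (i', j))"
proof -
  have num: "T \<in> numberings" using T by (rule SYT_numbering)
  define xs where "xs = sorted_list_of_multiset (at_infinity M)"
  have mxs: "mset xs = at_infinity M" by (simp add: xs_def)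
  define c where "c b = (if fst b = 0
    then if width \<le> snd b \<and> snd b < width + length xs then xs ! (snd b - width) else 0
    else entries M b)" for b :: box
  define q where "q = Abs_poly_mapping (\<lambda>n. if n = 0 then 0 else c (box_of T n))"
  have "{n. (if n = 0 then 0 else c (box_of T n)) \<noteq> 0}
      \<subseteq> T ` (finite_part D \<union> {0} \<times> {..<width + length xs})"
  proof
    fix n assume n: "n \<in> {n. (if n = 0 then 0 else c (box_of T n)) \<noteq> 0}"
    then have n1: "n \<ge> 1" "c (box_of T n) \<noteq> 0" by (auto split: if_splits)
    obtain i j where b: "box_of T n = (i, j)" by fastforce
    have "(i, j) \<in> finite_part D \<union> {0} \<times> {..<width + length xs}"
      using n1(2) b numbering(4)[OF num n1(1)] by (auto simp: c_def finite_part_def split: if_splits)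
    then show "n \<in> T ` (finite_part D \<union> {0} \<times> {..<width + length xs})"
      using numbering(3)[OF num n1(1)] b by (metis image_eqI)
  qed
  then have "finite {n. (if n = 0 then 0 else c (box_of T n)) \<noteq> 0}"
    by (rule finite_subset) (use finite_finite_part in auto)
  then have q: "expo q n = (if n = 0 then 0 else c (box_of T n))" for n by (simp add: q_def)
  have qT: "expo q (T b) = c b" if "b \<in> D" for b
    using numbering(1,2)[OF num that] by (simp add: q)
  have "card {n \<in> T ` diagram_row D 0. expo q n = h} = count (at_infinity M) h" if h: "h > 0" for h
  proof -
    let ?J = "{j. j < length xs \<and> xs ! j = h}"
    have "{n \<in> T ` diagram_row D 0. expo q n = h} = (\<lambda>j. T (0, width + j)) ` ?J"
    proof (intro set_eqI iffI)
      fix n assume "n \<in> {n \<in> T ` diagram_row D 0. expo q n = h}"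
      then obtain j where j: "(0, j) \<in> D" "n = T (0, j)" "c (0, j) = h"
        using qT by (auto simp: diagram_row_def)
      then have "width \<le> j" "j - width \<in> ?J" using h by (auto simp: c_def split: if_splits)
      then have "n = T (0, width + (j - width))" using j(2) by simp
      then show "n \<in> (\<lambda>j. T (0, width + j)) ` ?J" using \<open>j - width \<in> ?J\<close> by blast
    next
      fix n assume "n \<in> (\<lambda>j. T (0, width + j)) ` ?J"
      then show "n \<in> {n \<in> T ` diagram_row D 0. expo q n = h}"
        using first_row_infinite by (auto simp: qT c_def diagram_row_def)
    qed
    moreover have "inj_on (\<lambda>j. T (0, width + j)) ?J"
      using numbering(5)[OF num first_row_infinite first_row_infinite] by (simp add: inj_on_def)
    ultimately have "card {n \<in> T ` diagram_row D 0. expo q n = h} = card ?J" by (simp add: card_image)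
    also have "\<dots> = length (filter (\<lambda>x. x = h) xs)" by (simp add: length_filter_conv_card)
    also have "\<dots> = count (mset xs) h" by (induction xs) simp_all
    finally show ?thesis by (simp add: mxs)
  qed
  moreover have "expo q (T b) = entries M b" if "b \<in> finite_part D" for b
    using that qT[of b] by (simp add: finite_part_def c_def)
  ultimately have "admissible_mono D M T q" by (simp add: admissible_mono_def q)
  moreover have "expo q (T (i, j)) < expo q (T (i', j))" if "i < i'" "(i', j) \<in> D" for i i' j
  proof -
    have D: "(i, j) \<in> D" using that diagram_down_closed by (meson less_imp_le order_refl)
    have f': "(i', j) \<in> finite_part D" using that by (simp add: finite_part_def)
    have w: "j < width" using below_width[OF that(2)] that(1) by simp
    have "c (i, j) < c (i', j)"
    proof (cases "i = 0")
      case True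
      then show ?thesis using M f' w that(1) by (auto simp: c_def SSYT_def)
    next
      case False
      then have "(i, j) \<in> finite_part D" using D by (simp add: finite_part_def)
      then show ?thesis using M f' that(1) False by (simp add: c_def SSYT_def)
    qed
    then show ?thesis by (simp add: qT D that(2))
  qed
  ultimately show ?thesis using that admissible_compatible[OF num] by blast
qed

text \<open>The statistic depends on the row sums of the exponents only.\<close>

lemma compatible_statistic:
  assumes T: "T \<in> numberings" and p: "compatible M (tabloid_of T) p" and q: "compatible M (tabloid_of T) q"
  shows "(\<Sum>b\<in>finite_part D. fst b * expo p (T b)) = (\<Sum>b\<in>finite_part D. fst b * expo q (T b))"
proof -
  let ?t = "tabloid_of T"
  have t0: "expo ?t 0 = 0" by (simp add: expo_tabloid_of[OF T])
  obtain \<sigma> where \<sigma>: "\<sigma> \<in> S_infty" "perm_mono \<sigma> ?t = ?t" "perm_mono \<sigma> p = q"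
    using compatible_transitive[OF t0 p q] .
  have S: "\<sigma> \<in> S_nat" using \<sigma>(1) S_infty_subset by blast
  note s = S_natD[OF S]
  have e: "expo ?t (\<sigma> n) = expo ?t n" "expo q (\<sigma> n) = expo p n" for n
    using arg_cong[OF \<sigma>(2), of "\<lambda>m. expo m (\<sigma> n)"] arg_cong[OF \<sigma>(3), of "\<lambda>m. expo m (\<sigma> n)"] s(1,6)
    by (simp_all add: expo_perm_mono)
  have keys: "Poly_Mapping.keys ?t = T ` finite_part D"
  proof (intro set_eqI iffI)
    fix n assume "n \<in> Poly_Mapping.keys ?t"
    then have n: "n \<ge> 1" "0 < fst (box_of T n)"
      by (auto simp: in_keys_iff expo_tabloid_of[OF T] split: if_splits)
    then have "box_of T n \<in> finite_part D" using numbering(4)[OF T] by (simp add: finite_part_def)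
    then show "n \<in> T ` finite_part D" using numbering(3)[OF T n(1)] by (metis image_eqI)
  next
    fix n assume "n \<in> T ` finite_part D"
    then show "n \<in> Poly_Mapping.keys ?t"
      using tabloid_of_box[OF T] by (auto simp: in_keys_iff finite_part_def)
  qed
  have stat: "(\<Sum>b\<in>finite_part D. fst b * expo m (T b)) = (\<Sum>n\<in>Poly_Mapping.keys ?t. expo ?t n * expo m n)" for m
  proof -
    have "inj_on T (finite_part D)" using numbering(5)[OF T] by (auto simp: inj_on_def finite_part_def)
    then show ?thesis unfolding keys
      by (simp add: sum.reindex) (rule sum.cong, use T in \<open>auto simp: finite_part_def\<close>)
  qed
  show ?thesis unfolding stat
  proof (rule sum.reindex_bij_witness[where i = "inv \<sigma>" and j = \<sigma>])
    fix n assume "n \<in> Poly_Mapping.keys ?t"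
    then show "\<sigma> n \<in> Poly_Mapping.keys ?t" "inv \<sigma> n \<in> Poly_Mapping.keys ?t"
      using e(1)[of n] e(1)[of "inv \<sigma> n"] s(5) by (simp_all add: in_keys_iff)
    show "inv \<sigma> (\<sigma> n) = n" "\<sigma> (inv \<sigma> n) = n" "expo ?t (\<sigma> n) * expo q (\<sigma> n) = expo ?t n * expo p n"
      using s e by simp_all
  qed
qed

text \<open>
  The coefficient at a compatible monomial that strictly increases along the columns is one: by
  the rearrangement inequality a non-trivial column permutation changes the statistic, so the
  rearranged monomial is no longer compatible.
\<close>

lemma F_series_nonzero:
  assumes M: "M \<in> SSYT D" and T: "T \<in> SYT D"
  shows "F_series D M T \<noteq> 0"
proof -
  have num: "T \<in> numberings" using T by (rule SYT_numbering)
  obtain q where q: "compatible M (tabloid_of T) q"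
    and inc: "\<And>i i' j. i < i' \<Longrightarrow> (i', j) \<in> D \<Longrightarrow> expo q (T (i, j)) < expo q (T (i', j))"
    using column_strict_mono_exists[OF M T] by blast
  have "compatible M (tabloid_of T) (perm_mono (inv \<sigma>) q) \<longleftrightarrow> \<sigma> = id" if \<sigma>: "\<sigma> \<in> col_group D T" for \<sigma>
  proof
    assume "compatible M (tabloid_of T) (perm_mono (inv \<sigma>) q)"
    then have "(\<Sum>b\<in>finite_part D. fst b * expo (perm_mono (inv \<sigma>) q) (T b))
        = (\<Sum>b\<in>finite_part D. fst b * expo q (T b))"
      by (rule compatible_statistic[OF num _ q])
    moreover have "expo (perm_mono (inv \<sigma>) q) n = expo q (\<sigma> n)" for n
      using S_natD(1)[OF col_group_S_nat[OF \<sigma>]] by (simp add: expo_perm_mono bij_imp_bij_inv inv_inv_eq)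
    ultimately have eq: "(\<Sum>b\<in>finite_part D. fst b * expo q (\<sigma> (T b)))
        = (\<Sum>b\<in>finite_part D. fst b * expo q (T b))" by simp
    show "\<sigma> = id"
    proof (rule ccontr)
      assume "\<sigma> \<noteq> id"
      then have "(\<Sum>b\<in>finite_part D. fst b * expo q (\<sigma> (T b)))
          < (\<Sum>b\<in>finite_part D. fst b * expo q (T b))"
        by (intro rearrangement[where f = "expo q", OF num _ \<sigma>]) (rule inc)
      then show False using eq by simp
    qed
  qed (use q in simp)
  then have "coeff (F_series D M T) q = (\<Sum>\<sigma>\<in>col_group D T. if \<sigma> = id then 1 else 0)"
    unfolding F_series_column_sum coeff_column_sum row_orbit_compatible[OF T M]
    by (intro sum.cong) auto
  also have "\<dots> = 1" using finite_col_group[OF num] by simp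
  finally show ?thesis by (metis coeff_simps(1) zero_neq_one)
qed

end

section \<open>Equivariant embeddings\<close>

lemma is_representation_iff:
  assumes "G \<subseteq> S_nat"
  shows "is_representation G V \<longleftrightarrow> qs.subspace V \<and> (\<forall>\<sigma>\<in>G. \<forall>v\<in>V. act \<sigma> v \<in> V)"
  using assms S_natD(1) by (auto simp: is_representation_def act_add act_scale act_comp subset_iff)

lemma isomorphic_repsI:
  assumes "bij_betw \<phi> V W"
    "\<And>u v. u \<in> V \<Longrightarrow> v \<in> V \<Longrightarrow> \<phi> (u + v) = \<phi> u + \<phi> v"
    "\<And>c v. v \<in> V \<Longrightarrow> \<phi> (qscale c v) = qscale c (\<phi> v)"
    "\<And>\<sigma> v. \<sigma> \<in> G \<Longrightarrow> v \<in> V \<Longrightarrow> \<phi> (act \<sigma> v) = act \<sigma> (\<phi> v)"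
  shows "isomorphic_reps G V W"
  unfolding isomorphic_reps_def by (rule exI[of _ \<phi>]) (simp add: assms)

lemma isomorphic_repsE:
  assumes "isomorphic_reps G V W"
  obtains \<phi> where "bij_betw \<phi> V W"
    "\<And>u v. u \<in> V \<Longrightarrow> v \<in> V \<Longrightarrow> \<phi> (u + v) = \<phi> u + \<phi> v"
    "\<And>c v. v \<in> V \<Longrightarrow> \<phi> (qscale c v) = qscale c (\<phi> v)"
    "\<And>\<sigma> v. \<sigma> \<in> G \<Longrightarrow> v \<in> V \<Longrightarrow> \<phi> (act \<sigma> v) = act \<sigma> (\<phi> v)"
proof -
  from assms obtain \<phi> where "bij_betw \<phi> V W \<and>
      (\<forall>u\<in>V. \<forall>v\<in>V. \<phi> (u + v) = \<phi> u + \<phi> v) \<and>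
      (\<forall>c. \<forall>v\<in>V. \<phi> (qscale c v) = qscale c (\<phi> v)) \<and>
      (\<forall>\<sigma>\<in>G. \<forall>v\<in>V. \<phi> (act \<sigma> v) = act \<sigma> (\<phi> v))"
    unfolding isomorphic_reps_def by (rule exE)
  then show ?thesis by (intro that[of \<phi>]) simp_all
qed

lemma isomorphic_reps_sym:
  assumes V: "is_representation G V" and iso: "isomorphic_reps G V W"
  shows "isomorphic_reps G W V"
  using iso
proof (rule isomorphic_repsE)
  fix \<phi> assume b: "bij_betw \<phi> V W"
    and add: "\<And>u v. u \<in> V \<Longrightarrow> v \<in> V \<Longrightarrow> \<phi> (u + v) = \<phi> u + \<phi> v"
    and sc: "\<And>c v. v \<in> V \<Longrightarrow> \<phi> (qscale c v) = qscale c (\<phi> v)"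
    and eq: "\<And>\<sigma> v. \<sigma> \<in> G \<Longrightarrow> v \<in> V \<Longrightarrow> \<phi> (act \<sigma> v) = act \<sigma> (\<phi> v)"
  let ?\<psi> = "inv_into V \<phi>"
  have sV: "qs.subspace V" and aV: "\<And>\<sigma> v. \<sigma> \<in> G \<Longrightarrow> v \<in> V \<Longrightarrow> act \<sigma> v \<in> V"
    using V by (auto simp: is_representation_def)
  have m: "?\<psi> w \<in> V" "\<phi> (?\<psi> w) = w" if "w \<in> W" for w
    using b that by (auto simp: bij_betw_def f_inv_into_f inv_into_into)
  have u: "?\<psi> w = v" if "v \<in> V" "\<phi> v = w" for v w
    using b that by (auto simp: bij_betw_def)
  show ?thesis
  proof (rule isomorphic_repsI)
    show "bij_betw ?\<psi> W V" by (rule bij_betw_inv_into[OF b])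
    fix x y assume "x \<in> W" "y \<in> W"
    then show "?\<psi> (x + y) = ?\<psi> x + ?\<psi> y"
      using m add by (intro u qs.subspace_add[OF sV]) auto
  next
    fix c x assume "x \<in> W"
    then show "?\<psi> (qscale c x) = qscale c (?\<psi> x)"
      using m sc by (intro u qs.subspace_scale[OF sV]) auto
  next
    fix \<sigma> x assume "\<sigma> \<in> G" "x \<in> W"
    then show "?\<psi> (act \<sigma> x) = act \<sigma> (?\<psi> x)"
      using m eq by (intro u aV) auto
  qed
qed

lemma isomorphic_reps_trans:
  assumes UV: "isomorphic_reps G U V" and VW: "isomorphic_reps G V W"
  shows "isomorphic_reps G U W"
  using UV
proof (rule isomorphic_repsE)
  fix \<phi> assume b: "bij_betw \<phi> U V" and
    \<phi>: "\<And>u v. u \<in> U \<Longrightarrow> v \<in> U \<Longrightarrow> \<phi> (u + v) = \<phi> u + \<phi> v"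
    "\<And>c v. v \<in> U \<Longrightarrow> \<phi> (qscale c v) = qscale c (\<phi> v)"
    "\<And>\<sigma> v. \<sigma> \<in> G \<Longrightarrow> v \<in> U \<Longrightarrow> \<phi> (act \<sigma> v) = act \<sigma> (\<phi> v)"
  have m: "\<phi> v \<in> V" if "v \<in> U" for v using bij_betwE[OF b] that by blast
  from VW show ?thesis
  proof (rule isomorphic_repsE)
    fix \<psi> assume b': "bij_betw \<psi> V W" and
      \<psi>: "\<And>u v. u \<in> V \<Longrightarrow> v \<in> V \<Longrightarrow> \<psi> (u + v) = \<psi> u + \<psi> v"
      "\<And>c v. v \<in> V \<Longrightarrow> \<psi> (qscale c v) = qscale c (\<psi> v)"
      "\<And>\<sigma> v. \<sigma> \<in> G \<Longrightarrow> v \<in> V \<Longrightarrow> \<psi> (act \<sigma> v) = act \<sigma> (\<psi> v)"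
    show ?thesis
      by (rule isomorphic_repsI[of "\<psi> \<circ> \<phi>"])
        (simp_all add: bij_betw_trans[OF b b'] \<phi> \<psi> m)
  qed
qed

context diagram
begin

text \<open>
  Equivariant linear maps on all series that are injective on the Specht module.  Each of the
  spaces \<open>V_space D M\<close> and \<open>V_vec D C h\<close> is the image of \<open>specht\<close> under such a map.
\<close>

definition embedding :: "(series \<Rightarrow> series) \<Rightarrow> bool"
  where "embedding \<Psi> \<longleftrightarrow> Vector_Spaces.linear qscale qscale \<Psi> \<and>
    (\<forall>\<sigma>\<in>S_nat. \<forall>v. \<Psi> (act \<sigma> v) = act \<sigma> (\<Psi> v)) \<and> inj_on \<Psi> specht"

text \<open>By irreducibility, injectivity only has to be checked at a single polytabloid.\<close>

lemma embeddingI: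
  assumes lin: "Vector_Spaces.linear qscale qscale \<Psi>"
    and equi: "\<And>\<sigma> v. \<sigma> \<in> S_nat \<Longrightarrow> \<Psi> (act \<sigma> v) = act \<sigma> (\<Psi> v)"
    and T: "T \<in> SYT D" "\<Psi> (polytabloid T) \<noteq> 0"
  shows "embedding \<Psi>"
proof -
  define K where "K = {v \<in> specht. \<Psi> v = 0}"
  have "qs.subspace K"
    unfolding K_def
    by (rule qs.subspaceI)
      (use subspace_specht in \<open>auto simp: qs2.linear_add[OF lin] qs2.linear_scale[OF lin]
        qs2.linear_0[OF lin] qs.subspace_0 qs.subspace_add qs.subspace_scale\<close>)
  moreover have "act \<sigma> v \<in> K" if "\<sigma> \<in> S_infty" "v \<in> K" for \<sigma> v
  proof -
    have S: "\<sigma> \<in> S_nat" using that(1) S_infty_subset by blast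
    have "act \<sigma> 0 = 0" by (rule qs2.linear_0[OF linear_act])
    then show ?thesis using that(2) equi[OF S] act_specht[OF S] by (simp add: K_def)
  qed
  moreover have "K \<subseteq> specht" by (auto simp: K_def)
  moreover have "polytabloid T \<in> specht" by (rule polytabloid_specht[OF SYT_numbering[OF T(1)]])
  then have "K \<noteq> specht" using T(2) by (auto simp: K_def)
  ultimately have K0: "u = 0" if "u \<in> K" for u using specht_minimal[of K u] that by blast
  have "inj_on \<Psi> specht"
  proof (rule inj_onI)
    fix u v assume "u \<in> specht" "v \<in> specht" "\<Psi> u = \<Psi> v"
    then have "u - v \<in> K"
      using qs.subspace_diff[OF subspace_specht] by (simp add: K_def qs2.linear_diff[OF lin])
    then have "u - v = 0" by (rule K0)
    then show "u = v" by simp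
  qed
  then show ?thesis using lin equi by (simp add: embedding_def)
qed

lemma embedding_representation:
  assumes e: "embedding \<Psi>" and G: "G \<subseteq> S_nat"
  shows "is_representation G (\<Psi> ` specht)"
  unfolding is_representation_iff[OF G]
proof (intro conjI ballI)
  have lin: "Vector_Spaces.linear qscale qscale \<Psi>" using e by (simp add: embedding_def)
  show "qs.subspace (\<Psi> ` specht)"
    by (rule qs2.linear_subspace_image[OF lin subspace_specht])
  fix \<sigma> w assume "\<sigma> \<in> G" "w \<in> \<Psi> ` specht"
  then obtain v where "v \<in> specht" "w = \<Psi> v" "\<sigma> \<in> S_nat" using G by blast
  then have "act \<sigma> w = \<Psi> (act \<sigma> v)" "act \<sigma> v \<in> specht"
    using e act_specht by (auto simp: embedding_def)
  then show "act \<sigma> w \<in> \<Psi> ` specht" by blast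
qed

lemma embedding_irreducible:
  assumes e: "embedding \<Psi>" and G: "S_infty \<subseteq> G" "G \<subseteq> S_nat"
  shows "irreducible_rep G (\<Psi> ` specht)"
  unfolding irreducible_rep_def
proof (intro conjI allI impI)
  have lin: "Vector_Spaces.linear qscale qscale \<Psi>" and inj: "inj_on \<Psi> specht"
    and equi: "\<And>\<sigma> v. \<sigma> \<in> S_nat \<Longrightarrow> \<Psi> (act \<sigma> v) = act \<sigma> (\<Psi> v)"
    using e by (auto simp: embedding_def)
  have zero: "\<Psi> 0 = 0" by (rule qs2.linear_0[OF lin])
  show "is_representation G (\<Psi> ` specht)" by (rule embedding_representation[OF e G(2)])
  obtain T where T: "T \<in> SYT D" "polytabloid T \<noteq> 0" using specht_nonzero by blast
  have "polytabloid T \<in> specht" by (rule polytabloid_specht[OF SYT_numbering[OF T(1)]])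
  moreover from this have "\<Psi> (polytabloid T) \<noteq> 0"
    using inj zero T(2) qs.subspace_0[OF subspace_specht] by (metis inj_onD)
  ultimately show "\<Psi> ` specht \<noteq> {0}" by blast
  fix W assume W: "W \<subseteq> \<Psi> ` specht \<and> is_representation G W"
  then have sW: "qs.subspace W" and aW: "\<And>\<sigma> v. \<sigma> \<in> G \<Longrightarrow> v \<in> W \<Longrightarrow> act \<sigma> v \<in> W"
    by (auto simp: is_representation_def)
  define U where "U = {v \<in> specht. \<Psi> v \<in> W}"
  have WU: "W = \<Psi> ` U" using W by (auto simp: U_def)
  have sU: "qs.subspace U"
    unfolding U_def
    by (rule qs.subspaceI)
      (use subspace_specht sW in \<open>auto simp: qs2.linear_add[OF lin] qs2.linear_scale[OF lin]
        zero qs.subspace_0 qs.subspace_add qs.subspace_scale\<close>)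
  have aU: "act \<sigma> v \<in> U" if "\<sigma> \<in> S_infty" "v \<in> U" for \<sigma> v
  proof -
    have S: "\<sigma> \<in> S_nat" "\<sigma> \<in> G" using that(1) G by auto
    show ?thesis using that(2) act_specht[OF S(1)] aW[OF S(2)] by (simp add: U_def equi[OF S(1)])
  qed
  have subU: "U \<subseteq> specht" by (auto simp: U_def)
  show "W = {0} \<or> W = \<Psi> ` specht"
  proof (cases "U \<subseteq> {0}")
    case True
    then have "U = {0}" using qs.subspace_0[OF sU] by blast
    then show ?thesis using WU zero by simp
  next
    case False
    then obtain u where "u \<in> U" "u \<noteq> 0" by blast
    then have "U = specht" using specht_minimal[OF sU aU subU] by blast
    then show ?thesis using WU by simp
  qed
qed

lemma specht_representation: "G \<subseteq> S_nat \<Longrightarrow> is_representation G specht"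
  using subspace_specht act_specht by (auto simp: is_representation_iff)

lemma embedding_isomorphic:
  assumes e: "embedding \<Psi>" and G: "G \<subseteq> S_nat"
  shows "isomorphic_reps G specht (\<Psi> ` specht)"
proof (rule isomorphic_repsI)
  have lin: "Vector_Spaces.linear qscale qscale \<Psi>" using e by (simp add: embedding_def)
  show "bij_betw \<Psi> specht (\<Psi> ` specht)" using e by (simp add: embedding_def bij_betw_def)
  show "\<Psi> (u + v) = \<Psi> u + \<Psi> v" for u v by (rule qs2.linear_add[OF lin])
  show "\<Psi> (qscale c v) = qscale c (\<Psi> v)" for c v by (rule qs2.linear_scale[OF lin])
  show "\<Psi> (act \<sigma> v) = act \<sigma> (\<Psi> v)" if "\<sigma> \<in> G" for \<sigma> v
    using e G that by (auto simp: embedding_def)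
qed

lemma embedding_isomorphic':
  "embedding \<Psi> \<Longrightarrow> G \<subseteq> S_nat \<Longrightarrow> isomorphic_reps G (\<Psi> ` specht) specht"
  using isomorphic_reps_sym[OF specht_representation embedding_isomorphic] by simp

lemma embedding_basis:
  assumes e: "embedding \<Psi>" and F: "\<And>T. T \<in> SYT D \<Longrightarrow> F T = \<Psi> (polytabloid T)"
  shows "is_basis F (SYT D) (\<Psi> ` specht)"
proof -
  have lin: "Vector_Spaces.linear qscale qscale \<Psi>" and inj: "inj_on \<Psi> specht"
    using e by (auto simp: embedding_def)
  have b: "inj_on polytabloid (SYT D)" "qs.independent (polytabloid ` SYT D)"
    using polytabloid_basis by (auto simp: is_basis_def)
  have im: "F ` SYT D = \<Psi> ` polytabloid ` SYT D" using F by force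
  have "inj_on F (SYT D)"
  proof (rule inj_onI)
    fix T T' assume *: "T \<in> SYT D" "T' \<in> SYT D" "F T = F T'"
    then have "polytabloid T = polytabloid T'"
      using F inj polytabloid_specht SYT_numbering by (metis inj_onD)
    then show "T = T'" using b(1) * by (auto dest: inj_onD)
  qed
  moreover have "qs.independent (F ` SYT D)"
    unfolding im by (rule qs2.linear_independent_injective_image[OF lin b(2)]) (use inj in \<open>simp add: specht_def\<close>)
  moreover have "qs.span (F ` SYT D) = \<Psi> ` specht"
    unfolding im specht_def by (rule qs2.linear_span_image[OF lin])
  ultimately show ?thesis by (simp add: is_basis_def)
qed

lemma embedding_tableau_hom:
  assumes "M \<in> SSYT D" shows "embedding (tableau_hom M)"
proof -
  obtain T where T: "T \<in> SYT D" using specht_nonzero by blast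
  show ?thesis
    by (rule embeddingI[OF linear_tableau_hom tableau_hom_act T])
      (simp_all add: tableau_hom_polytabloid assms T F_series_nonzero)
qed

lemma V_space_image: "M \<in> SSYT D \<Longrightarrow> V_space D M = tableau_hom M ` specht"
proof -
  assume M: "M \<in> SSYT D"
  have "F_series D M ` SYT D = tableau_hom M ` polytabloid ` SYT D"
    using tableau_hom_polytabloid[OF M] by force
  then show ?thesis
    unfolding V_space_def specht_def by (simp only: qs2.linear_span_image[OF linear_tableau_hom])
qed

text \<open>The product of elementary symmetric functions that defines \<open>V_vec\<close>.\<close>

definition elem_prod :: "(nat \<Rightarrow> nat) \<Rightarrow> series"
  where "elem_prod h = (\<Prod>r\<in>{r. 1 \<le> r \<and> h r \<noteq> 0}. elem_sym r ^ h r)"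

lemma embedding_tableau_hom_mult:
  assumes M: "M \<in> SSYT D"
  shows "embedding (\<lambda>v. tableau_hom M v * elem_prod h)"
proof -
  obtain T where T: "T \<in> SYT D" using specht_nonzero by blast
  have "elem_prod h \<noteq> 0"
    unfolding elem_prod_def
    by (cases "finite {r. 1 \<le> r \<and> h r \<noteq> 0}") (auto simp: prod_zero_iff elem_sym_nonzero)
  then have "tableau_hom M (polytabloid T) * elem_prod h \<noteq> 0"
    by (simp add: tableau_hom_polytabloid M T F_series_nonzero)
  moreover have "Vector_Spaces.linear qscale qscale (\<lambda>v. tableau_hom M v * elem_prod h)"
    using linear_tableau_hom[of M] by (simp add: linear_qscale distrib_right qscale_mult)
  moreover have "tableau_hom M (act \<sigma> v) * elem_prod h = act \<sigma> (tableau_hom M v * elem_prod h)"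
    if "\<sigma> \<in> S_nat" for \<sigma> v
    using act_prod_elem_sym[OF that] S_natD(1)[OF that]
    by (simp add: tableau_hom_act[OF that] act_mult elem_prod_def)
  ultimately show ?thesis using T by (intro embeddingI) 
qed

lemma V_vec_image: "M \<in> SSYT D \<Longrightarrow> V_vec D M h = (\<lambda>v. tableau_hom M v * elem_prod h) ` specht"
  by (simp add: V_vec_def V_space_image elem_prod_def image_image)

lemma shape_reps_embedding:
  assumes "U \<in> shape_reps D" obtains \<Psi> where "embedding \<Psi>" "U = \<Psi> ` specht"
proof -
  have "C \<in> SSYT D" if "C \<in> CCT D" for C using that by (simp add: CCT_def)
  then have "\<exists>\<Psi>. embedding \<Psi> \<and> U = \<Psi> ` specht"
    using assms embedding_tableau_hom embedding_tableau_hom_mult V_space_image V_vec_image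
    unfolding shape_reps_def by (smt (verit) Un_iff mem_Collect_eq)
  then show ?thesis using that by blast
qed

lemma F_hom_eq:
  assumes I: "0 \<notin># I" and C: "C \<in> SSYT D" and T: "T \<in> SYT D"
  shows "F_hom D C I T = tableau_hom C (polytabloid T) * elem_prod (h_hom D C I)"
proof -
  let ?J = "I - mset_set (Dspc_set D C)"
  have "0 \<notin># ?J" using I by (meson in_diffD)
  then have "{r. 1 \<le> r \<and> h_hom D C I r \<noteq> 0} = set_mset ?J"
    unfolding h_hom_def by (auto simp: count_eq_zero_iff Suc_le_eq intro: gr0I simp del: count_diff)
  then have "elem_prod (h_hom D C I) = prod_mset (image_mset elem_sym ?J)"
    unfolding elem_prod_def image_prod_mset_multiplicity by (simp add: h_hom_def)
  then show ?thesis by (simp add: F_hom_def tableau_hom_polytabloid C T)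
qed

lemma F_set_eq:
  assumes I: "finite I" and C: "C \<in> SSYT D" and T: "T \<in> SYT D"
  shows "F_set D C I T = tableau_hom C (polytabloid T) * elem_prod (h_set D C I)"
proof -
  let ?J = "I - Dspc_set D C"
  have fin: "finite ?J" using I by simp
  have cnt: "h_set D C I r \<noteq> 0 \<longleftrightarrow> r \<in> r_idx I ` ?J" for r
  proof -
    have "finite {i \<in> ?J. r_idx I i = r}" using fin by (rule rev_finite_subset) auto
    then show ?thesis unfolding h_set_def by (auto simp: card_eq_0_iff)
  qed
  have "(\<Prod>i\<in>?J. elem_sym (r_idx I i)) = (\<Prod>r\<in>r_idx I ` ?J. \<Prod>i\<in>{i \<in> ?J. r_idx I i = r}. elem_sym (r_idx I i))"
    by (rule prod.image_gen[OF fin])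
  also have "\<dots> = (\<Prod>r\<in>r_idx I ` ?J. elem_sym r ^ h_set D C I r)"
    by (rule prod.cong) (auto simp: h_set_def)
  also have "\<dots> = (\<Prod>r\<in>{r. 1 \<le> r \<and> h_set D C I r \<noteq> 0}. elem_sym r ^ h_set D C I r)"
  proof (rule prod.mono_neutral_right)
    show "{r. 1 \<le> r \<and> h_set D C I r \<noteq> 0} \<subseteq> r_idx I ` ?J" using cnt by blast
    show "\<forall>r\<in>r_idx I ` ?J - {r. 1 \<le> r \<and> h_set D C I r \<noteq> 0}. elem_sym r ^ h_set D C I r = 1"
    proof
      fix r assume "r \<in> r_idx I ` ?J - {r. 1 \<le> r \<and> h_set D C I r \<noteq> 0}"
      then have "r = 0" using cnt[of r] by auto
      then show "elem_sym r ^ h_set D C I r = 1" by (simp add: elem_sym_0)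
    qed
  qed (use fin in simp)
  finally show ?thesis by (simp add: F_set_def tableau_hom_polytabloid C T elem_prod_def)
qed

end

lemma isomorphic_specht_le:
  assumes D: "diagram D" and D': "diagram D'" and G: "S_infty \<subseteq> G" and k: "k \<ge> 1"
    and iso: "isomorphic_reps G (diagram.specht D) (diagram.specht D')"
  shows "card {b \<in> D. k \<le> fst b} \<le> card {b \<in> D'. k \<le> fst b}"
  using iso
proof (rule isomorphic_repsE)
  fix \<phi> assume b: "bij_betw \<phi> (diagram.specht D) (diagram.specht D')" and
    \<phi>: "\<And>u v. u \<in> diagram.specht D \<Longrightarrow> v \<in> diagram.specht D \<Longrightarrow> \<phi> (u + v) = \<phi> u + \<phi> v"
    "\<And>c v. v \<in> diagram.specht D \<Longrightarrow> \<phi> (qscale c v) = qscale c (\<phi> v)"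
    "\<And>\<sigma> v. \<sigma> \<in> G \<Longrightarrow> v \<in> diagram.specht D \<Longrightarrow> \<phi> (act \<sigma> v) = act \<sigma> (\<phi> v)"
  show ?thesis
    by (rule specht_hom_dominance[OF D D' \<phi>(1,2) \<phi>(3) _ _ k])
      (use b G in \<open>auto simp: bij_betw_def\<close>)
qed

text \<open>Images of the Specht modules of different shapes are not isomorphic.\<close>

lemma isomorphic_shapes:
  assumes D: "diagram D" and D': "diagram D'"
    and e: "diagram.embedding D \<Psi>" and e': "diagram.embedding D' \<Psi>'"
    and G: "S_infty \<subseteq> G" "G \<subseteq> S_nat"
    and iso: "isomorphic_reps G (\<Psi> ` diagram.specht D) (\<Psi>' ` diagram.specht D')"
  shows "D = D'"
proof -
  have iso1: "isomorphic_reps G (diagram.specht D) (diagram.specht D')"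
    using diagram.embedding_isomorphic[OF D e G(2)] iso diagram.embedding_isomorphic'[OF D' e' G(2)]
    by (blast intro: isomorphic_reps_trans)
  have iso2: "isomorphic_reps G (diagram.specht D') (diagram.specht D)"
    by (rule isomorphic_reps_sym[OF diagram.specht_representation[OF D G(2)] iso1])
  show ?thesis
    by (rule diagram_eqI[OF D D'])
      (intro antisym isomorphic_specht_le[OF D D' G(1) _ iso1] isomorphic_specht_le[OF D' D G(1) _ iso2])
qed

section \<open>Bases, irreducibility and isomorphism types\<close>

theorem theorem2p19:
  fixes D :: "box set" and M C :: infinite_ssyt
  assumes "ferrers_infty D" and "M \<in> SSYT D" and "C \<in> CCT D"
  shows
    "(is_basis (F_series D M) (SYT D) (V_space D M) \<and>
      (\<forall>I :: nat set. finite I \<and> I \<subseteq> {1..} \<and> Dspc_set D C \<subseteq> I \<longrightarrow>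
         is_basis (F_set D C I) (SYT D) (V_vec D C (h_set D C I))) \<and>
      (\<forall>I :: nat multiset. 0 \<notin># I \<and> Dspc_set D C \<subseteq> set_mset I \<longrightarrow>
         is_basis (F_hom D C I) (SYT D) (V_vec D C (h_hom D C I)))) \<and>
     (\<forall>G \<in> {S_nat, S_infty}.
        is_representation G (V_space D M) \<and>
        (\<forall>h. finite_vec h \<longrightarrow> is_representation G (V_vec D C h))) \<and>
     (\<forall>G \<in> {S_nat, S_infty}. \<forall>U \<in> shape_reps D. \<forall>W \<in> shape_reps D.
        isomorphic_reps G U W) \<and>
     (\<forall>G \<in> {S_nat, S_infty}.
        irreducible_rep G (V_space D M) \<and>
        (\<forall>h. finite_vec h \<longrightarrow> irreducible_rep G (V_vec D C h))) \<and>
     (\<forall>G \<in> {S_nat, S_infty}. \<forall>D'. ferrers_infty D' \<and> D' \<noteq> D \<longrightarrow>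
        (\<forall>U \<in> shape_reps D. \<forall>W \<in> shape_reps D'. \<not> isomorphic_reps G U W))"
proof -
  have D: "diagram D" using assms(1) by (rule diagram.intro)
  interpret diagram D by (rule D)
  have C: "C \<in> SSYT D" using assms(3) by (simp add: CCT_def)
  have G: "S_infty \<subseteq> G \<and> G \<subseteq> S_nat" if "G \<in> {S_nat, S_infty}" for G
    using that S_infty_subset by auto
  note eM = embedding_tableau_hom[OF assms(2)] and eC = embedding_tableau_hom_mult[OF C]
  show ?thesis
  proof (intro conjI ballI allI impI)
    show "is_basis (F_series D M) (SYT D) (V_space D M)"
      unfolding V_space_image[OF assms(2)]
      by (rule embedding_basis[OF eM]) (simp add: tableau_hom_polytabloid assms(2))
  next
    fix I :: "nat set" assume "finite I \<and> I \<subseteq> {1..} \<and> Dspc_set D C \<subseteq> I"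
    then show "is_basis (F_set D C I) (SYT D) (V_vec D C (h_set D C I))"
      unfolding V_vec_image[OF C] by (intro embedding_basis[OF eC] F_set_eq C) auto
  next
    fix I :: "nat multiset" assume "0 \<notin># I \<and> Dspc_set D C \<subseteq> set_mset I"
    then show "is_basis (F_hom D C I) (SYT D) (V_vec D C (h_hom D C I))"
      unfolding V_vec_image[OF C] by (intro embedding_basis[OF eC] F_hom_eq C) auto
  next
    fix G assume "G \<in> {S_nat, S_infty}"
    note G = G[OF this]
    show "is_representation G (V_space D M)" "irreducible_rep G (V_space D M)"
      unfolding V_space_image[OF assms(2)]
      using G embedding_representation[OF eM] embedding_irreducible[OF eM] by auto
    fix h
    show "is_representation G (V_vec D C h)" "irreducible_rep G (V_vec D C h)"
      unfolding V_vec_image[OF C]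
      using G embedding_representation[OF eC] embedding_irreducible[OF eC] by auto
  next
    fix G U W assume "G \<in> {S_nat, S_infty}" and UW: "U \<in> shape_reps D" "W \<in> shape_reps D"
    note G = G[OF this(1)]
    obtain \<Psi> where \<Psi>: "embedding \<Psi>" "U = \<Psi> ` specht" using shape_reps_embedding[OF UW(1)] .
    obtain \<Psi>' where \<Psi>': "embedding \<Psi>'" "W = \<Psi>' ` specht" using shape_reps_embedding[OF UW(2)] .
    show "isomorphic_reps G U W"
      unfolding \<Psi>(2) \<Psi>'(2)
      by (rule isomorphic_reps_trans[OF embedding_isomorphic' embedding_isomorphic])
        (use \<Psi>(1) \<Psi>'(1) G in auto)
  next
    fix G D' U W
    assume "G \<in> {S_nat, S_infty}" and D': "ferrers_infty D' \<and> D' \<noteq> D"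
      and UW: "U \<in> shape_reps D" "W \<in> shape_reps D'"
    note G = G[OF this(1)]
    have dD': "diagram D'" using D' by (simp add: diagram.intro)
    obtain \<Psi> where \<Psi>: "embedding \<Psi>" "U = \<Psi> ` specht" using shape_reps_embedding[OF UW(1)] .
    obtain \<Psi>' where \<Psi>': "diagram.embedding D' \<Psi>'" "W = \<Psi>' ` diagram.specht D'"
      using diagram.shape_reps_embedding[OF dD' UW(2)] .
    show "\<not> isomorphic_reps G U W"
      using isomorphic_shapes[OF D dD' \<Psi>(1) \<Psi>'(1)] G D' unfolding \<Psi>(2) \<Psi>'(2) by blast
  qed
qed

end
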